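(* Bounded Extension Roman Domination, parameterized by the weight $\omega(f)=\sum_{v\in V}f(v)$ of the lower-bound function $f$, is W[3]-hard, even when restricted to split graphs.
   Context: For a graph $G=(V,E)$, a function $g:V\to\{0,1,2\}$ is a Roman dominating function (rdf) if every $v$ with $g(v)=0$ has a neighbor $u$ with $g(u)=2$. Functions are ordered pointwise; an rdf $g$ is minimal if every rdf $g'\le g$ equals $g$. Bounded Extension Roman Domination: given a graph $G=(V,E)$ and functions $f,h:V\to\{0,1,2\}$, decide whether there is a minimal rdf $g$ with $f\le g\le h$. A split graph is one whose vertex set partitions into a clique and an independent set. *)

theory Defs
  imports Main
begin

section \<open>Model of computation\<close>

text \<open>
  Programs are first-order function expressions over binary trees, with an unbounded
  while loop. A basic operation costs the number of nodes of its argument, and a compound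
  expression costs one more than all the evaluations it triggers. Hence the cost of a run
  bounds the size of every tree occurring in it (\<open>exec_cost_ge_input\<close>,
  \<open>exec_cost_ge_output\<close>): sharing subtrees cannot be used to build exponentially large trees
  cheaply. Consequently this model and multitape Turing machines simulate each other with
  polynomial overhead, for functions as well as for decision problems, so the notions
  of computable function and of fpt time below are the usual ones.
\<close>

datatype tree = Lf | Br tree tree

primrec tsize :: "tree \<Rightarrow> nat" where
  "tsize Lf = 1"
| "tsize (Br a b) = Suc (tsize a + tsize b)"

fun left :: "tree \<Rightarrow> tree" where
  "left Lf = Lf"
| "left (Br a b) = a"

fun right :: "tree \<Rightarrow> tree" where
  "right Lf = Lf"
| "right (Br a b) = b"

datatype prog =
    Ident
  | Nul
  | LeftP
  | RightP
  | EqP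
  | Fork prog prog
  | Seq prog prog
  | Cond prog prog prog
  | While prog prog

text \<open>\<open>exec p x y t\<close>: on input \<open>x\<close>, program \<open>p\<close> halts with output \<open>y\<close> after a run of cost \<open>t\<close>.
  As truth values, \<open>Lf\<close> is false and every other tree is true.\<close>

inductive exec :: "prog \<Rightarrow> tree \<Rightarrow> tree \<Rightarrow> nat \<Rightarrow> bool" where
  exec_Ident: "exec Ident x x (tsize x)"
| exec_Nul: "exec Nul x Lf (tsize x)"
| exec_LeftP: "exec LeftP x (left x) (tsize x)"
| exec_RightP: "exec RightP x (right x) (tsize x)"
| exec_EqP: "exec EqP x (if \<exists>a. x = Br a a then Br Lf Lf else Lf) (tsize x)"
| exec_Fork: "exec p x y s \<Longrightarrow> exec q x z t \<Longrightarrow> exec (Fork p q) x (Br y z) (Suc (s + t))"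
| exec_Seq: "exec p x y s \<Longrightarrow> exec q y z t \<Longrightarrow> exec (Seq p q) x z (Suc (s + t))"
| exec_Cond_true: "exec b x w r \<Longrightarrow> w \<noteq> Lf \<Longrightarrow> exec p x y s \<Longrightarrow> exec (Cond b p q) x y (Suc (r + s))"
| exec_Cond_false: "exec b x Lf r \<Longrightarrow> exec q x y s \<Longrightarrow> exec (Cond b p q) x y (Suc (r + s))"
| exec_While_stop: "exec b x Lf r \<Longrightarrow> exec (While b p) x x (Suc r)"
| exec_While_step: "exec b x w r \<Longrightarrow> w \<noteq> Lf \<Longrightarrow> exec p x y s \<Longrightarrow> exec (While b p) y z t
    \<Longrightarrow> exec (While b p) x z (Suc (r + s + t))"

inductive_cases exec_elims:
  "exec Ident x y t" "exec Nul x y t" "exec LeftP x y t" "exec RightP x y t" "exec EqP x y t"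
  "exec (Fork p q) x y t" "exec (Seq p q) x y t" "exec (Cond b p q) x y t"

inductive_cases exec_WhileE: "exec (While b p) x y t"

lemma tsize_pos: "1 \<le> tsize x"
  by (cases x) auto

lemma exec_cost_ge_input: "exec p x y t \<Longrightarrow> tsize x \<le> t"
  by (induction rule: exec.induct) auto

lemma exec_cost_ge_output: "exec p x y t \<Longrightarrow> tsize y \<le> t"
proof (induction rule: exec.induct)
  case (exec_LeftP x) then show ?case by (cases x) auto
next
  case (exec_RightP x) then show ?case by (cases x) auto
next
  case (exec_EqP x)
  have "Suc 0 < tsize a + tsize a" for a
    using tsize_pos[of a] by linarith
  then show ?case using tsize_pos[of x] by (auto simp: Suc_le_eq)
qed (auto dest: exec_cost_ge_input simp: tsize_pos[simplified])

lemma exec_deterministic: "exec p x y t \<Longrightarrow> exec p x y' t' \<Longrightarrow> y' = y \<and> t' = t"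
proof (induction arbitrary: y' t' rule: exec.induct)
  case exec_Fork from exec_Fork.prems show ?case
    by (elim exec_elims) (auto dest!: exec_Fork.IH)
next
  case exec_Seq from exec_Seq.prems show ?case
    by (elim exec_elims) (metis exec_Seq.IH)
next
  case exec_Cond_true from exec_Cond_true.prems exec_Cond_true.hyps show ?case
    by (elim exec_elims) (metis exec_Cond_true.IH)+
next
  case exec_Cond_false from exec_Cond_false.prems show ?case
    by (elim exec_elims) (metis exec_Cond_false.IH)+
next
  case exec_While_stop
  show ?case
    by (rule exec_WhileE[OF exec_While_stop.prems]) (metis exec_While_stop.IH)+
next
  case exec_While_step
  show ?case
    by (rule exec_WhileE[OF exec_While_step.prems])
       (metis exec_While_step.IH exec_While_step.hyps)+
qed (auto elim!: exec_elims)

subsection \<open>Encodings\<close>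

text \<open>Numbers are written in unary, so the size of an encoded graph or circuit is polynomial
  in its number of vertices or nodes.\<close>

primrec enc_nat :: "nat \<Rightarrow> tree" where
  "enc_nat 0 = Lf"
| "enc_nat (Suc n) = Br Lf (enc_nat n)"

primrec enc_list :: "('a \<Rightarrow> tree) \<Rightarrow> 'a list \<Rightarrow> tree" where
  "enc_list e [] = Lf"
| "enc_list e (x # xs) = Br (e x) (enc_list e xs)"

fun enc_pair :: "('a \<Rightarrow> tree) \<Rightarrow> ('b \<Rightarrow> tree) \<Rightarrow> 'a \<times> 'b \<Rightarrow> tree" where
  "enc_pair e e' (a, b) = Br (e a) (e' b)"

lemma inj_enc_nat: "inj enc_nat"
proof (rule injI)
  show "m = n" if "enc_nat m = enc_nat n" for m n
    using that
  proof (induction m arbitrary: n)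
    case 0 then show ?case by (cases n) auto
  next
    case (Suc m) then show ?case by (cases n) auto
  qed
qed

lemma inj_enc_list: assumes "inj e" shows "inj (enc_list e)"
proof (rule injI)
  show "xs = ys" if "enc_list e xs = enc_list e ys" for xs ys
    using that
  proof (induction xs arbitrary: ys)
    case Nil then show ?case by (cases ys) auto
  next
    case (Cons x xs) then show ?case by (cases ys) (auto dest: injD[OF assms])
  qed
qed

lemma inj_enc_pair: "inj e \<Longrightarrow> inj e' \<Longrightarrow> inj (enc_pair e e')"
  by (auto simp: inj_def)

section \<open>Parameterized complexity\<close>

text \<open>A parameterized problem is a set of pairs of a word and a parameter value; trees
  play the role of words.\<close>

type_synonym param_problem = "(tree \<times> nat) set"

definition computable :: "(nat \<Rightarrow> nat) \<Rightarrow> bool" where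
  "computable f \<longleftrightarrow> (\<exists>p. \<forall>n. \<exists>t. exec p (enc_nat n) (enc_nat (f n)) t)"

text \<open>\<open>P\<close> reduces to \<open>Q\<close> by a (many-one, strongly uniform) fpt-reduction all of whose outputs
  lie in \<open>D\<close>. With \<open>D = UNIV\<close> this is the ordinary fpt-reducibility; in general it is
  fpt-reducibility to the restriction of \<open>Q\<close> to the instance class \<open>D\<close>.\<close>

definition fpt_reducible_into :: "param_problem \<Rightarrow> param_problem \<Rightarrow> param_problem \<Rightarrow> bool" where
  "fpt_reducible_into D P Q \<longleftrightarrow>
     (\<exists>p f g c. computable f \<and> computable g \<and>
       (\<forall>x k. \<exists>x' k' t.
          exec p (Br x (enc_nat k)) (Br x' (enc_nat k')) t \<and>
          t \<le> f k * tsize x ^ c \<and>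
          k' \<le> g k \<and>
          ((x, k) \<in> P \<longleftrightarrow> (x', k') \<in> Q) \<and>
          (x', k') \<in> D))"

definition fpt_reducible :: "param_problem \<Rightarrow> param_problem \<Rightarrow> bool" where
  "fpt_reducible P Q \<longleftrightarrow> fpt_reducible_into UNIV P Q"

subsection \<open>Boolean circuits\<close>

text \<open>A circuit has its nodes numbered in a topological order: first the input nodes
  \<open>0, \<dots>, inputs - 1\<close>, then one node for each entry of the list of gates. A gate lists
  the numbers of its predecessors. The last gate is the output.\<close>

datatype gate = Neg nat | Conj "nat list" | Disj "nat list"

type_synonym circuit = "nat \<times> gate list"

fun preds :: "gate \<Rightarrow> nat list" where
  "preds (Neg i) = [i]"
| "preds (Conj is) = is"
| "preds (Disj is) = is"

fun wf_circuit :: "circuit \<Rightarrow> bool" where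
  "wf_circuit (n, gs) \<longleftrightarrow> gs \<noteq> [] \<and>
     (\<forall>j < length gs. preds (gs ! j) \<noteq> [] \<and> (\<forall>i \<in> set (preds (gs ! j)). i < n + j))"

definition node_values :: "(gate \<Rightarrow> 'b list \<Rightarrow> 'b) \<Rightarrow> 'b list \<Rightarrow> gate list \<Rightarrow> 'b list" where
  "node_values F init gs = foldl (\<lambda>vs g. vs @ [F g (map (\<lambda>i. vs ! i) (preds g))]) init gs"

fun gate_value :: "gate \<Rightarrow> bool list \<Rightarrow> bool" where
  "gate_value (Neg _) bs \<longleftrightarrow> \<not> hd bs"
| "gate_value (Conj _) bs \<longleftrightarrow> (\<forall>b \<in> set bs. b)"
| "gate_value (Disj _) bs \<longleftrightarrow> (\<exists>b \<in> set bs. b)"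

fun circuit_value :: "circuit \<Rightarrow> bool list \<Rightarrow> bool" where
  "circuit_value (n, gs) a = last (node_values gate_value a gs)"

text \<open>The depth is the maximal number of gates, and the weft the maximal number of large gates
  (those of fan-in greater than two), on a path from an input node to the output.\<close>

fun depth :: "circuit \<Rightarrow> nat" where
  "depth (n, gs) = last (node_values (\<lambda>g ds. Suc (Max (set ds))) (replicate n 0) gs)"

definition large :: "gate \<Rightarrow> bool" where
  "large g \<longleftrightarrow> length (preds g) > 2"

fun weft :: "circuit \<Rightarrow> nat" where
  "weft (n, gs) =
     last (node_values (\<lambda>g ws. (if large g then 1 else 0) + Max (set ws)) (replicate n 0) gs)"

fun enc_gate :: "gate \<Rightarrow> tree" where
  "enc_gate (Neg i) = Br (enc_nat 0) (enc_nat i)"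
| "enc_gate (Conj is) = Br (enc_nat 1) (enc_list enc_nat is)"
| "enc_gate (Disj is) = Br (enc_nat 2) (enc_list enc_nat is)"

definition enc_circuit :: "circuit \<Rightarrow> tree" where
  "enc_circuit = enc_pair enc_nat (enc_list enc_gate)"

lemma inj_enc_gate: "inj enc_gate"
proof (rule injI)
  show "g = h" if "enc_gate g = enc_gate h" for g h
    using that
    by (cases g; cases h)
       (auto simp: numeral_2_eq_2 dest: injD[OF inj_enc_nat] injD[OF inj_enc_list[OF inj_enc_nat]])
qed

lemma inj_enc_circuit: "inj enc_circuit"
  unfolding enc_circuit_def by (intro inj_enc_pair inj_enc_nat inj_enc_list inj_enc_gate)

subsection \<open>The W-hierarchy\<close>

definition weighted_sat :: "circuit \<Rightarrow> nat \<Rightarrow> bool" where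
  "weighted_sat C k \<longleftrightarrow>
     (\<exists>a. length a = fst C \<and> card {i. i < length a \<and> a ! i} = k \<and> circuit_value C a)"

definition WCS :: "nat \<Rightarrow> nat \<Rightarrow> param_problem" where
  "WCS t d = {(enc_circuit C, k) | C k.
     wf_circuit C \<and> weft C \<le> t \<and> depth C \<le> d \<and> weighted_sat C k}"

definition W :: "nat \<Rightarrow> param_problem set" where
  "W t = {P. \<exists>d. fpt_reducible P (WCS t d)}"

definition W_hard :: "nat \<Rightarrow> param_problem \<Rightarrow> bool" where
  "W_hard t Q \<longleftrightarrow> (\<forall>P \<in> W t. fpt_reducible P Q)"

definition W_hard_on :: "param_problem \<Rightarrow> nat \<Rightarrow> param_problem \<Rightarrow> bool" where
  "W_hard_on D t Q \<longleftrightarrow> (\<forall>P \<in> W t. fpt_reducible_into D P Q)"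

section \<open>Roman domination\<close>

definition simple_graph :: "'a set \<Rightarrow> 'a set set \<Rightarrow> bool" where
  "simple_graph V E \<longleftrightarrow> finite V \<and> (\<forall>e \<in> E. e \<subseteq> V \<and> card e = 2)"

definition split_graph :: "'a set \<Rightarrow> 'a set set \<Rightarrow> bool" where
  "split_graph V E \<longleftrightarrow> simple_graph V E \<and>
     (\<exists>C I. C \<union> I = V \<and> C \<inter> I = {} \<and>
        (\<forall>u \<in> C. \<forall>v \<in> C. u \<noteq> v \<longrightarrow> {u, v} \<in> E) \<and>
        (\<forall>u \<in> I. \<forall>v \<in> I. {u, v} \<notin> E))"

text \<open>A function from \<open>V\<close> to \<open>{0,1,2}\<close> is a function on the whole type of which only the values
  on \<open>V\<close> matter.\<close>

definition labelling :: "'a set \<Rightarrow> ('a \<Rightarrow> nat) \<Rightarrow> bool" where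
  "labelling V g \<longleftrightarrow> (\<forall>v \<in> V. g v \<in> {0, 1, 2})"

definition weight :: "'a set \<Rightarrow> ('a \<Rightarrow> nat) \<Rightarrow> nat" where
  "weight V g = (\<Sum>v \<in> V. g v)"

definition rdf :: "'a set \<Rightarrow> 'a set set \<Rightarrow> ('a \<Rightarrow> nat) \<Rightarrow> bool" where
  "rdf V E g \<longleftrightarrow> labelling V g \<and> (\<forall>v \<in> V. g v = 0 \<longrightarrow> (\<exists>u \<in> V. {u, v} \<in> E \<and> g u = 2))"

definition minimal_rdf :: "'a set \<Rightarrow> 'a set set \<Rightarrow> ('a \<Rightarrow> nat) \<Rightarrow> bool" where
  "minimal_rdf V E g \<longleftrightarrow> rdf V E g \<and>
     (\<forall>g'. rdf V E g' \<longrightarrow> (\<forall>v \<in> V. g' v \<le> g v) \<longrightarrow> (\<forall>v \<in> V. g' v = g v))"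

definition bounded_extension ::
  "'a set \<Rightarrow> 'a set set \<Rightarrow> ('a \<Rightarrow> nat) \<Rightarrow> ('a \<Rightarrow> nat) \<Rightarrow> bool" where
  "bounded_extension V E f h \<longleftrightarrow>
     (\<exists>g. minimal_rdf V E g \<and> (\<forall>v \<in> V. f v \<le> g v \<and> g v \<le> h v))"

subsection \<open>Bounded Extension Roman Domination as a parameterized problem\<close>

text \<open>An instance \<open>(n, es, fs, hs)\<close> represents the graph on \<open>{..<n}\<close> with edge list \<open>es\<close>,
  and the lower and upper bounds as lists of values.\<close>

type_synonym berd_instance = "nat \<times> (nat \<times> nat) list \<times> nat list \<times> nat list"

fun verts :: "berd_instance \<Rightarrow> nat set" where
  "verts (n, es, fs, hs) = {..<n}"

fun edges :: "berd_instance \<Rightarrow> nat set set" where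
  "edges (n, es, fs, hs) = (\<lambda>(u, v). {u, v}) ` set es"

fun lower :: "berd_instance \<Rightarrow> nat \<Rightarrow> nat" where
  "lower (n, es, fs, hs) v = fs ! v"

fun upper :: "berd_instance \<Rightarrow> nat \<Rightarrow> nat" where
  "upper (n, es, fs, hs) v = hs ! v"

fun wf_berd :: "berd_instance \<Rightarrow> bool" where
  "wf_berd (n, es, fs, hs) \<longleftrightarrow>
     simple_graph (verts (n, es, fs, hs)) (edges (n, es, fs, hs)) \<and>
     length fs = n \<and> labelling {..<n} (\<lambda>v. fs ! v) \<and>
     length hs = n \<and> labelling {..<n} (\<lambda>v. hs ! v)"

definition enc_berd :: "berd_instance \<Rightarrow> tree" where
  "enc_berd = enc_pair enc_nat (enc_pair (enc_list (enc_pair enc_nat enc_nat))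
     (enc_pair (enc_list enc_nat) (enc_list enc_nat)))"

lemma inj_enc_berd: "inj enc_berd"
  unfolding enc_berd_def by (intro inj_enc_pair inj_enc_nat inj_enc_list)

text \<open>The parameter that accompanies an instance is the weight of its lower bound.\<close>

definition BERD :: param_problem where
  "BERD = {(enc_berd J, weight (verts J) (lower J)) | J.
     wf_berd J \<and> bounded_extension (verts J) (edges J) (lower J) (upper J)}"

definition BERD_split_instances :: "(tree \<times> nat) set" where
  "BERD_split_instances = {(enc_berd J, weight (verts J) (lower J)) | J.
     wf_berd J \<and> split_graph (verts J) (edges J)}"

end

theory Submission
  imports Defs
begin

text \<open>
  A circuit of weft 3 and bounded depth unfolds into a formula in which bounded conjunctions can be
  multiplied out, so that it has the shape \<open>\<exists>u. \<forall>i. \<exists>j. \<forall>l. \<not> l\<close> with each \<open>l\<close> a conjunction of at most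
  \<open>m = 2 ^ d\<close> literals. Relative to a set \<open>T\<close> of \<open>k\<close> true variables, the truth of a literal is
  certified by one of the \<open>k + 1\<close> gaps between consecutive elements of \<open>T\<close>, hence that of \<open>l\<close> by
  an \<open>m\<close>-tuple of gaps.

  The Roman domination instance has a vertex of lower bound 2 for each of the \<open>(k + 1) ^ m\<close> tuples of
  gap indices, and one more. Such a vertex needs a private neighbour, which chooses the values of
  the gaps, respectively \<open>u\<close>. For each \<open>(u, i)\<close> a vertex of upper bound 0 has to be dominated by some
  \<open>j\<close>, and a vertex \<open>j\<close> of value 2 spoils the privacy of all tuples that certify an \<open>l\<close> belonging
  to \<open>j\<close>. All slots and all \<open>j\<close> form a clique, so that no private neighbour is found elsewhere.
\<close>

section \<open>Polynomial time\<close>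

text \<open>A vertex \<open>j\<close> only reacts to single candidates: it spoils those it is
  adjacent to. So the truth of a conjunction \<open>l\<close>, which involves up to \<open>m\<close>
  literals, has to be visible in one choice; this forces slots for whole tuples of gaps and makes a
  bound on the number of literals indispensable. Gaps replace variables because that
  \<open>y\<close> is outside \<open>T\<close> depends on all \<open>k\<close> elements at once, but
  is visible in the one gap that contains \<open>y\<close>.

  The choices in different slots are made independently. Agreement is enforced by pairwise clauses,
  each of which excludes two conflicting candidates, and \<open>T\<close> is then read off the
  constant tuples \<open>(s, ..., s)\<close>. The outer choice of \<open>u\<close> gets a slot of
  its own, so that the quantifier over \<open>i\<close> becomes a plain list of clauses, each void
  unless its \<open>u\<close> is chosen.

  Membership in W[3] fixes a depth bound \<open>d\<close> before the reduction is chosen. Hence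
  \<open>2 ^ d\<close> is a constant: there are polynomially many tuples of gaps, all recursions
  along \<open>d\<close> unroll into a fixed program, and the new parameter depends on
  \<open>k\<close> alone.\<close>

definition poly_bounded :: "(tree \<Rightarrow> nat) \<Rightarrow> bool" where
  "poly_bounded h \<longleftrightarrow> (\<exists>C e. \<forall>x. h x \<le> C * tsize x ^ e)"

lemma poly_boundedI: "(\<And>x. h x \<le> C * tsize x ^ e) \<Longrightarrow> poly_bounded h"
  unfolding poly_bounded_def by blast

lemma poly_bounded_le:
  assumes "poly_bounded h" "\<And>x. h' x \<le> h x" shows "poly_bounded h'"
  using assms unfolding poly_bounded_def by (meson le_trans)

lemma poly_bounded_const: "poly_bounded (\<lambda>x. n)"
  by (rule poly_boundedI[of _ n 0]) simp

lemma poly_bounded_tsize: "poly_bounded tsize"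
  by (rule poly_boundedI[of _ 1 1]) simp

text \<open>Trees have size at least 1, so lower powers are absorbed by higher ones and a single
  monomial serves as the normal form of a polynomial bound.\<close>

lemma tsize_power_mono: "a \<le> b \<Longrightarrow> tsize x ^ a \<le> tsize x ^ b"
  using tsize_pos[of x] by (intro power_increasing) auto

lemma poly_bounded_add:
  assumes "poly_bounded h" "poly_bounded h'" shows "poly_bounded (\<lambda>x. h x + h' x)"
proof -
  obtain C e C' e' where *: "\<And>x. h x \<le> C * tsize x ^ e" "\<And>x. h' x \<le> C' * tsize x ^ e'"
    using assms unfolding poly_bounded_def by blast
  show ?thesis
  proof (rule poly_boundedI)
    fix x
    have "C * tsize x ^ e \<le> C * tsize x ^ (e + e')" "C' * tsize x ^ e' \<le> C' * tsize x ^ (e + e')"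
      by (intro mult_left_mono tsize_power_mono; simp)+
    then show "h x + h' x \<le> (C + C') * tsize x ^ (e + e')"
      using *[of x] unfolding add_mult_distrib by linarith
  qed
qed

lemma poly_bounded_mult:
  assumes "poly_bounded h" "poly_bounded h'" shows "poly_bounded (\<lambda>x. h x * h' x)"
proof -
  obtain C e C' e' where *: "\<And>x. h x \<le> C * tsize x ^ e" "\<And>x. h' x \<le> C' * tsize x ^ e'"
    using assms unfolding poly_bounded_def by blast
  have "h x * h' x \<le> (C * C') * tsize x ^ (e + e')" for x
    using mult_mono[OF *(1)[of x] *(2)[of x]] by (simp add: algebra_simps power_add)
  then show ?thesis by (rule poly_boundedI)
qed

lemma poly_bounded_power: "poly_bounded h \<Longrightarrow> poly_bounded (\<lambda>x. h x ^ n)"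
  by (induction n) (simp_all add: poly_bounded_const poly_bounded_mult)

lemma poly_bounded_Suc: "poly_bounded h \<Longrightarrow> poly_bounded (\<lambda>x. Suc (h x))"
  using poly_bounded_add[of h "\<lambda>x. 1"] poly_bounded_const[of 1] by simp

lemma poly_bounded_comp:
  assumes "poly_bounded h" "poly_bounded (\<lambda>x. tsize (f x))" shows "poly_bounded (\<lambda>x. h (f x))"
proof -
  obtain C e where "\<And>x. h x \<le> C * tsize x ^ e"
    using assms(1) unfolding poly_bounded_def by blast
  moreover have "poly_bounded (\<lambda>x. C * tsize (f x) ^ e)"
    by (intro poly_bounded_mult poly_bounded_const poly_bounded_power assms(2))
  ultimately show ?thesis by (rule poly_bounded_le[rotated])
qed

lemmas poly_bounded_intros = poly_bounded_const poly_bounded_tsize poly_bounded_add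
  poly_bounded_mult poly_bounded_power poly_bounded_Suc

section \<open>Polynomial-time functions on trees and their closure properties\<close>

definition polyf :: "(tree \<Rightarrow> tree) \<Rightarrow> bool" where
  "polyf f \<longleftrightarrow> (\<exists>p T. poly_bounded T \<and> (\<forall>x. exec p x (f x) (T x)))"

lemma polyfI: "poly_bounded T \<Longrightarrow> (\<And>x. exec p x (f x) (T x)) \<Longrightarrow> polyf f"
  unfolding polyf_def by blast

lemma polyf_size: "polyf f \<Longrightarrow> poly_bounded (\<lambda>x. tsize (f x))"
  unfolding polyf_def by (elim exE conjE) (erule poly_bounded_le, rule exec_cost_ge_output, erule spec)

lemma polyf_id: "polyf (\<lambda>x. x)"
  by (rule polyfI[OF poly_bounded_tsize]) (rule exec_Ident)

lemma polyf_Lf: "polyf (\<lambda>x. Lf)"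
  by (rule polyfI[OF poly_bounded_tsize]) (rule exec_Nul)

lemma polyf_comp: assumes "polyf g" "polyf f" shows "polyf (\<lambda>x. g (f x))"
proof -
  obtain p T q U where *: "poly_bounded T" "\<And>x. exec p x (f x) (T x)"
    "poly_bounded U" "\<And>x. exec q x (g x) (U x)"
    using assms unfolding polyf_def by blast
  show ?thesis
  proof (rule polyfI)
    show "poly_bounded (\<lambda>x. Suc (T x + U (f x)))"
      by (intro poly_bounded_intros poly_bounded_comp[OF *(3)] polyf_size assms(2) *(1))
  qed (rule exec_Seq[OF *(2,4)])
qed

lemma polyf_left: "polyf f \<Longrightarrow> polyf (\<lambda>x. left (f x))"
  by (rule polyf_comp[of left]) (rule polyfI[OF poly_bounded_tsize], rule exec_LeftP)

lemma polyf_right: "polyf f \<Longrightarrow> polyf (\<lambda>x. right (f x))"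
  by (rule polyf_comp[of right]) (rule polyfI[OF poly_bounded_tsize], rule exec_RightP)

lemma polyf_Br: assumes "polyf f" "polyf g" shows "polyf (\<lambda>x. Br (f x) (g x))"
proof -
  obtain p T q U where *: "poly_bounded T" "\<And>x. exec p x (f x) (T x)"
    "poly_bounded U" "\<And>x. exec q x (g x) (U x)"
    using assms unfolding polyf_def by blast
  show ?thesis
  proof (rule polyfI)
    show "poly_bounded (\<lambda>x. Suc (T x + U x))"
      by (intro poly_bounded_intros *(1,3))
  qed (rule exec_Fork[OF *(2,4)])
qed

lemma polyf_const: "polyf (\<lambda>x. t)"
  by (induction t) (simp_all add: polyf_Lf polyf_Br)

section \<open>Polynomial-time predicates\<close>

definition of_bool_tree :: "bool \<Rightarrow> tree" where
  "of_bool_tree b = (if b then Br Lf Lf else Lf)"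

lemma of_bool_tree_eq_Lf [simp]: "of_bool_tree b = Lf \<longleftrightarrow> \<not> b"
  by (simp add: of_bool_tree_def)

definition polyp :: "(tree \<Rightarrow> bool) \<Rightarrow> bool" where
  "polyp P \<longleftrightarrow> polyf (\<lambda>x. of_bool_tree (P x))"

lemma polyf_if_aux: assumes "polyf b" "polyf f" "polyf g"
  shows "polyf (\<lambda>x. if b x \<noteq> Lf then f x else g x)"
proof -
  obtain p T q U r R where *: "poly_bounded T" "\<And>x. exec p x (f x) (T x)"
    "poly_bounded U" "\<And>x. exec q x (g x) (U x)"
    "poly_bounded R" "\<And>x. exec r x (b x) (R x)"
    using assms unfolding polyf_def by blast
  show ?thesis
  proof (rule polyfI)
    show "poly_bounded (\<lambda>x. if b x \<noteq> Lf then Suc (R x + T x) else Suc (R x + U x))"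
    proof (rule poly_bounded_le)
      show "poly_bounded (\<lambda>x. Suc (R x + T x) + Suc (R x + U x))"
        by (intro poly_bounded_intros *(1,3,5))
    qed simp
    show "exec (Cond r p q) x (if b x \<noteq> Lf then f x else g x)
        (if b x \<noteq> Lf then Suc (R x + T x) else Suc (R x + U x))" for x
      using exec_Cond_true[OF *(6)[of x] _ *(2)[of x]] exec_Cond_false[OF _ *(4)[of x]] *(6)[of x]
      by (cases "b x = Lf") auto
  qed
qed

lemma polyf_if: "polyp P \<Longrightarrow> polyf f \<Longrightarrow> polyf g \<Longrightarrow> polyf (\<lambda>x. if P x then f x else g x)"
  using polyf_if_aux[of "\<lambda>x. of_bool_tree (P x)" f g] by (simp add: polyp_def)

lemma polyp_eq: assumes "polyf f" "polyf g" shows "polyp (\<lambda>x. f x = g x)"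
proof -
  have "polyf (\<lambda>x. if \<exists>a. x = Br a a then Br Lf Lf else Lf)"
    by (rule polyfI[OF poly_bounded_tsize]) (rule exec_EqP)
  from polyf_comp[OF this polyf_Br[OF assms]] show ?thesis
    by (simp add: polyp_def of_bool_tree_def eq_commute[of "g _"])
qed

lemma polyp_const: "polyp (\<lambda>x. b)"
  unfolding polyp_def by (rule polyf_const)

lemma polyp_if: assumes "polyp P" "polyp Q" "polyp R" shows "polyp (\<lambda>x. if P x then Q x else R x)"
proof -
  have "polyf (\<lambda>x. if P x then of_bool_tree (Q x) else of_bool_tree (R x))"
    by (rule polyf_if[OF assms(1)]) (use assms in \<open>simp_all add: polyp_def\<close>)
  then show ?thesis by (simp add: polyp_def if_distrib[of of_bool_tree])
qed

lemma polyp_not: assumes "polyp P" shows "polyp (\<lambda>x. \<not> P x)"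
proof -
  have eq: "(\<lambda>x. \<not> P x) = (\<lambda>x. if P x then False else True)" by auto
  show ?thesis unfolding eq by (rule polyp_if; rule assms polyp_const)
qed

lemma polyp_conj: assumes "polyp P" "polyp Q" shows "polyp (\<lambda>x. P x \<and> Q x)"
proof -
  have eq: "(\<lambda>x. P x \<and> Q x) = (\<lambda>x. if P x then Q x else False)" by auto
  show ?thesis unfolding eq by (rule polyp_if; rule assms polyp_const)
qed

lemma polyp_disj: assumes "polyp P" "polyp Q" shows "polyp (\<lambda>x. P x \<or> Q x)"
proof -
  have eq: "(\<lambda>x. P x \<or> Q x) = (\<lambda>x. if P x then True else Q x)" by auto
  show ?thesis unfolding eq by (rule polyp_if; rule assms polyp_const)
qed

lemma polyp_imp: assumes "polyp P" "polyp Q" shows "polyp (\<lambda>x. P x \<longrightarrow> Q x)"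
proof -
  have eq: "(\<lambda>x. P x \<longrightarrow> Q x) = (\<lambda>x. if P x then Q x else True)" by auto
  show ?thesis unfolding eq by (rule polyp_if; rule assms polyp_const)
qed

lemma polyp_iff: assumes "polyp P" "polyp Q" shows "polyp (\<lambda>x. P x \<longleftrightarrow> Q x)"
proof -
  have eq: "(\<lambda>x. P x \<longleftrightarrow> Q x) = (\<lambda>x. if P x then Q x else \<not> Q x)" by auto
  show ?thesis unfolding eq by (rule polyp_if; rule assms polyp_not[OF assms(2)])
qed

subsection \<open>Loops\<close>

text \<open>Each of the at most \<open>\<mu> y\<close> iterations, and also the final failing test,
  costs at most \<open>K\<close>; hence the factor \<open>Suc (\<mu> y)\<close>.\<close>

lemma exec_While_measure:
  fixes \<mu> :: "tree \<Rightarrow> nat"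
  assumes b: "\<And>y. exec pb y (b y) (Tb y)" and s: "\<And>y. exec ps y (s y) (Ts y)"
    and step: "\<And>y. I y \<Longrightarrow> b y \<noteq> Lf \<Longrightarrow> I (s y) \<and> \<mu> (s y) < \<mu> y"
    and cost: "\<And>y. I y \<Longrightarrow> Suc (Tb y + Ts y) \<le> K"
    and "I y"
  shows "\<exists>z t. exec (While pb ps) y z t \<and> t \<le> Suc (\<mu> y) * K \<and> I z \<and> b z = Lf"
  using \<open>I y\<close>
proof (induction "\<mu> y" arbitrary: y rule: less_induct)
  case less
  show ?case
  proof (cases "b y = Lf")
    case True
    then have "exec (While pb ps) y y (Suc (Tb y))"
      using exec_While_stop b by metis
    moreover have "Suc (Tb y) \<le> Suc (\<mu> y) * K" using cost[OF less.prems] by simp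
    ultimately show ?thesis using True less.prems by blast
  next
    case False
    note st = step[OF less.prems False]
    obtain z t where z: "exec (While pb ps) (s y) z t" "t \<le> Suc (\<mu> (s y)) * K" "I z" "b z = Lf"
      using less.hyps[of "s y"] st by blast
    have "exec (While pb ps) y z (Suc (Tb y + Ts y + t))"
      using exec_While_step[OF b False s z(1)] .
    moreover have "Suc (\<mu> (s y)) * K \<le> \<mu> y * K" using st by (intro mult_right_mono) auto
    then have "Suc (Tb y + Ts y + t) \<le> Suc (\<mu> y) * K"
      using cost[OF less.prems] z(2) by simp
    ultimately show ?thesis using z by blast
  qed
qed

text \<open>Polynomially many rounds of a polynomial body may still blow up the state. So
  \<open>M\<close> has to bound every reachable state in terms of the original input, which the
  invariant \<open>I\<close> therefore carries as its first argument.\<close>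

lemma polyf_loop:
  fixes \<mu> :: "tree \<Rightarrow> nat"
  assumes poly: "polyf b" "polyf s" "polyf i" "polyf out"
    and bounds: "poly_bounded M" "poly_bounded (\<lambda>x. \<mu> (i x))"
    and init: "\<And>x. I x (i x)"
    and step: "\<And>x y. I x y \<Longrightarrow> b y \<noteq> Lf \<Longrightarrow> I x (s y) \<and> \<mu> (s y) < \<mu> y"
    and size: "\<And>x y. I x y \<Longrightarrow> tsize y \<le> M x"
    and res: "\<And>x y. I x y \<Longrightarrow> b y = Lf \<Longrightarrow> out y = r x"
  shows "polyf r"
proof -
  obtain pb Tb ps Ts where p: "poly_bounded Tb" "\<And>x. exec pb x (b x) (Tb x)"
    "poly_bounded Ts" "\<And>x. exec ps x (s x) (Ts x)"
    using poly unfolding polyf_def by blast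
  obtain C e where Ce: "\<And>x. Suc (Tb x + Ts x) \<le> C * tsize x ^ e"
    using poly_bounded_Suc[OF poly_bounded_add[OF p(1,3)]] unfolding poly_bounded_def by blast
  have cost: "Suc (Tb y + Ts y) \<le> C * M x ^ e" if "I x y" for x y
    using Ce[of y] size[OF that] by (meson le_trans mult_left_mono power_mono zero_le)
  have "\<exists>z t. exec (While pb ps) (i x) z t \<and> t \<le> Suc (\<mu> (i x)) * (C * M x ^ e) \<and> I x z \<and> b z = Lf" for x
    by (rule exec_While_measure[of pb b Tb ps s Ts "I x", OF p(2,4) step cost init])
  then have "\<forall>x. \<exists>z t. exec (While pb ps) (i x) z t \<and> t \<le> Suc (\<mu> (i x)) * (C * M x ^ e) \<and> I x z \<and> b z = Lf"
    by blast
  \<comment> \<open>\<open>polyf\<close> asks for the exact cost as a function of the input, so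
    final states and costs are chosen as functions of \<open>x\<close>.\<close>
  from choice[OF this] obtain z where
    "\<forall>x. \<exists>t. exec (While pb ps) (i x) (z x) t \<and> t \<le> Suc (\<mu> (i x)) * (C * M x ^ e) \<and> I x (z x) \<and> b (z x) = Lf"
    by blast
  from choice[OF this] obtain t where zt: "\<And>x. exec (While pb ps) (i x) (z x) (t x)"
      "\<And>x. t x \<le> Suc (\<mu> (i x)) * (C * M x ^ e)" "\<And>x. I x (z x)" "\<And>x. b (z x) = Lf"
    by blast
  obtain pi Ti po To where q: "poly_bounded Ti" "\<And>x. exec pi x (i x) (Ti x)"
    "poly_bounded To" "\<And>x. exec po x (out x) (To x)"
    using poly unfolding polyf_def by blast
  have t: "poly_bounded t"
    by (rule poly_bounded_le[OF _ zt(2)]) (intro poly_bounded_intros bounds)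
  show ?thesis
  proof (rule polyfI)
    have "poly_bounded (\<lambda>x. tsize (z x))"
      by (rule poly_bounded_le[OF bounds(1)]) (rule size[OF zt(3)])
    then show "poly_bounded (\<lambda>x. Suc (Ti x + Suc (t x + To (z x))))"
      by (intro poly_bounded_intros q t poly_bounded_comp[OF q(3)])
    show "exec (Seq pi (Seq (While pb ps) po)) x (r x) (Suc (Ti x + Suc (t x + To (z x))))" for x
      using exec_Seq[OF q(2) exec_Seq[OF zt(1) q(4)], of x] res[OF zt(3) zt(4), of x] by simp
  qed
qed

subsection \<open>Trees as lists of trees\<close>

primrec elems :: "tree \<Rightarrow> tree list" where
  "elems Lf = []"
| "elems (Br a b) = a # elems b"

abbreviation of_list :: "tree list \<Rightarrow> tree" where
  "of_list \<equiv> enc_list (\<lambda>x. x)"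

lemma elems_of_list [simp]: "elems (of_list xs) = xs"
  by (induction xs) auto

lemma of_list_elems [simp]: "of_list (elems t) = t"
  by (induction t) auto

lemma of_list_eq_Lf [simp]: "of_list xs = Lf \<longleftrightarrow> xs = []"
  by (cases xs) auto

lemma of_list_inject [simp]: "of_list xs = of_list ys \<longleftrightarrow> xs = ys"
  by (metis elems_of_list)

lemma elems_eq_Nil [simp]: "elems t = [] \<longleftrightarrow> t = Lf"
  by (cases t) auto

lemma enc_list_map: "enc_list e xs = of_list (map e xs)"
  by (induction xs) auto

lemma enc_nat_replicate: "enc_nat n = of_list (replicate n Lf)"
  by (induction n) auto

lemma tsize_of_list: "tsize (of_list xs) = Suc (\<Sum>x\<leftarrow>xs. Suc (tsize x))"
  by (induction xs) auto

lemma tsize_elems: "tsize t = Suc (\<Sum>x\<leftarrow>elems t. Suc (tsize x))"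
  using tsize_of_list[of "elems t"] by simp

lemma length_le_tsize: "length xs < tsize (of_list xs)"
  by (induction xs) auto

lemma tsize_elem: "x \<in> set (elems t) \<Longrightarrow> tsize x < tsize t"
  by (induction t) auto

definition polyl :: "(tree \<Rightarrow> tree list) \<Rightarrow> bool" where
  "polyl l \<longleftrightarrow> polyf (\<lambda>x. of_list (l x))"

definition polyn :: "(tree \<Rightarrow> nat) \<Rightarrow> bool" where
  "polyn n \<longleftrightarrow> polyf (\<lambda>x. enc_nat (n x))"

lemma polyf_of_list: "polyl l \<Longrightarrow> polyf (\<lambda>x. of_list (l x))"
  by (simp add: polyl_def)

lemma polyl_elems: "polyf f \<Longrightarrow> polyl (\<lambda>x. elems (f x))"
  by (simp add: polyl_def)

lemma poly_bounded_concat_map: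
  assumes F: "poly_bounded (\<lambda>z. tsize (F z))"
  shows "poly_bounded (\<lambda>z. \<Sum>a\<leftarrow>elems (right z). tsize (F (Br (left z) a)))"
proof -
  obtain C e where Ce: "\<And>x. tsize (F x) \<le> C * tsize x ^ e"
    using F unfolding poly_bounded_def by blast
  show ?thesis
  proof (rule poly_bounded_le)
    show "poly_bounded (\<lambda>z. tsize z * (C * (2 + tsize z) ^ e))"
      by (intro poly_bounded_intros)
    show "(\<Sum>a\<leftarrow>elems (right z). tsize (F (Br (left z) a))) \<le> tsize z * (C * (2 + tsize z) ^ e)" for z
    proof -
      have *: "tsize (F (Br (left z) a)) \<le> C * (2 + tsize z) ^ e" if "a \<in> set (elems (right z))" for a
      proof -
        have "tsize (Br (left z) a) \<le> 2 + tsize z"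
          using tsize_elem[OF that] that by (cases z) auto
        then show ?thesis
          using Ce[of "Br (left z) a"] by (meson le_trans mult_left_mono power_mono zero_le)
      qed
      have "(\<Sum>a\<leftarrow>elems (right z). tsize (F (Br (left z) a)))
          \<le> (\<Sum>a\<leftarrow>elems (right z). C * (2 + tsize z) ^ e)"
        by (intro sum_list_mono *)
      also have "\<dots> = length (elems (right z)) * (C * (2 + tsize z) ^ e)"
        by (simp add: sum_list_triv)
      also have "\<dots> \<le> tsize z * (C * (2 + tsize z) ^ e)"
      proof (rule mult_right_mono)
        have "length (elems (right z)) \<le> tsize (right z)"
          using length_le_tsize[of "elems (right z)"] by simp
        also have "\<dots> \<le> tsize z" by (cases z) auto
        finally show "length (elems (right z)) \<le> tsize z" .
      qed simp
      finally show ?thesis .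
    qed
  qed
qed

text \<open>The state of the loop is \<open>Br acc (Br x (Br cur rem))\<close>: each step moves one element of the
  list \<open>cur\<close> to \<open>acc\<close>, or refills \<open>cur\<close> from the next element of \<open>rem\<close>.\<close>

lemma polyf_rev_concat_map:
  assumes F: "polyf F"
  shows "polyf (\<lambda>z. of_list (rev (concat (map (\<lambda>a. elems (F (Br (left z) a))) (elems (right z))))))"
proof -
  let ?G = "\<lambda>x a. elems (F (Br x a))"
  let ?cur = "\<lambda>y. left (right (right y))" and ?rem = "\<lambda>y. right (right (right y))"
  define b where "b y = (if ?cur y = Lf then ?rem y else ?cur y)" for y
  define s where "s y = (if ?cur y = Lf
      then Br (left y) (Br (left (right y)) (Br (F (Br (left (right y)) (left (?rem y)))) (right (?rem y))))
      else Br (Br (left (?cur y)) (left y)) (Br (left (right y)) (Br (right (?cur y)) (?rem y))))" for y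
  \<comment> \<open>Each remaining element is charged in advance for the elements it will produce,
    plus one (\<open>Suc\<close>) for the refill step.\<close>
  define \<mu> where "\<mu> y = length (elems (?cur y)) +
      (\<Sum>a\<leftarrow>elems (?rem y). Suc (length (?G (left (right y)) a)))" for y
  \<comment> \<open>The prefix \<open>pre\<close> records that \<open>rem\<close> is a suffix of the
    input list, which bounds its size.\<close>
  define I where "I z y \<longleftrightarrow> (\<exists>acc cur rem pre. y = Br (of_list acc) (Br (left z) (Br (of_list cur) (of_list rem)))
      \<and> rev acc @ cur @ concat (map (?G (left z)) rem) = concat (map (?G (left z)) (elems (right z)))
      \<and> elems (right z) = pre @ rem)" for z y
  define S where "S z = (\<Sum>a\<leftarrow>elems (right z). tsize (F (Br (left z) a)))" for z
  have S: "poly_bounded S" unfolding S_def using polyf_size[OF F] by (rule poly_bounded_concat_map)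
  have S_sum: "(\<Sum>a\<leftarrow>concat (map (?G (left z)) (elems (right z))). Suc (tsize a)) \<le> S z" for z
  proof -
    have "(\<Sum>a\<leftarrow>concat (map (?G (left z)) xs). Suc (tsize a)) \<le> (\<Sum>a\<leftarrow>xs. tsize (F (Br (left z) a)))" for xs
    proof (induction xs)
      case (Cons a xs)
      then show ?case using tsize_elems[of "F (Br (left z) a)"] by simp
    qed simp
    then show ?thesis by (simp add: S_def)
  qed
  show ?thesis
  proof (rule polyf_loop[where b = b and s = s and i = "\<lambda>z. Br Lf (Br (left z) (Br Lf (right z)))"
        and out = left and I = I and \<mu> = \<mu> and M = "\<lambda>z. 10 + tsize z + tsize z + S z + S z"])
    show "polyf b" unfolding b_def
      by (intro polyf_if polyp_eq polyf_left polyf_right polyf_id polyf_const)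
    show "polyf s" unfolding s_def
      by (intro polyf_if polyp_eq polyf_left polyf_right polyf_Br polyf_id polyf_const polyf_comp[OF F])
    show "polyf (\<lambda>z. Br Lf (Br (left z) (Br Lf (right z))))" "polyf left"
      by (intro polyf_left polyf_right polyf_Br polyf_id polyf_const)+
    show "poly_bounded (\<lambda>z. 10 + tsize z + tsize z + S z + S z)" by (intro poly_bounded_intros S)
    show "poly_bounded (\<lambda>z. \<mu> (Br Lf (Br (left z) (Br Lf (right z)))))"
    proof (rule poly_bounded_le[OF S])
      show "\<mu> (Br Lf (Br (left z) (Br Lf (right z)))) \<le> S z" for z
        unfolding \<mu>_def S_def left.simps right.simps elems.simps list.size add_0
      proof (rule sum_list_mono)
        show "Suc (length (?G (left z) a)) \<le> tsize (F (Br (left z) a))" for a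
          using length_le_tsize[of "?G (left z) a"] by simp
      qed
    qed
    show "I z (Br Lf (Br (left z) (Br Lf (right z))))" for z
      unfolding I_def
      by (rule exI[of _ "[]"], rule exI[of _ "[]"], rule exI[of _ "elems (right z)"], rule exI[of _ "[]"]) simp
    show "I z (s y) \<and> \<mu> (s y) < \<mu> y" if inv: "I z y" and ne: "b y \<noteq> Lf" for z y
    proof -
      obtain acc cur rem pre where y: "y = Br (of_list acc) (Br (left z) (Br (of_list cur) (of_list rem)))"
        "rev acc @ cur @ concat (map (?G (left z)) rem) = concat (map (?G (left z)) (elems (right z)))"
        "elems (right z) = pre @ rem"
        using inv unfolding I_def by blast
      show ?thesis
      proof (cases cur)
        case Nil
        then obtain a rem' where rem: "rem = a # rem'"
          using ne y(1) by (cases rem) (auto simp: b_def)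
        have sy: "s y = Br (of_list acc) (Br (left z) (Br (of_list (?G (left z) a)) (of_list rem')))"
          using Nil rem y(1) by (simp add: s_def)
        have "I z (s y)" unfolding I_def
          by (rule exI[of _ acc], rule exI[of _ "?G (left z) a"], rule exI[of _ rem'],
              rule exI[of _ "pre @ [a]"]) (use y Nil rem sy in auto)
        moreover have "\<mu> (s y) < \<mu> y" using Nil rem y(1) sy by (simp add: \<mu>_def)
        ultimately show ?thesis ..
      next
        case (Cons c cur')
        have sy: "s y = Br (of_list (c # acc)) (Br (left z) (Br (of_list cur') (of_list rem)))"
          using Cons y(1) by (simp add: s_def)
        have "I z (s y)" unfolding I_def
          by (rule exI[of _ "c # acc"], rule exI[of _ cur'], rule exI[of _ rem],
              rule exI[of _ "pre"]) (use y Cons sy in auto)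
        moreover have "\<mu> (s y) < \<mu> y" using Cons y(1) sy by (simp add: \<mu>_def)
        ultimately show ?thesis ..
      qed
    qed
    show "tsize y \<le> 10 + tsize z + tsize z + S z + S z" if inv: "I z y" for z y
    proof -
      obtain acc cur rem pre where y: "y = Br (of_list acc) (Br (left z) (Br (of_list cur) (of_list rem)))"
        "rev acc @ cur @ concat (map (?G (left z)) rem) = concat (map (?G (left z)) (elems (right z)))"
        "elems (right z) = pre @ rem"
        using inv unfolding I_def by blast
      have "(\<Sum>a\<leftarrow>rev acc. Suc (tsize a)) = (\<Sum>a\<leftarrow>acc. Suc (tsize a))"
        by (simp only: rev_map[symmetric] sum_list_rev)
      then have "(\<Sum>a\<leftarrow>acc. Suc (tsize a)) + (\<Sum>a\<leftarrow>cur. Suc (tsize a)) \<le> S z"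
        using S_sum[of z] by (simp flip: y(2))
      moreover have "tsize (of_list rem) \<le> tsize (right z)"
        using tsize_elems[of "right z"] y(3) by (simp add: tsize_of_list)
      moreover have "tsize (left z) \<le> tsize z" "tsize (right z) \<le> tsize z" by (cases z; simp)+
      ultimately show ?thesis using y(1) by (simp add: tsize_of_list)
    qed
    show "left y = of_list (rev (concat (map (?G (left z)) (elems (right z)))))"
      if inv: "I z y" and stop: "b y = Lf" for z y
    proof -
      obtain acc cur rem pre where y: "y = Br (of_list acc) (Br (left z) (Br (of_list cur) (of_list rem)))"
        "rev acc @ cur @ concat (map (?G (left z)) rem) = concat (map (?G (left z)) (elems (right z)))"
        using inv unfolding I_def by blast
      have "cur = []" "rem = []" using stop y(1) by (auto simp: b_def split: if_splits)
      then show ?thesis using y by (simp flip: y(2))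
    qed
  qed
qed

text \<open>The loop delivers its result in reverse order. Applied to one-element lists it is
  reversal itself, which can then undo the reversal in general.\<close>

lemma polyl_rev: assumes "polyl L" shows "polyl (\<lambda>x. rev (L x))"
proof -
  have "polyf (\<lambda>z. Br (right z) Lf)"
    by (intro polyf_Br polyf_right polyf_id polyf_const)
  from polyf_comp[OF polyf_rev_concat_map[OF this] polyf_Br[OF polyf_const[of Lf] assms[unfolded polyl_def]]]
  show ?thesis by (simp add: polyl_def)
qed

text \<open>Programs have no variables: the body of an iteration receives a pair of the outer input
  and the current element, reached as \<open>left z\<close> and \<open>right z\<close>. The rules
  below for maps, filters and bounded quantifiers have the same form.\<close>

lemma polyl_concat_map:
  assumes "polyl L" "polyl (\<lambda>z. f (left z) (right z))"
  shows "polyl (\<lambda>x. concat (map (f x) (L x)))"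
proof -
  from polyf_comp[OF polyf_rev_concat_map[OF assms(2)[unfolded polyl_def]] polyf_Br[OF polyf_id assms(1)[unfolded polyl_def]]]
  have "polyl (\<lambda>x. rev (concat (map (f x) (L x))))" by (simp add: polyl_def)
  from polyl_rev[OF this] show ?thesis by simp
qed

lemma polyl_Nil: "polyl (\<lambda>x. [])"
  by (simp add: polyl_def polyf_const)

lemma polyl_Cons: "polyf f \<Longrightarrow> polyl l \<Longrightarrow> polyl (\<lambda>x. f x # l x)"
  by (simp add: polyl_def polyf_Br)

lemma polyl_if: "polyp P \<Longrightarrow> polyl f \<Longrightarrow> polyl g \<Longrightarrow> polyl (\<lambda>x. if P x then f x else g x)"
  using polyf_if[of P "\<lambda>x. of_list (f x)" "\<lambda>x. of_list (g x)"]
  unfolding polyl_def by (simp add: if_distrib[of of_list])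

lemma polyl_map:
  assumes "polyl L" "polyf (\<lambda>z. f (left z) (right z))"
  shows "polyl (\<lambda>x. map (f x) (L x))"
  using polyl_concat_map[OF assms(1) polyl_Cons[OF assms(2) polyl_Nil]] by simp

lemma polyl_filter:
  assumes "polyl L" "polyp (\<lambda>z. P (left z) (right z))"
  shows "polyl (\<lambda>x. filter (P x) (L x))"
proof -
  have "polyl (\<lambda>x. concat (map (\<lambda>a. if P x a then [a] else []) (L x)))"
    by (intro polyl_concat_map assms polyl_if polyl_Cons polyl_Nil polyf_right polyf_id)
  moreover have "concat (map (\<lambda>a. if P x a then [a] else []) xs) = filter (P x) xs" for x xs
    by (induction xs) auto
  ultimately show ?thesis by simp
qed

lemma polyp_empty: "polyl L \<Longrightarrow> polyp (\<lambda>x. L x = [])"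
  using polyp_eq[of "\<lambda>x. of_list (L x)" "\<lambda>x. Lf"] by (simp add: polyl_def polyf_const)

lemma polyp_ball:
  assumes "polyl L" "polyp (\<lambda>z. P (left z) (right z))"
  shows "polyp (\<lambda>x. \<forall>a \<in> set (L x). P x a)"
  using polyp_empty[OF polyl_filter[OF assms(1) polyp_not[OF assms(2)]]]
  by (simp add: filter_empty_conv)

lemma polyp_bex:
  assumes "polyl L" "polyp (\<lambda>z. P (left z) (right z))"
  shows "polyp (\<lambda>x. \<exists>a \<in> set (L x). P x a)"
  using polyp_not[OF polyp_ball[OF assms(1) polyp_not[OF assms(2)]]] by simp

lemma polyp_mem: assumes "polyf f" "polyl L" shows "polyp (\<lambda>x. f x \<in> set (L x))"
proof -
  have "polyp (\<lambda>x. \<exists>a \<in> set (L x). a = f x)"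
    by (intro polyp_bex polyp_eq polyf_right polyf_id assms(2) polyf_comp[OF assms(1)] polyf_left)
  then show ?thesis by (simp add: Bex_def)
qed

lemma polyl_append: assumes "polyl L" "polyl M" shows "polyl (\<lambda>x. L x @ M x)"
proof -
  have "polyl (\<lambda>x. concat (map elems [of_list (L x), of_list (M x)]))"
    by (intro polyl_concat_map polyl_Cons polyl_Nil polyl_elems polyf_right polyf_id polyf_of_list assms)
  then show ?thesis by simp
qed

text \<open>Iterating over suffixes instead of elements makes positions available, since the length
  of a suffix is a distance from the end. The empty suffix is left out, so every member has a
  head.\<close>

fun tails :: "'a list \<Rightarrow> 'a list list" where
  "tails [] = []"
| "tails (x # xs) = (x # xs) # tails xs"

lemma set_tails: "set (tails xs) = {ys. ys \<noteq> [] \<and> (\<exists>zs. xs = zs @ ys)}"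
proof (induction xs)
  case (Cons x xs)
  have "(\<exists>zs. x # xs = zs @ ys) \<longleftrightarrow> ys = x # xs \<or> (\<exists>zs. xs = zs @ ys)" for ys
    by (auto simp: Cons_eq_append_conv)
  then show ?case using Cons by auto
qed auto

lemma polyl_tails: assumes "polyl L" shows "polyl (\<lambda>x. map of_list (tails (L x)))"
proof -
  define I where "I x y \<longleftrightarrow> (\<exists>acc rem pre. y = Br (of_list (map of_list acc)) (of_list rem)
      \<and> rev acc @ tails rem = tails (elems x) \<and> elems x = pre @ rem)" for x y
  \<comment> \<open>All suffixes together have only quadratic size; this bounds the accumulator of
    the loop.\<close>
  have sz: "(\<Sum>t\<leftarrow>tails xs. Suc (tsize (of_list t))) \<le> length xs * Suc (tsize (of_list xs))" for xs
  proof (induction xs)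
    case (Cons a xs)
    moreover have "length xs * Suc (tsize (of_list xs)) \<le> length xs * Suc (tsize (of_list (a # xs)))"
      by (intro mult_left_mono) auto
    ultimately show ?case by simp
  qed simp
  have "polyf (\<lambda>x. of_list (rev (map of_list (tails (elems x)))))"
  proof (rule polyf_loop[where b = right and s = "\<lambda>y. Br (Br (right y) (left y)) (right (right y))"
        and i = "\<lambda>x. Br Lf x" and out = left and I = I and \<mu> = "\<lambda>y. length (elems (right y))"
        and M = "\<lambda>x. 10 + tsize x + tsize x * Suc (tsize x)"])
    show "polyf right" "polyf left" "polyf (Br Lf)"
      "polyf (\<lambda>y. Br (Br (right y) (left y)) (right (right y)))"
      by (intro polyf_left polyf_right polyf_Br polyf_id polyf_const)+
    show "poly_bounded (\<lambda>x. 10 + tsize x + tsize x * Suc (tsize x))" by (intro poly_bounded_intros)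
    show "poly_bounded (\<lambda>x. length (elems (right (Br Lf x))))"
      by (rule poly_bounded_le[OF poly_bounded_tsize])
         (use length_le_tsize[of "elems _"] in \<open>simp add: less_imp_le\<close>)
    show "I x (Br Lf x)" for x
      unfolding I_def
      by (rule exI[of _ "[]"], rule exI[of _ "elems x"], rule exI[of _ "[]"]) simp
    show "I x (Br (Br (right y) (left y)) (right (right y))) \<and>
        length (elems (right (Br (Br (right y) (left y)) (right (right y))))) < length (elems (right y))"
      if inv: "I x y" and ne: "right y \<noteq> Lf" for x y
    proof -
      obtain acc rem pre where y: "y = Br (of_list (map of_list acc)) (of_list rem)"
          "rev acc @ tails rem = tails (elems x)" "elems x = pre @ rem"
        using inv unfolding I_def by blast
      then obtain a rem' where rem: "rem = a # rem'" using ne by (cases rem) auto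
      have "I x (Br (Br (right y) (left y)) (right (right y)))"
        unfolding I_def
        by (rule exI[of _ "rem # acc"], rule exI[of _ rem'], rule exI[of _ "pre @ [a]"])
           (use y rem in auto)
      then show ?thesis using y rem by simp
    qed
    show "tsize y \<le> 10 + tsize x + tsize x * Suc (tsize x)" if inv: "I x y" for x y
    proof -
      obtain acc rem pre where y: "y = Br (of_list (map of_list acc)) (of_list rem)"
          "rev acc @ tails rem = tails (elems x)" "elems x = pre @ rem"
        using inv unfolding I_def by blast
      have "(\<Sum>t\<leftarrow>rev acc. Suc (tsize (of_list t))) = (\<Sum>t\<leftarrow>acc. Suc (tsize (of_list t)))"
        by (simp only: rev_map[symmetric] sum_list_rev)
      then have "(\<Sum>t\<leftarrow>acc. Suc (tsize (of_list t))) \<le> length (elems x) * Suc (tsize x)"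
        using sz[of "elems x"] by (simp flip: y(2))
      moreover have "length (elems x) * Suc (tsize x) \<le> tsize x * Suc (tsize x)"
        using length_le_tsize[of "elems x"] by (intro mult_right_mono) auto
      moreover have "tsize (of_list rem) \<le> tsize x"
        using tsize_elems[of x] y(3) by (simp add: tsize_of_list)
      ultimately show ?thesis using y(1) by (simp add: tsize_of_list o_def)
    qed
    show "left y = of_list (rev (map of_list (tails (elems x))))" if inv: "I x y" and stop: "right y = Lf" for x y
    proof -
      obtain acc rem where y: "y = Br (of_list (map of_list acc)) (of_list rem)"
          "rev acc @ tails rem = tails (elems x)"
        using inv unfolding I_def by blast
      then have "tails (elems x) = rev acc" using stop by simp
      then show ?thesis using y(1) by (simp add: rev_map)
    qed
  qed
  from polyl_rev[OF this[folded polyl_def]]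
  have "polyf (\<lambda>x. of_list (map of_list (tails (elems x))))" by (simp add: polyl_def)
  from polyf_comp[OF this assms[unfolded polyl_def]] show ?thesis by (simp add: polyl_def)
qed

lemma polyl_concat_tails:
  assumes "polyl L" "polyl (\<lambda>z. f (left z) (elems (right z)))"
  shows "polyl (\<lambda>x. concat (map (f x) (tails (L x))))"
  using polyl_concat_map[OF polyl_tails[OF assms(1)] assms(2)] by (simp add: o_def)

lemma polyl_map_tails:
  assumes "polyl L" "polyf (\<lambda>z. f (left z) (elems (right z)))"
  shows "polyl (\<lambda>x. map (f x) (tails (L x)))"
  using polyl_map[OF polyl_tails[OF assms(1)] assms(2)] by (simp add: o_def)

lemma polyp_ball_tails:
  assumes "polyl L" "polyp (\<lambda>z. P (left z) (elems (right z)))"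
  shows "polyp (\<lambda>x. \<forall>a \<in> set (tails (L x)). P x a)"
  using polyp_ball[OF polyl_tails[OF assms(1)] assms(2)] by simp

lemma polyl_remdups: assumes "polyl L" shows "polyl (\<lambda>x. remdups (L x))"
proof -
  have "polyl (\<lambda>x. concat (map (\<lambda>s. if left (of_list s) \<in> set (elems (right (of_list s))) then []
      else [left (of_list s)]) (tails (L x))))"
    by (intro polyl_concat_tails assms polyl_if polyp_mem polyl_Cons polyl_Nil polyl_elems
        polyf_left polyf_right polyf_of_list polyf_id)
  moreover have "concat (map (\<lambda>s. if left (of_list s) \<in> set (elems (right (of_list s))) then []
      else [left (of_list s)]) (tails xs)) = remdups xs" for xs
    by (induction xs) auto
  ultimately show ?thesis by simp
qed

subsection \<open>Numbers\<close>

lemma polyf_enc_nat: "polyn n \<Longrightarrow> polyf (\<lambda>x. enc_nat (n x))"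
  by (simp add: polyn_def)

text \<open>A unary number is a list of copies of \<open>Lf\<close>, so arithmetic reduces to list
  operations: sums to appending, products to nested iteration.\<close>

lemma polyn_length: assumes "polyl L" shows "polyn (\<lambda>x. length (L x))"
proof -
  have "polyl (\<lambda>x. map (\<lambda>a. Lf) (L x))" by (intro polyl_map assms polyf_const)
  then show ?thesis by (simp add: polyn_def polyl_def enc_nat_replicate map_replicate_const)
qed

lemma length_elems_enc_nat [simp]: "length (elems (enc_nat n)) = n"
  by (simp add: enc_nat_replicate)

lemma polyn_add: assumes "polyn m" "polyn n" shows "polyn (\<lambda>x. m x + n x)"
proof -
  have "polyn (\<lambda>x. length (elems (enc_nat (m x)) @ elems (enc_nat (n x))))"
    by (intro polyn_length polyl_append polyl_elems polyf_enc_nat assms)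
  then show ?thesis by simp
qed

lemma polyn_const: "polyn (\<lambda>x. n)"
  by (simp add: polyn_def polyf_const)

lemma polyn_Suc: "polyn n \<Longrightarrow> polyn (\<lambda>x. Suc (n x))"
  using polyn_add[OF polyn_const[of 1]] by simp

lemma polyn_mult: assumes "polyn m" "polyn n" shows "polyn (\<lambda>x. m x * n x)"
proof -
  have "polyn (\<lambda>z. n (left z))"
    using polyf_comp[OF assms(2)[unfolded polyn_def] polyf_left[OF polyf_id]] by (simp add: polyn_def)
  then have "polyn (\<lambda>x. length (concat (map (\<lambda>a. elems (enc_nat (n x))) (elems (enc_nat (m x))))))"
    by (intro polyn_length polyl_concat_map polyl_elems polyf_enc_nat assms)
  then show ?thesis by (simp add: length_concat o_def sum_list_triv)
qed

lemma polyn_power: "polyn n \<Longrightarrow> polyn (\<lambda>x. n x ^ e)"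
  by (induction e) (simp_all add: polyn_const polyn_mult)

lemma polyp_nat_eq: "polyn m \<Longrightarrow> polyn n \<Longrightarrow> polyp (\<lambda>x. m x = n x)"
  using polyp_eq[of "\<lambda>x. enc_nat (m x)" "\<lambda>x. enc_nat (n x)"]
  by (simp add: polyn_def inj_eq[OF inj_enc_nat])

definition nat_trees :: "nat \<Rightarrow> tree list" where
  "nat_trees n = map enc_nat [0..<n]"

lemma polyl_nat_trees: assumes "polyn n" shows "polyl (\<lambda>x. nat_trees (n x))"
proof -
  \<comment> \<open>Removing the head from each nonempty suffix of the unary \<open>n\<close> leaves
    the numbers \<open>n - 1\<close> down to 0.\<close>
  have "polyl (\<lambda>x. map (\<lambda>s. right (of_list s)) (tails (elems (enc_nat (n x)))))"
    by (intro polyl_map_tails polyf_right polyf_of_list polyl_elems polyf_id polyf_enc_nat assms)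
  then have "polyl (\<lambda>x. rev (map (\<lambda>s. right (of_list s)) (tails (elems (enc_nat (n x))))))"
    by (rule polyl_rev)
  moreover have "rev (map (\<lambda>s. right (of_list s)) (tails (elems (enc_nat n)))) = nat_trees n" for n
    by (induction n) (auto simp: nat_trees_def)
  ultimately show ?thesis by simp
qed

lemma polyp_less: assumes "polyn m" "polyn n" shows "polyp (\<lambda>x. m x < n x)"
proof -
  have "polyp (\<lambda>x. enc_nat (m x) \<in> set (nat_trees (n x)))"
    by (intro polyp_mem polyl_nat_trees polyf_enc_nat assms)
  then show ?thesis by (simp add: nat_trees_def inj_image_mem_iff[OF inj_enc_nat])
qed

section \<open>From a selection problem to Roman domination\<close>

text \<open>A smaller \<open>g'\<close> would have to lower some value 2, say at \<open>v\<close>.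
  The vertex \<open>u\<close> keeps value 0, so it has a neighbour with value 2 under
  \<open>g'\<close>, hence under \<open>g\<close>; by privacy this is \<open>v\<close>, which was
  not lowered after all.\<close>

lemma minimal_rdfI:
  assumes rdf: "rdf V E g" and no1: "\<And>v. v \<in> V \<Longrightarrow> g v \<noteq> 1"
    and priv: "\<And>v. v \<in> V \<Longrightarrow> g v = 2 \<Longrightarrow>
      \<exists>u \<in> V. g u = 0 \<and> (\<forall>w \<in> V. {w, u} \<in> E \<and> g w = 2 \<longrightarrow> w = v)"
  shows "minimal_rdf V E g"
  unfolding minimal_rdf_def
proof (intro conjI allI impI ballI rdf)
  fix g' v assume g': "rdf V E g'" and le: "\<forall>v \<in> V. g' v \<le> g v" and v: "v \<in> V"
  have lab: "g w \<in> {0, 1, 2}" "g' w \<in> {0, 1, 2}" if "w \<in> V" for w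
    using rdf g' that by (auto simp: rdf_def labelling_def)
  show "g' v = g v"
  proof (rule ccontr)
    assume ne: "g' v \<noteq> g v"
    then have "g v = 2" using lab[OF v] no1[OF v] le v by force
    then obtain u where u: "u \<in> V" "g u = 0" "\<forall>w \<in> V. {w, u} \<in> E \<and> g w = 2 \<longrightarrow> w = v"
      using priv[OF v] by blast
    have "g' u = 0" using le u by force
    then obtain w where w: "w \<in> V" "{w, u} \<in> E" "g' w = 2"
      using g' u(1) by (auto simp: rdf_def)
    have "2 \<le> g w" using le w by force
    then have "g w = 2" using lab(1)[OF w(1)] by auto
    then show False using u(3) w ne \<open>g v = 2\<close> by auto
  qed
qed

lemma minimal_rdf_private:
  assumes min: "minimal_rdf V E g" and v: "v \<in> V" "g v = 2"
  shows "\<exists>u \<in> V. g u = 0 \<and> {v, u} \<in> E \<and> (\<forall>w \<in> V. {w, u} \<in> E \<and> g w = 2 \<longrightarrow> w = v)"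
proof (rule ccontr)
  assume contr: "\<not> ?thesis"
  have rdf: "rdf V E g" using min by (simp add: minimal_rdf_def)
  \<comment> \<open>With value 1 rather than 0 the vertex \<open>v\<close> itself needs no
    domination, so only its neighbours could object.\<close>
  let ?g = "g(v := 1)"
  have "rdf V E ?g"
    unfolding rdf_def
  proof (intro conjI ballI impI)
    show "labelling V ?g" using rdf by (auto simp: rdf_def labelling_def)
    fix u assume u: "u \<in> V" "?g u = 0"
    then have gu: "g u = 0" "u \<noteq> v" by (auto split: if_splits)
    obtain w where w: "w \<in> V" "{w, u} \<in> E" "g w = 2"
      using rdf u(1) gu by (auto simp: rdf_def)
    show "\<exists>w \<in> V. {w, u} \<in> E \<and> ?g w = 2"
    proof (cases "w = v")
      case True
      then obtain w' where "w' \<in> V" "{w', u} \<in> E" "g w' = 2" "w' \<noteq> v"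
        using contr u(1) gu(1) w(2) by blast
      then show ?thesis by auto
    next
      case False
      then show ?thesis using w by auto
    qed
  qed
  moreover have "\<forall>u \<in> V. ?g u \<le> g u" using v by simp
  ultimately have "?g v = g v" using min v(1) unfolding minimal_rdf_def by blast
  then show False using v(2) by simp
qed

section \<open>Invariance under renaming of vertices\<close>

lemma rdf_transfer:
  assumes "\<And>u v. u \<in> U \<Longrightarrow> v \<in> U \<Longrightarrow> {m u, m v} \<in> E' \<longleftrightarrow> {u, v} \<in> E"
    and "\<And>u. u \<in> U \<Longrightarrow> g' (m u) = g u"
  shows "rdf (m ` U) E' g' \<longleftrightarrow> rdf U E g"
  using assms by (auto simp: rdf_def labelling_def)

text \<open>Labellings travel along \<open>m\<close> and, by injectivity, back along its inverse.
  Edges enter only as adjacency of two vertices, so it is enough that \<open>m\<close> preserves and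
  reflects adjacency.\<close>

lemma bounded_extension_transfer:
  assumes inj: "inj_on m U"
    and E: "\<And>u v. u \<in> U \<Longrightarrow> v \<in> U \<Longrightarrow> {m u, m v} \<in> E' \<longleftrightarrow> {u, v} \<in> E"
    and f: "\<And>u. u \<in> U \<Longrightarrow> f' (m u) = f u" and h: "\<And>u. u \<in> U \<Longrightarrow> h' (m u) = h u"
  shows "bounded_extension (m ` U) E' f' h' \<longleftrightarrow> bounded_extension U E f h"
proof -
  let ?i = "inv_into U m"
  have i: "?i (m u) = u" if "u \<in> U" for u using inj that by (rule inv_into_f_f)
  have tr: "rdf (m ` U) E' g' \<longleftrightarrow> rdf U E g" if "\<And>u. u \<in> U \<Longrightarrow> g' (m u) = g u" for g' g
    using rdf_transfer[of U m E' E g' g] E that by blast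
  have min: "minimal_rdf (m ` U) E' g' \<longleftrightarrow> minimal_rdf U E g"
    if gg: "\<And>u. u \<in> U \<Longrightarrow> g' (m u) = g u" for g' g
  proof
    assume min: "minimal_rdf (m ` U) E' g'"
    show "minimal_rdf U E g"
      unfolding minimal_rdf_def
    proof (intro conjI allI impI ballI)
      show "rdf U E g" using min tr[of g' g] gg by (auto simp: minimal_rdf_def)
      fix k v assume k: "rdf U E k" "\<forall>v \<in> U. k v \<le> g v" "v \<in> U"
      have "rdf (m ` U) E' (k \<circ> ?i)" using k(1) tr[of "k \<circ> ?i" k] i by auto
      moreover have "\<forall>v \<in> m ` U. (k \<circ> ?i) v \<le> g' v" using k(2) i gg by auto
      ultimately have "\<forall>v \<in> m ` U. (k \<circ> ?i) v = g' v"
        using min unfolding minimal_rdf_def by blast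
      then show "k v = g v" using k(3) i gg by auto
    qed
  next
    assume min: "minimal_rdf U E g"
    show "minimal_rdf (m ` U) E' g'"
      unfolding minimal_rdf_def
    proof (intro conjI allI impI)
      show "rdf (m ` U) E' g'" using min tr[of g' g] gg by (auto simp: minimal_rdf_def)
      fix k assume k: "rdf (m ` U) E' k" "\<forall>v \<in> m ` U. k v \<le> g' v"
      have "rdf U E (k \<circ> m)" using k(1) tr[of k "k \<circ> m"] by auto
      moreover have "\<forall>v \<in> U. (k \<circ> m) v \<le> g v" using k(2) gg by auto
      ultimately have "\<forall>v \<in> U. (k \<circ> m) v = g v"
        using min unfolding minimal_rdf_def by blast
      then show "\<forall>v \<in> m ` U. k v = g' v" using gg by auto
    qed
  qed
  show ?thesis
  proof
    assume "bounded_extension (m ` U) E' f' h'"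
    then obtain g' where "minimal_rdf (m ` U) E' g'" "\<forall>v \<in> m ` U. f' v \<le> g' v \<and> g' v \<le> h' v"
      unfolding bounded_extension_def by blast
    then have "minimal_rdf U E (g' \<circ> m) \<and> (\<forall>v \<in> U. f v \<le> (g' \<circ> m) v \<and> (g' \<circ> m) v \<le> h v)"
      using min[of g' "g' \<circ> m"] f h by auto
    then show "bounded_extension U E f h" unfolding bounded_extension_def by blast
  next
    assume "bounded_extension U E f h"
    then obtain g where "minimal_rdf U E g" "\<forall>v \<in> U. f v \<le> g v \<and> g v \<le> h v"
      unfolding bounded_extension_def by blast
    then have "minimal_rdf (m ` U) E' (g \<circ> ?i) \<and>
        (\<forall>v \<in> m ` U. f' v \<le> (g \<circ> ?i) v \<and> (g \<circ> ?i) v \<le> h' v)"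
      using min[of "g \<circ> ?i" g] f h i by auto
    then show "bounded_extension (m ` U) E' f' h'" unfolding bounded_extension_def by blast
  qed
qed

text \<open>A slot \<open>a\<close> is to be filled with a candidate \<open>x\<close> such that \<open>left x = a\<close>. A disjunct is a list
  of candidates, true if none of them is chosen, and a clause is a list of disjuncts.\<close>

definition selectable :: "tree set \<Rightarrow> tree set \<Rightarrow> tree set \<Rightarrow> bool" where
  "selectable A X Cl \<longleftrightarrow> (\<exists>p. (\<forall>a \<in> A. p a \<in> X \<and> left (p a) = a) \<and>
     (\<forall>w \<in> Cl. \<exists>b \<in> set (elems w). \<forall>a \<in> A. p a \<notin> set (elems b)))"

abbreviation slot_tag :: tree where "slot_tag \<equiv> Lf"
abbreviation cand_tag :: tree where "cand_tag \<equiv> Br Lf Lf"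
abbreviation disj_tag :: tree where "disj_tag \<equiv> Br Lf (Br Lf Lf)"
abbreviation clause_tag :: tree where "clause_tag \<equiv> Br (Br Lf Lf) Lf"

text \<open>In order: the clique of slots and disjuncts; a slot and the candidates for it, its
  possible private neighbours; a disjunct and the candidates whose privacy it destroys; a disjunct
  and the clauses it can dominate. In the last three cases the end in the clique comes
  first.\<close>

definition arc :: "tree \<Rightarrow> tree \<Rightarrow> bool" where
  "arc u v \<longleftrightarrow>
     u \<noteq> v \<and> (left u = slot_tag \<or> left u = disj_tag) \<and> (left v = slot_tag \<or> left v = disj_tag) \<or>
     left u = slot_tag \<and> left v = cand_tag \<and> left (right v) = right u \<or>
     left u = disj_tag \<and> left v = cand_tag \<and> right v \<in> set (elems (right u)) \<or>
     left u = disj_tag \<and> left v = clause_tag \<and> right u \<in> set (elems (right v))"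

text \<open>The two bounds pin slots to 2, candidates and clauses to 0; only the disjuncts remain
  free.\<close>

definition lower_bound :: "tree \<Rightarrow> nat" where
  "lower_bound u = (if left u = slot_tag then 2 else 0)"

definition upper_bound :: "tree \<Rightarrow> nat" where
  "upper_bound u = (if left u = cand_tag \<or> left u = clause_tag then 0 else 2)"

definition selection_verts :: "tree set \<Rightarrow> tree set \<Rightarrow> tree set \<Rightarrow> tree set" where
  "selection_verts A X Cl = Br slot_tag ` A \<union> Br cand_tag ` X \<union>
     Br disj_tag ` (\<Union>w \<in> Cl. set (elems w)) \<union> Br clause_tag ` Cl"

definition arc_edges :: "tree set \<Rightarrow> tree set set" where
  "arc_edges V = {{u, v} | u v. u \<in> V \<and> v \<in> V \<and> arc u v}"

lemma arc_edges_iff: "u \<in> V \<Longrightarrow> v \<in> V \<Longrightarrow> {u, v} \<in> arc_edges V \<longleftrightarrow> arc u v \<or> arc v u"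
  by (auto simp: arc_edges_def doubleton_eq_iff)

lemma arc_irrefl: "arc u v \<Longrightarrow> u \<noteq> v"
  by (auto simp: arc_def)

text \<open>The clique contains a second slot, so the private neighbour of a slot is a candidate. Conversely
  an inclusion-minimal set of disjuncts that hits all clauses gives each disjunct a private clause.\<close>

lemma selectable_iff_bounded_extension:
  assumes fin: "finite A" "finite X" "finite Cl" and X: "\<And>x. x \<in> X \<Longrightarrow> left x \<in> A"
    and A: "a1 \<in> A" "a2 \<in> A" "a1 \<noteq> a2"
  defines "V \<equiv> selection_verts A X Cl"
  shows "bounded_extension V (arc_edges V) lower_bound upper_bound \<longleftrightarrow> selectable A X Cl"
proof
  let ?E = "arc_edges V"
  assume "bounded_extension V ?E lower_bound upper_bound"
  then obtain g where min: "minimal_rdf V ?E g" and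
    bds: "\<And>v. v \<in> V \<Longrightarrow> lower_bound v \<le> g v \<and> g v \<le> upper_bound v"
    unfolding bounded_extension_def by blast
  have rdf: "rdf V ?E g" using min by (simp add: minimal_rdf_def)
  have AV: "Br slot_tag a \<in> V" if "a \<in> A" for a using that by (auto simp: V_def selection_verts_def)
  have gA: "g (Br slot_tag a) = 2" if "a \<in> A" for a
    using bds[OF AV[OF that]] by (simp add: lower_bound_def upper_bound_def)
  have "\<exists>x. x \<in> X \<and> left x = a \<and> (\<forall>b. Br disj_tag b \<in> V \<and> g (Br disj_tag b) = 2 \<longrightarrow> x \<notin> set (elems b))"
    if a: "a \<in> A" for a
  proof -
    obtain u where u: "u \<in> V" "g u = 0" "{Br slot_tag a, u} \<in> ?E"
      "\<forall>w \<in> V. {w, u} \<in> ?E \<and> g w = 2 \<longrightarrow> w = Br slot_tag a"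
      using minimal_rdf_private[OF min AV[OF a] gA[OF a]] by blast
    obtain a' where a': "a' \<in> A" "a' \<noteq> a" using A by blast
    have adj: "arc (Br slot_tag a) u \<or> arc u (Br slot_tag a)"
      using u(3) arc_edges_iff[OF AV[OF a] u(1)] by simp
    have "left u \<noteq> disj_tag"
    proof
      assume "left u = disj_tag"
      then have "arc (Br slot_tag a') u" by (auto simp: arc_def)
      then show False using u(4) AV[OF a'(1)] gA[OF a'(1)] a' arc_edges_iff[OF AV[OF a'(1)] u(1)] by auto
    qed
    moreover have "left u \<noteq> slot_tag"
    proof
      assume "left u = slot_tag"
      then obtain a'' where "u = Br slot_tag a''" "a'' \<in> A"
        using u(1) by (auto simp: V_def selection_verts_def)
      then show False using gA u(2) by auto
    qed
    ultimately have "left u = cand_tag" "left (right u) = a" using adj by (auto simp: arc_def)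
    then obtain x where x: "u = Br cand_tag x" "x \<in> X" "left x = a"
      using u(1) by (auto simp: V_def selection_verts_def)
    have "x \<notin> set (elems b)" if b: "Br disj_tag b \<in> V" "g (Br disj_tag b) = 2" for b
    proof
      assume "x \<in> set (elems b)"
      then have "{Br disj_tag b, u} \<in> ?E"
        using x(1) arc_edges_iff[OF b(1) u(1)] by (simp add: arc_def)
      then show False using u(4) b by blast
    qed
    then show ?thesis using x by blast
  qed
  then have "\<forall>a \<in> A. \<exists>x. x \<in> X \<and> left x = a \<and>
      (\<forall>b. Br disj_tag b \<in> V \<and> g (Br disj_tag b) = 2 \<longrightarrow> x \<notin> set (elems b))"
    by blast
  from bchoice[OF this] obtain p where p: "\<And>a. a \<in> A \<Longrightarrow> p a \<in> X \<and> left (p a) = a \<and>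
      (\<forall>b. Br disj_tag b \<in> V \<and> g (Br disj_tag b) = 2 \<longrightarrow> p a \<notin> set (elems b))"
    by blast
  have "\<exists>b \<in> set (elems w). \<forall>a \<in> A. p a \<notin> set (elems b)" if w: "w \<in> Cl" for w
  proof -
    have wV: "Br clause_tag w \<in> V" using w by (auto simp: V_def selection_verts_def)
    have "g (Br clause_tag w) = 0" using bds[OF wV] by (simp add: upper_bound_def)
    then obtain u where u: "u \<in> V" "{u, Br clause_tag w} \<in> ?E" "g u = 2"
      using rdf wV by (auto simp: rdf_def)
    then have "left u = disj_tag" "right u \<in> set (elems w)"
      using arc_edges_iff[OF u(1) wV] by (auto simp: arc_def)
    then have "\<forall>a \<in> A. p a \<notin> set (elems (right u))" using p u by (cases u) auto
    then show ?thesis using \<open>right u \<in> set (elems w)\<close> by blast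
  qed
  then show "selectable A X Cl" unfolding selectable_def using p by blast
next
  let ?E = "arc_edges V"
  assume "selectable A X Cl"
  then obtain p where p: "\<And>a. a \<in> A \<Longrightarrow> p a \<in> X \<and> left (p a) = a"
    and cl: "\<And>w. w \<in> Cl \<Longrightarrow> \<exists>b \<in> set (elems w). \<forall>a \<in> A. p a \<notin> set (elems b)"
    unfolding selectable_def by blast
  let ?B = "\<Union>w \<in> Cl. set (elems w)"
  \<comment> \<open>The disjuncts that hold under \<open>p\<close>: exactly these can receive 2
    without spoiling the privacy of a chosen candidate.\<close>
  define S0 where "S0 = {b \<in> ?B. \<forall>a \<in> A. p a \<notin> set (elems b)}"
  define dom where "dom S \<longleftrightarrow> S \<subseteq> S0 \<and> (\<forall>w \<in> Cl. \<exists>b \<in> S. b \<in> set (elems w))" for S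
  have "dom S0" using cl unfolding dom_def S0_def by blast
  then obtain S where S: "dom S" "\<And>S'. dom S' \<Longrightarrow> card S \<le> card S'"
    using ex_has_least_nat[of dom S0 card] by blast
  have finS: "finite S" using S(1) fin unfolding dom_def S0_def by (auto intro: finite_subset)
  have priv: "\<exists>w \<in> Cl. b \<in> set (elems w) \<and> (\<forall>b' \<in> S. b' \<in> set (elems w) \<longrightarrow> b' = b)" if b: "b \<in> S" for b
  proof (rule ccontr)
    assume "\<not> ?thesis"
    then have "dom (S - {b})" using S(1) unfolding dom_def by blast
    then show False using S(2)[of "S - {b}"] finS b card_Diff1_less[OF finS b] by simp
  qed
  define g where "g u = (if left u = slot_tag \<or> left u = disj_tag \<and> right u \<in> S then 2 else (0::nat))" for u
  have AV: "Br slot_tag a \<in> V" if "a \<in> A" for a using that by (auto simp: V_def selection_verts_def)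
  have XV: "Br cand_tag x \<in> V" if "x \<in> X" for x using that by (auto simp: V_def selection_verts_def)
  have WV: "Br clause_tag w \<in> V" if "w \<in> Cl" for w using that by (auto simp: V_def selection_verts_def)
  have BV: "Br disj_tag b \<in> V" if "b \<in> S" for b
    using that S(1) unfolding V_def selection_verts_def dom_def S0_def by blast
  have "rdf V ?E g"
    unfolding rdf_def
  proof (intro conjI ballI impI)
    show "labelling V g" by (auto simp: labelling_def g_def)
    fix v assume v: "v \<in> V" "g v = 0"
    have *: "\<exists>u \<in> V. {u, v} \<in> ?E \<and> g u = 2" if "u \<in> V" "arc u v" "g u = 2" for u
      using that arc_edges_iff[OF that(1) v(1)] by blast
    consider x where "v = Br cand_tag x" "x \<in> X" | b where "v = Br disj_tag b"
      | w where "v = Br clause_tag w" "w \<in> Cl"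
      using v by (auto simp: V_def selection_verts_def g_def)
    then show "\<exists>u \<in> V. {u, v} \<in> ?E \<and> g u = 2"
    proof cases
      case 1
      show ?thesis
        by (rule *[of "Br slot_tag (left x)"]) (use 1 AV X in \<open>auto simp: arc_def g_def\<close>)
    next
      case 2
      show ?thesis
        by (rule *[of "Br slot_tag a1"]) (use 2 AV A in \<open>auto simp: arc_def g_def\<close>)
    next
      case 3
      then obtain b where b: "b \<in> S" "b \<in> set (elems w)" using S(1) unfolding dom_def by blast
      show ?thesis
        by (rule *[of "Br disj_tag b"]) (use BV 3 b in \<open>auto simp: arc_def g_def\<close>)
    qed
  qed
  moreover have "\<exists>u \<in> V. g u = 0 \<and> (\<forall>w \<in> V. {w, u} \<in> ?E \<and> g w = 2 \<longrightarrow> w = v)"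
    if v: "v \<in> V" "g v = 2" for v
  proof -
    consider a where "v = Br slot_tag a" "a \<in> A" | b where "v = Br disj_tag b" "b \<in> S"
      using v by (auto simp: V_def selection_verts_def g_def split: if_splits)
    then show ?thesis
    proof cases
      case 1
      let ?u = "Br cand_tag (p a)"
      have uV: "?u \<in> V" using p 1 XV by blast
      have "w = v" if w: "w \<in> V" "{w, ?u} \<in> ?E" "g w = 2" for w
      proof -
        have "arc w ?u" using arc_edges_iff[OF w(1) uV] w(2) by (auto simp: arc_def)
        moreover have "b \<in> S \<Longrightarrow> p a \<notin> set (elems b)" for b
          using S(1) 1 unfolding dom_def S0_def by blast
        ultimately have "left w = slot_tag" "right w = a"
          using w(3) p[OF 1(2)] by (auto simp: arc_def g_def split: if_splits)
        then show ?thesis using 1(1) w(1) by (cases w) (auto simp: V_def selection_verts_def)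
      qed
      then show ?thesis using uV by (intro bexI[of _ ?u]) (auto simp: g_def)
    next
      case 2
      then obtain c where c: "c \<in> Cl" "\<forall>b' \<in> S. b' \<in> set (elems c) \<longrightarrow> b' = b" using priv by blast
      let ?u = "Br clause_tag c"
      have "w = v" if w: "w \<in> V" "{w, ?u} \<in> ?E" "g w = 2" for w
      proof -
        have "arc w ?u" using arc_edges_iff[OF w(1) WV[OF c(1)]] w(2) by (auto simp: arc_def)
        then have "left w = disj_tag" "right w \<in> S" "right w \<in> set (elems c)"
          using w(3) by (auto simp: arc_def g_def split: if_splits)
        then show ?thesis using c(2) 2(1) by (cases w) auto
      qed
      then show ?thesis using WV[OF c(1)] by (intro bexI[of _ ?u]) (auto simp: g_def)
    qed
  qed
  moreover have "g v \<noteq> 1" for v by (simp add: g_def)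
  ultimately have "minimal_rdf V ?E g" by (intro minimal_rdfI) auto
  moreover have "lower_bound v \<le> g v \<and> g v \<le> upper_bound v" for v
    by (auto simp: lower_bound_def upper_bound_def g_def)
  ultimately show "bounded_extension V ?E lower_bound upper_bound"
    unfolding bounded_extension_def by blast
qed

subsection \<open>Numbering the vertices\<close>

text \<open>The vertex with number \<open>i\<close> is \<open>rev L ! i\<close>: the number of the head of a suffix of \<open>L\<close> is
  the length of its tail.\<close>

definition instance_of :: "tree list \<Rightarrow> berd_instance" where
  "instance_of L = (length L,
     concat (map (\<lambda>s. concat (map (\<lambda>t. if arc (hd s) (hd t) then [(length (tl s), length (tl t))] else [])
       (tails L))) (tails L)),
     map lower_bound (rev L), map upper_bound (rev L))"

lemma tails_number: "(\<lambda>s. (length (tl s), hd s)) ` set (tails L) = (\<lambda>i. (i, rev L ! i)) ` {..<length L}"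
proof (induction L)
  case (Cons a L)
  have "(\<lambda>i. (i, rev (a # L) ! i)) ` {..<length (a # L)} =
      insert (length L, a) ((\<lambda>i. (i, rev L ! i)) ` {..<length L})"
    by (auto simp: lessThan_Suc nth_append image_iff)
  then show ?case using Cons by simp
qed simp

lemma verts_instance_of [simp]: "verts (instance_of L) = {..<length L}"
  by (simp add: instance_of_def)

lemma edges_instance_of:
  "edges (instance_of L) = {{i, j} | i j. i < length L \<and> j < length L \<and> arc (rev L ! i) (rev L ! j)}"
proof -
  have *: "(\<exists>s \<in> set (tails L). P (length (tl s)) (hd s)) \<longleftrightarrow> (\<exists>i < length L. P i (rev L ! i))" for P
  proof -
    have "(\<exists>s \<in> set (tails L). P (length (tl s)) (hd s)) \<longleftrightarrow>
        (\<exists>q \<in> (\<lambda>s. (length (tl s), hd s)) ` set (tails L). P (fst q) (snd q))" by simp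
    then show ?thesis unfolding tails_number by auto
  qed
  have "(i, j) \<in> set (fst (snd (instance_of L))) \<longleftrightarrow> (\<exists>s \<in> set (tails L). \<exists>t \<in> set (tails L).
      arc (hd s) (hd t) \<and> i = length (tl s) \<and> j = length (tl t))" for i j
    by (auto simp: instance_of_def)
  then have "(i, j) \<in> set (fst (snd (instance_of L))) \<longleftrightarrow>
      i < length L \<and> j < length L \<and> arc (rev L ! i) (rev L ! j)" for i j
    using *[of "\<lambda>i' u. \<exists>t \<in> set (tails L). arc u (hd t) \<and> i = i' \<and> j = length (tl t)"]
      *[of "\<lambda>j' v. arc (rev L ! i) v \<and> j = j'"] by auto
  then have "set (fst (snd (instance_of L))) =
      {(i, j). i < length L \<and> j < length L \<and> arc (rev L ! i) (rev L ! j)}" by auto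
  moreover have "edges (instance_of L) = (\<lambda>(u, v). {u, v}) ` set (fst (snd (instance_of L)))"
    by (simp add: instance_of_def)
  ultimately show ?thesis by auto
qed

lemma lower_instance_of: "i < length L \<Longrightarrow> lower (instance_of L) i = lower_bound (rev L ! i)"
  by (simp add: instance_of_def)

lemma upper_instance_of: "i < length L \<Longrightarrow> upper (instance_of L) i = upper_bound (rev L ! i)"
  by (simp add: instance_of_def)

lemma wf_instance_of: "wf_berd (instance_of L)"
proof -
  obtain n es fs hs where J: "instance_of L = (n, es, fs, hs)" by (metis prod_cases4)
  have "simple_graph (verts (instance_of L)) (edges (instance_of L))"
    unfolding simple_graph_def edges_instance_of using arc_irrefl by (fastforce simp: card_2_iff)
  moreover have "fs = map lower_bound (rev L)" "hs = map upper_bound (rev L)" "n = length L"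
    using J by (simp_all add: instance_of_def)
  then have "length fs = n" "length hs = n" "labelling {..<n} (\<lambda>v. fs ! v)"
    "labelling {..<n} (\<lambda>v. hs ! v)"
    by (simp_all add: labelling_def lower_bound_def upper_bound_def)
  ultimately show ?thesis by (simp add: J)
qed

lemma instance_of_adj:
  assumes "i < length L" "j < length L"
  shows "{i, j} \<in> edges (instance_of L) \<longleftrightarrow> arc (rev L ! i) (rev L ! j) \<or> arc (rev L ! j) (rev L ! i)"
  unfolding edges_instance_of using assms by (auto simp: doubleton_eq_iff)

text \<open>\<open>arc\<close> distinguishes vertices as trees, so the clique property needs
  different numbers to carry different trees.\<close>

lemma split_instance_of:
  assumes tags: "\<And>u. u \<in> set L \<Longrightarrow> left u \<in> {slot_tag, cand_tag, disj_tag, clause_tag}"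
    and dist: "distinct L"
  shows "split_graph (verts (instance_of L)) (edges (instance_of L))"
proof -
  let ?V = "{..<length L}" and ?c = "\<lambda>i. left (rev L ! i) \<in> {slot_tag, disj_tag}"
  have inL: "rev L ! i \<in> set L" if "i < length L" for i
    using nth_mem[of i "rev L"] that by simp
  have "simple_graph (verts (instance_of L)) (edges (instance_of L))"
    using wf_instance_of[of L] by (metis prod_cases4 wf_berd.simps)
  moreover have "{i \<in> ?V. ?c i} \<union> {i \<in> ?V. \<not> ?c i} = ?V" "{i \<in> ?V. ?c i} \<inter> {i \<in> ?V. \<not> ?c i} = {}"
    by auto
  moreover have "\<forall>u \<in> {i \<in> ?V. ?c i}. \<forall>v \<in> {i \<in> ?V. ?c i}. u \<noteq> v \<longrightarrow> {u, v} \<in> edges (instance_of L)"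
    using dist by (auto simp: instance_of_adj arc_def nth_eq_iff_index_eq)
  moreover have "\<forall>u \<in> {i \<in> ?V. \<not> ?c i}. \<forall>v \<in> {i \<in> ?V. \<not> ?c i}. {u, v} \<notin> edges (instance_of L)"
    by (auto simp: instance_of_adj arc_def)
  ultimately show ?thesis unfolding split_graph_def verts_instance_of by blast
qed

lemma bounded_extension_instance_of:
  assumes "distinct L"
  shows "bounded_extension (verts (instance_of L)) (edges (instance_of L))
      (lower (instance_of L)) (upper (instance_of L)) \<longleftrightarrow>
    bounded_extension (set L) (arc_edges (set L)) lower_bound upper_bound"
proof -
  let ?m = "\<lambda>i. rev L ! i"
  have "?m ` {..<length L} = set (rev L)" by (auto simp del: set_rev simp: set_conv_nth)
  then have img: "?m ` {..<length L} = set L" by simp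
  have inL: "rev L ! i \<in> set L" if "i < length L" for i
    using nth_mem[of i "rev L"] that by simp
  have "bounded_extension (?m ` {..<length L}) (arc_edges (set L)) lower_bound upper_bound \<longleftrightarrow>
      bounded_extension {..<length L} (edges (instance_of L)) (lower (instance_of L)) (upper (instance_of L))"
  proof (rule bounded_extension_transfer)
    show "inj_on ?m {..<length L}" using assms by (auto simp: inj_on_def nth_eq_iff_index_eq)
  qed (auto simp: instance_of_adj arc_edges_iff[OF inL inL] lower_instance_of upper_instance_of)
  then show ?thesis by (simp add: img)
qed

lemma weight_instance_of:
  assumes "distinct L"
  shows "weight (verts (instance_of L)) (lower (instance_of L)) = 2 * card {u \<in> set L. left u = slot_tag}"
proof -
  have "weight (verts (instance_of L)) (lower (instance_of L)) = (\<Sum>i<length L. lower_bound (rev L ! i))"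
    by (simp add: weight_def lower_instance_of)
  also have "\<dots> = sum_list (map lower_bound (rev L))"
    by (simp add: sum_list_sum_nth atLeast0LessThan)
  also have "\<dots> = sum lower_bound (set L)"
    using assms by (metis distinct_rev set_rev sum_list_distinct_conv_sum_set)
  also have "\<dots> = (\<Sum>u \<in> {u \<in> set L. left u = slot_tag}. 2)"
    by (intro sum.mono_neutral_cong_right) (auto simp: lower_bound_def)
  finally show ?thesis by simp
qed

section \<open>Polynomial time for the numbered instance\<close>

lemma polyp_arc: assumes "polyf f" "polyf g" shows "polyp (\<lambda>x. arc (f x) (g x))"
  unfolding arc_def
  by (intro polyp_conj polyp_disj polyp_not polyp_eq polyp_mem polyl_elems polyf_left polyf_right
      polyf_const assms)

lemma hd_conv_left: "s \<noteq> [] \<Longrightarrow> hd s = left (of_list s)"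
  by (cases s) auto

lemma tl_conv_right: "tl s = elems (right (of_list s))"
  by (cases s) auto

lemma polyf_instance_of: assumes "polyl L" shows "polyf (\<lambda>x. enc_berd (instance_of (L x)))"
proof -
  let ?pr = "\<lambda>s t. Br (enc_nat (length (elems (right (of_list s))))) (enc_nat (length (elems (right (of_list t)))))"
  let ?es = "\<lambda>L. concat (map (\<lambda>s. concat (map (\<lambda>t. if arc (left (of_list s)) (left (of_list t))
      then [?pr s t] else []) (tails L))) (tails L))"
  have es: "map (enc_pair enc_nat enc_nat) (fst (snd (instance_of L))) = ?es L" for L
  proof -
    have inner: "map (enc_pair enc_nat enc_nat)
        (if arc (hd s) (hd t) then [(length (tl s), length (tl t))] else []) =
      (if arc (left (of_list s)) (left (of_list t)) then [?pr s t] else [])"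
      if "s \<in> set (tails L)" "t \<in> set (tails L)" for s t
      using that by (simp add: set_tails hd_conv_left flip: tl_conv_right)
    show ?thesis
      unfolding instance_of_def fst_conv snd_conv map_concat map_map o_def
      by (rule arg_cong[of _ _ concat], rule map_cong[OF refl], rule arg_cong[of _ _ concat],
          rule map_cong[OF refl], rule inner)
  qed
  have "enc_berd (n, ps, fs, hs) = Br (enc_nat n) (Br (of_list (map (enc_pair enc_nat enc_nat) ps))
      (Br (of_list (map enc_nat fs)) (of_list (map enc_nat hs))))" for n ps fs hs
    by (simp add: enc_berd_def enc_list_map[of enc_nat] enc_list_map[of "enc_pair enc_nat enc_nat"])
  then have "enc_berd J = Br (enc_nat (fst J)) (Br (of_list (map (enc_pair enc_nat enc_nat) (fst (snd J))))
      (Br (of_list (map enc_nat (fst (snd (snd J))))) (of_list (map enc_nat (snd (snd (snd J)))))))" for J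
    by (metis prod.collapse)
  from this[of "instance_of _"]
  have enc: "enc_berd (instance_of L) = Br (enc_nat (length L)) (Br (of_list (?es L))
      (Br (of_list (map (\<lambda>u. enc_nat (lower_bound u)) (rev L)))
        (of_list (map (\<lambda>u. enc_nat (upper_bound u)) (rev L)))))" for L
    unfolding es by (simp add: instance_of_def o_def)
  have L2: "polyl (\<lambda>z. L (left z))"
    using polyf_comp[OF assms[unfolded polyl_def] polyf_left[OF polyf_id]] by (simp add: polyl_def)
  show ?thesis
    unfolding enc lower_bound_def upper_bound_def if_distrib[of enc_nat]
    by (intro polyf_Br polyf_of_list polyl_concat_tails polyl_map polyl_rev polyf_enc_nat polyn_length
        polyl_if polyp_arc polyl_Cons polyl_Nil polyl_elems polyf_left polyf_right polyf_id
        polyf_const polyf_if polyp_eq polyp_disj assms L2)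
qed

section \<open>Circuits\<close>

lemma length_node_values: "length (node_values F init gs) = length init + length gs"
  by (induction gs rule: rev_induct) (auto simp: node_values_def)

lemma node_values_snoc:
  "node_values F init (gs @ [g]) =
     node_values F init gs @ [F g (map (\<lambda>i. node_values F init gs ! i) (preds g))]"
  by (simp add: node_values_def)

lemma node_values_nth_init: "i < length init \<Longrightarrow> node_values F init gs ! i = init ! i"
proof (induction gs rule: rev_induct)
  case Nil then show ?case by (simp add: node_values_def)
next
  case (snoc g gs)
  then show ?case by (simp add: node_values_snoc nth_append length_node_values)
qed

text \<open>Later gates only append values and predecessors have smaller numbers, so the values seen
  when a gate is evaluated are those of the final list. This turns the fold into a recursive
  equation.\<close>

lemma node_values_nth_gate:
  assumes "j < length gs" "\<forall>j < length gs. \<forall>i \<in> set (preds (gs ! j)). i < length init + j"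
  shows "node_values F init gs ! (length init + j) =
    F (gs ! j) (map (\<lambda>i. node_values F init gs ! i) (preds (gs ! j)))"
  using assms
proof (induction gs rule: rev_induct)
  case Nil then show ?case by simp
next
  case (snoc g gs)
  let ?v = "node_values F init gs"
  have small: "i < length ?v" if "i \<in> set (preds ((gs @ [g]) ! j))" for i
    using snoc.prems that by (fastforce simp: length_node_values)
  have pr: "map (\<lambda>i. node_values F init (gs @ [g]) ! i) (preds ((gs @ [g]) ! j)) =
      map (\<lambda>i. ?v ! i) (preds ((gs @ [g]) ! j))"
    using small by (auto simp: node_values_snoc nth_append)
  show ?case
  proof (cases "j < length gs")
    case True
    have "\<forall>j < length gs. \<forall>i \<in> set (preds (gs ! j)). i < length init + j"
      using snoc.prems(2) by (force simp: nth_append)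
    then show ?thesis unfolding pr using snoc.IH True
      by (simp add: node_values_snoc nth_append length_node_values)
  next
    case False
    then have "j = length gs" using snoc.prems(1) by simp
    then show ?thesis unfolding pr
      by (simp add: node_values_snoc nth_append length_node_values)
  qed
qed

lemma last_node_values:
  "gs \<noteq> [] \<Longrightarrow> last (node_values F init gs) = node_values F init gs ! (length init + length gs - 1)"
  using length_node_values[of F init gs]
  by (cases "node_values F init gs = []") (auto simp: last_conv_nth)

section \<open>Formulas\<close>

text \<open>A formula is a tree \<open>Br s (Br m p)\<close>: a sign \<open>s\<close> (\<open>Lf\<close> for plus) and either the variable
  numbered \<open>p\<close> (if \<open>m = Lf\<close>) or the conjunction of the list \<open>p\<close> of formulas.\<close>

abbreviation num :: "tree \<Rightarrow> nat" where "num t \<equiv> length (elems t)"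
abbreviation atomic :: "tree \<Rightarrow> bool" where "atomic t \<equiv> left (right t) = Lf"
abbreviation body :: "tree \<Rightarrow> tree" where "body t \<equiv> right (right t)"
abbreviation binary :: "tree \<Rightarrow> bool" where "binary p \<equiv> right (right p) = Lf"

definition var :: "tree \<Rightarrow> tree" where "var i = Br Lf (Br Lf i)"

definition conj_of :: "tree list \<Rightarrow> tree" where "conj_of ts = Br Lf (Br (Br Lf Lf) (of_list ts))"

text \<open>Negation changes only the sign, so it adds neither height nor weft, and a disjunction
  can be written as a negated conjunction.\<close>

definition flip :: "tree \<Rightarrow> tree" where
  "flip t = Br (if left t = Lf then Br Lf Lf else Lf) (right t)"

lemma left_flip [simp]: "left (flip t) = Lf \<longleftrightarrow> left t \<noteq> Lf"
  and right_flip [simp]: "right (flip t) = right t"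
  by (simp_all add: flip_def)

lemma tsize_right_le: "tsize (right t) \<le> tsize t"
  by (cases t) auto

function formula_value :: "nat set \<Rightarrow> tree \<Rightarrow> bool" where
  "formula_value T t \<longleftrightarrow> (left t = Lf) =
     (if atomic t then num (body t) \<in> T else \<forall>c \<in> set (elems (body t)). formula_value T c)"
  by auto
termination
proof (relation "measure (\<lambda>(T, t). tsize t)")
  fix T t c assume "c \<in> set (elems (body t))"
  then show "((T, c), T, t) \<in> measure (\<lambda>(T, t). tsize t)"
    using tsize_elem[of c "body t"] tsize_right_le[of t] tsize_right_le[of "right t"] by simp
qed simp

declare formula_value.simps [simp del]

lemma formula_value_flip [simp]: "formula_value T (flip t) \<longleftrightarrow> \<not> formula_value T t"
  using formula_value.simps[of T t] formula_value.simps[of T "flip t"] by auto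

lemma formula_value_var [simp]: "formula_value T (var i) \<longleftrightarrow> num i \<in> T"
  by (subst formula_value.simps) (simp add: var_def)

lemma formula_value_conj_of [simp]:
  "formula_value T (conj_of ts) \<longleftrightarrow> (\<forall>c \<in> set ts. formula_value T c)"
  by (subst formula_value.simps) (simp add: conj_of_def)

text \<open>The formula \<open>t\<close> is equivalent to the disjunction of \<open>dnf d t\<close>, where \<open>d\<close> bounds the
  height of \<open>t\<close>: disjunctions and binary conjunctions are multiplied out, but a large conjunction
  is left alone.\<close>

primrec dnf :: "nat \<Rightarrow> tree \<Rightarrow> tree list" where
  "dnf 0 t = [t]"
| "dnf (Suc d) t =
     (if atomic t then [t]
      else if left t \<noteq> Lf then concat (map (\<lambda>c. dnf d (flip c)) (elems (body t)))
      else if binary (body t) then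
        concat (map (\<lambda>i. map (\<lambda>j. conj_of [i, j])
            (dnf d (left (if right (body t) = Lf then body t else right (body t)))))
          (dnf d (left (body t))))
      else [t])"

text \<open>Empty conjunctions are excluded because \<open>binary Lf\<close> holds, and
  \<open>dnf\<close> reads a first conjunct from every positive binary body.\<close>

primrec height_le :: "nat \<Rightarrow> tree \<Rightarrow> bool" where
  "height_le 0 t \<longleftrightarrow> atomic t"
| "height_le (Suc h) t \<longleftrightarrow> atomic t \<or> body t \<noteq> Lf \<and> (\<forall>c \<in> set (elems (body t)). height_le h c)"

primrec weft_le :: "nat \<Rightarrow> nat \<Rightarrow> tree \<Rightarrow> bool" where
  "weft_le 0 w t \<longleftrightarrow> atomic t"
| "weft_le (Suc h) w t \<longleftrightarrow> atomic t \<or> body t \<noteq> Lf \<and>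
     (if binary (body t) then \<forall>c \<in> set (elems (body t)). weft_le h w c
      else 0 < w \<and> (\<forall>c \<in> set (elems (body t)). weft_le h (w - 1) c))"

text \<open>The shape of the members of \<open>dnf h t\<close>: binary conjunctions of literals and large
  conjunctions, where only the large ones contribute to the weft.\<close>

primrec conj_weft_le :: "nat \<Rightarrow> nat \<Rightarrow> tree \<Rightarrow> bool" where
  "conj_weft_le 0 w t \<longleftrightarrow> atomic t"
| "conj_weft_le (Suc h) w t \<longleftrightarrow> atomic t \<or> left t = Lf \<and> body t \<noteq> Lf \<and>
     (if binary (body t) then \<forall>c \<in> set (elems (body t)). conj_weft_le h w c
      else 0 < w \<and> (\<forall>c \<in> set (elems (body t)). weft_le h (w - 1) c))"

lemma height_le_flip [simp]: "height_le h (flip t) = height_le h t"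
  by (cases h) auto

lemma weft_le_flip [simp]: "weft_le h w (flip t) = weft_le h w t"
  by (cases h) auto

lemma weft_le_height_le: "weft_le h w t \<Longrightarrow> height_le h t"
  by (induction h arbitrary: w t) (auto split: if_splits)

lemma conj_weft_le_height_le: "conj_weft_le h w t \<Longrightarrow> height_le h t"
  by (induction h arbitrary: w t) (auto split: if_splits dest: weft_le_height_le)

lemma weft_le_mono: "weft_le h w t \<Longrightarrow> w \<le> w' \<Longrightarrow> weft_le (Suc h) w' t"
proof (induction h arbitrary: w w' t)
  case (Suc h)
  have IH: "weft_le h w c \<Longrightarrow> weft_le (Suc h) w' c" "weft_le h (w - 1) c \<Longrightarrow> weft_le (Suc h) (w' - 1) c" for c
    using Suc.IH[of w c w'] Suc.IH[of "w - 1" c "w' - 1"] Suc.prems(2) by auto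
  show ?case
    using Suc.prems IH by (subst weft_le.simps) (auto simp del: weft_le.simps(2) simp: weft_le.simps(2)[of h w t] split: if_splits)
qed simp

lemma conj_weft_le_mono: "conj_weft_le h w t \<Longrightarrow> w \<le> w' \<Longrightarrow> conj_weft_le (Suc h) w' t"
proof (induction h arbitrary: w w' t)
  case (Suc h)
  have IH: "conj_weft_le h w c \<Longrightarrow> conj_weft_le (Suc h) w' c" "weft_le h (w - 1) c \<Longrightarrow> weft_le (Suc h) (w' - 1) c" for c
    using Suc.IH[of w c w'] weft_le_mono[of h "w - 1" c "w' - 1"] Suc.prems(2) by auto
  show ?case
    using Suc.prems IH
    by (subst conj_weft_le.simps)
       (auto simp del: conj_weft_le.simps(2) weft_le.simps simp: conj_weft_le.simps(2)[of h w t] split: if_splits)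
qed simp

lemma conj_weft_le_conj_of:
  "conj_weft_le h w i \<Longrightarrow> conj_weft_le h w j \<Longrightarrow> conj_weft_le (Suc h) w (conj_of [i, j])"
  by (simp add: conj_of_def)

lemma binary_cases:
  assumes "binary p" "p \<noteq> Lf"
  obtains a where "p = Br a Lf" | a b where "p = Br a (Br b Lf)"
  using assms by (metis left.simps right.simps tree.exhaust)

section \<open>Multiplying out: truth values and weft\<close>

lemma formula_value_dnf:
  "height_le h t \<Longrightarrow> formula_value T t \<longleftrightarrow> (\<exists>i \<in> set (dnf h t). formula_value T i)"
proof (induction h arbitrary: t)
  case (Suc h)
  consider "atomic t" | "\<not> atomic t" "left t \<noteq> Lf" | "\<not> atomic t" "left t = Lf" "binary (body t)"
    | "\<not> atomic t" "left t = Lf" "\<not> binary (body t)" by blast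
  then show ?case
  proof cases
    case 2
    have "formula_value T t \<longleftrightarrow> (\<exists>c \<in> set (elems (body t)). formula_value T (flip c))"
      using 2 by (subst formula_value.simps) simp
    also have "\<dots> \<longleftrightarrow> (\<exists>c \<in> set (elems (body t)). \<exists>i \<in> set (dnf h (flip c)). formula_value T i)"
      using Suc 2 by (intro bex_cong refl Suc.IH) auto
    finally show ?thesis using 2 by simp
  next
    case 3
    have ne: "body t \<noteq> Lf" using Suc.prems 3 by simp
    have val: "formula_value T t \<longleftrightarrow> (\<forall>c \<in> set (elems (body t)). formula_value T c)"
      using 3 by (subst formula_value.simps) simp
    have IH: "formula_value T c \<longleftrightarrow> (\<exists>i \<in> set (dnf h c). formula_value T i)"
      if "c \<in> set (elems (body t))" for c
      using that Suc 3 by auto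
    show ?thesis
      using 3(3) ne
    proof (cases rule: binary_cases)
      \<comment> \<open>\<open>dnf\<close> treats a conjunction with the single member
        \<open>a\<close> as \<open>a\<close> taken twice.\<close>
      case (1 a)
      then show ?thesis using 3 val IH[of a] by auto
    next
      case (2 a b)
      then show ?thesis using 3 val IH[of a] IH[of b] by auto
    qed
  qed auto
qed simp

text \<open>Each conjunction built by \<open>dnf\<close> takes the place of a small conjunction of
  \<open>t\<close>, and a disjunction gives way to its members, so neither height nor weft grows.
  Keeping the height is what later limits the number of literals to \<open>2 ^ h\<close>.\<close>

lemma dnf_conj_weft_le: "weft_le h w t \<Longrightarrow> i \<in> set (dnf h t) \<Longrightarrow> conj_weft_le h w i"
proof (induction h arbitrary: w t i)
  case (Suc h)
  consider "atomic t" | "\<not> atomic t" "left t \<noteq> Lf" | "\<not> atomic t" "left t = Lf" "binary (body t)"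
    | "\<not> atomic t" "left t = Lf" "\<not> binary (body t)" by blast
  then show ?case
  proof cases
    case 2
    then obtain c where c: "c \<in> set (elems (body t))" "i \<in> set (dnf h (flip c))"
      using Suc.prems by auto
    have "weft_le h w c \<or> weft_le h (w - 1) c" using Suc.prems(1) c(1) 2 by (auto split: if_splits)
    then have "conj_weft_le h w i \<or> conj_weft_le h (w - 1) i"
      using Suc.IH[of w "flip c" i] Suc.IH[of "w - 1" "flip c" i] c(2) by auto
    then show ?thesis
      using conj_weft_le_mono[of h w i w] conj_weft_le_mono[of h "w - 1" i w]
      by (auto simp del: conj_weft_le.simps)
  next
    case 3
    have ne: "body t \<noteq> Lf" using Suc.prems 3 by simp
    have IH: "conj_weft_le h w j" if "c \<in> set (elems (body t))" "j \<in> set (dnf h c)" for c j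
      using that Suc 3 by auto
    show ?thesis
      using 3(3) ne
    proof (cases rule: binary_cases)
      case (1 a)
      then show ?thesis using Suc.prems(2) 3 IH[of a] by (auto simp del: conj_weft_le.simps intro!: conj_weft_le_conj_of)
    next
      case (2 a b)
      then show ?thesis using Suc.prems(2) 3 IH[of a] IH[of b]
        by (auto simp del: conj_weft_le.simps intro!: conj_weft_le_conj_of)
    qed
  qed (use Suc.prems in auto)
qed simp

text \<open>The negation of a member is a disjunction down to the literals and the large
  conjunctions. A negated large conjunction is replaced by its negated members, whose weft is
  smaller by one: one alternation of quantifiers per unit of weft. For \<open>w = 0\<close> there is
  no large conjunction and the bound stays 0.\<close>

lemma dnf_flip_conj_weft_le:
  "conj_weft_le h w t \<Longrightarrow> i \<in> set (dnf h (flip t)) \<Longrightarrow> conj_weft_le h (w - 1) i"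
proof (induction h arbitrary: w t i)
  case (Suc h)
  show ?case
  proof (cases "atomic t")
    case True
    then show ?thesis using Suc.prems by simp
  next
    case False
    then obtain c where c: "c \<in> set (elems (body t))" "i \<in> set (dnf h (flip c))"
      using Suc.prems by auto
    show ?thesis
    proof (cases "binary (body t)")
      case True
      then have "conj_weft_le h w c" using Suc.prems(1) False c(1) by auto
      then show ?thesis using Suc.IH[OF _ c(2)] conj_weft_le_mono by blast
    next
      case nb: False
      then have "weft_le h (w - 1) (flip c)" using Suc.prems(1) False c(1) by auto
      then show ?thesis using dnf_conj_weft_le[OF _ c(2)] conj_weft_le_mono by blast
    qed
  qed
qed simp

text \<open>A formula of weft 3 has the shape \<open>\<exists>\<forall>\<exists>\<forall>\<close>, where the last matrix consists of
  negated conjunctions of a bounded number of literals.\<close>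

lemma formula_value_weft3:
  assumes "weft_le h 3 t"
  shows "formula_value T t \<longleftrightarrow> (\<exists>u \<in> set (dnf h t). \<forall>i \<in> set (dnf h (flip u)).
    \<exists>j \<in> set (dnf h (flip i)). \<forall>l \<in> set (dnf h (flip j)). \<not> formula_value T l)"
proof -
  have neg: "formula_value T u \<longleftrightarrow> (\<forall>i \<in> set (dnf h (flip u)). \<not> formula_value T i)"
    if "height_le h u" for u
    using formula_value_dnf[of h "flip u" T] that by auto
  have neg': "\<not> formula_value T u \<longleftrightarrow> (\<exists>i \<in> set (dnf h (flip u)). formula_value T i)"
    if "height_le h u" for u
    using formula_value_dnf[of h "flip u" T] that by auto
  have hu: "conj_weft_le h 3 u" if "u \<in> set (dnf h t)" for u
    using dnf_conj_weft_le[OF assms that] .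
  have step: "conj_weft_le h w i \<Longrightarrow> j \<in> set (dnf h (flip i)) \<Longrightarrow> conj_weft_le h (w - 1) j" for w i j
    by (rule dnf_flip_conj_weft_le)
  have "formula_value T t \<longleftrightarrow> (\<exists>u \<in> set (dnf h t). formula_value T u)"
    by (rule formula_value_dnf[OF weft_le_height_le[OF assms]])
  also have "\<dots> \<longleftrightarrow> (\<exists>u \<in> set (dnf h t). \<forall>i \<in> set (dnf h (flip u)). \<not> formula_value T i)"
    using neg[OF conj_weft_le_height_le[OF hu]] by (intro bex_cong refl) auto
  also have "\<dots> \<longleftrightarrow> (\<exists>u \<in> set (dnf h t). \<forall>i \<in> set (dnf h (flip u)).
      \<exists>j \<in> set (dnf h (flip i)). formula_value T j)"
    using neg'[OF conj_weft_le_height_le[OF step[OF hu]]] by (intro bex_cong ball_cong refl) auto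
  also have "\<dots> \<longleftrightarrow> (\<exists>u \<in> set (dnf h t). \<forall>i \<in> set (dnf h (flip u)).
      \<exists>j \<in> set (dnf h (flip i)). \<forall>l \<in> set (dnf h (flip j)). \<not> formula_value T l)"
    using neg[OF conj_weft_le_height_le[OF step[OF step[OF hu]]]]
    by (intro bex_cong ball_cong refl) auto
  finally show ?thesis .
qed

text \<open>The weft bounds for \<open>u\<close>, \<open>i\<close>, \<open>j\<close>,
  \<open>l\<close> are 3, 2, 1, 0. At weft 0 only nested small conjunctions of literals are
  left.\<close>

lemma weft3_literals:
  assumes "weft_le h 3 t" "u \<in> set (dnf h t)" "i \<in> set (dnf h (flip u))" "j \<in> set (dnf h (flip i))"
    "l \<in> set (dnf h (flip j))"
  shows "conj_weft_le h 0 l"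
  using dnf_flip_conj_weft_le[OF dnf_flip_conj_weft_le[OF dnf_flip_conj_weft_le[OF
        dnf_conj_weft_le[OF assms(1,2)] assms(3)] assms(4)] assms(5)] by simp

subsection \<open>Certificates for conjunctions of literals\<close>

text \<open>A gap \<open>(a, b)\<close> between consecutive elements of a set \<open>T\<close> certifies that \<open>a - 1 \<in> T\<close>, unless
  \<open>a = 0\<close>, and that no \<open>y\<close> with \<open>a < y + 1 < b\<close> is in \<open>T\<close>; the value \<open>b = 0\<close> stands for infinity.
  Gaps occur as trees \<open>Br s (Br a b)\<close>, where \<open>s\<close> numbers the gap.\<close>

abbreviation gap_start :: "tree \<Rightarrow> nat" where "gap_start e \<equiv> num (left (right e))"
abbreviation gap_end :: "tree \<Rightarrow> nat" where "gap_end e \<equiv> num (right (right e))"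

definition in_gap :: "nat \<Rightarrow> tree \<Rightarrow> bool" where
  "in_gap y e \<longleftrightarrow> gap_start e < Suc y \<and> (gap_end e = 0 \<or> Suc y < gap_end e)"

definition literal_certified :: "tree \<Rightarrow> tree \<Rightarrow> bool" where
  "literal_certified x l \<longleftrightarrow>
     (if left l = Lf then \<exists>e \<in> set (elems x). gap_start e = Suc (num (body l))
      else \<exists>e \<in> set (elems x). in_gap (num (body l)) e)"

primrec certified :: "nat \<Rightarrow> tree \<Rightarrow> tree \<Rightarrow> bool" where
  "certified 0 x l \<longleftrightarrow> literal_certified x l"
| "certified (Suc h) x l \<longleftrightarrow> (if atomic l then literal_certified x l
     else \<forall>c \<in> set (elems (body l)). certified h x c)"

lemma certified_sound:
  assumes gaps: "\<And>e. e \<in> set (elems x) \<Longrightarrow>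
      (gap_start e = 0 \<or> gap_start e - 1 \<in> T) \<and> (\<forall>y. in_gap y e \<longrightarrow> y \<notin> T)"
    and "conj_weft_le h 0 l" "certified h x l"
  shows "formula_value T l"
proof -
  have lit: "formula_value T l" if "atomic l" "literal_certified x l" for l
    using that gaps by (subst formula_value.simps) (fastforce simp: literal_certified_def split: if_splits)
  show ?thesis
    using assms(2,3)
  proof (induction h arbitrary: l)
    case (Suc h)
    show ?case
    proof (cases "atomic l")
      case False
      then have "left l = Lf" "\<forall>c \<in> set (elems (body l)). conj_weft_le h 0 c \<and> certified h x c"
        using Suc.prems by (auto split: if_splits)
      then show ?thesis using Suc.IH False by (subst formula_value.simps) auto
    qed (use lit Suc.prems in auto)
  qed (use lit in auto)
qed

lemma certified_mono:
  assumes "set (elems x) \<subseteq> set (elems x')" shows "certified h x l \<Longrightarrow> certified h x' l"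
proof (induction h arbitrary: l)
  case 0 then show ?case using assms by (auto simp: literal_certified_def split: if_splits)
next
  case (Suc h)
  have "literal_certified x l \<Longrightarrow> literal_certified x' l"
    using assms by (auto simp: literal_certified_def split: if_splits)
  then show ?case using Suc by (auto split: if_splits)
qed

text \<open>Certificates of two conjuncts are concatenated, which doubles the length with each
  level; a literal met before the bottom repeats its gap. The length is thus exactly
  \<open>2 ^ h\<close>, the length of the tuples for which there are slots.\<close>

lemma certified_complete:
  assumes gaps: "\<And>y. \<exists>e \<in> G. if y \<in> T then gap_start e = Suc y else in_gap y e"
    and "conj_weft_le h 0 l" "formula_value T l"
  shows "\<exists>xs. length xs = 2 ^ h \<and> set xs \<subseteq> G \<and> certified h (of_list xs) l"
  using assms(2,3)
proof (induction h arbitrary: l)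
  case 0
  obtain e where e: "e \<in> G" "if num (body l) \<in> T then gap_start e = Suc (num (body l)) else in_gap (num (body l)) e"
    using gaps by blast
  have "certified 0 (of_list [e]) l"
    using 0 e(2) formula_value.simps[of T l] by (auto simp: literal_certified_def)
  then show ?case using e(1) by (intro exI[of _ "[e]"]) simp
next
  case (Suc h)
  show ?case
  proof (cases "atomic l")
    case True
    obtain e where e: "e \<in> G" "if num (body l) \<in> T then gap_start e = Suc (num (body l)) else in_gap (num (body l)) e"
      using gaps by blast
    have "certified (Suc h) (of_list (replicate (2 ^ Suc h) e)) l"
      using True Suc.prems(2) e(2) formula_value.simps[of T l] by (auto simp: literal_certified_def)
    then show ?thesis using e(1) by (intro exI[of _ "replicate (2 ^ Suc h) e"]) auto
  next
    case False
    have l: "left l = Lf" "binary (body l)" "body l \<noteq> Lf" "\<forall>c \<in> set (elems (body l)). conj_weft_le h 0 c"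
      using Suc.prems(1) False by (auto split: if_splits)
    have "\<forall>c \<in> set (elems (body l)). formula_value T c"
      using Suc.prems(2) False l(1) by (subst (asm) formula_value.simps) auto
    then have IH: "\<exists>xs. length xs = 2 ^ h \<and> set xs \<subseteq> G \<and> certified h (of_list xs) c"
      if "c \<in> set (elems (body l))" for c
      using that l(4) Suc.IH by blast
    have main: ?thesis if ab: "elems (body l) = [a] \<or> elems (body l) = [a, b]"
        "a \<in> set (elems (body l))" "b \<in> set (elems (body l))" for a b
    proof -
      obtain xs ys where xy: "length xs = 2 ^ h" "set xs \<subseteq> G" "certified h (of_list xs) a"
        "length ys = 2 ^ h" "set ys \<subseteq> G" "certified h (of_list ys) b"
        using IH[OF ab(2)] IH[OF ab(3)] by blast
      have "certified h (of_list (xs @ ys)) a" "certified h (of_list (xs @ ys)) b"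
        using certified_mono[OF _ xy(3)] certified_mono[OF _ xy(6)] by auto
      then show ?thesis using xy False ab(1) by (intro exI[of _ "xs @ ys"]) auto
    qed
    show ?thesis using l(2,3)
    proof (cases rule: binary_cases)
      case (1 a) then show ?thesis by (intro main[of a a]) auto
    next
      case (2 a b) then show ?thesis by (intro main[of a b]) auto
    qed
  qed
qed

section \<open>Unfolding circuits into formulas\<close>

text \<open>Node \<open>i\<close> is the gate at position \<open>i - n\<close>, the head of the
  suffix of length \<open>n + length gs - i\<close>; the test states this without
  subtraction.\<close>

definition lookup :: "nat \<Rightarrow> tree list \<Rightarrow> nat \<Rightarrow> tree" where
  "lookup n gs i = left (of_list (concat (map (\<lambda>s.
     if n + length gs = i + length s then [left (of_list s)] else []) (tails gs))))"

lemma lookup_nth: "j < length gs \<Longrightarrow> lookup n gs (n + j) = gs ! j"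
proof (induction gs arbitrary: n j)
  case (Cons g gs)
  have "lookup n (g # gs) i = (if i = n then g else lookup (Suc n) gs i)" for i
    by (simp add: lookup_def)
  then show ?case using Cons.IH[of "j - 1" "Suc n"] Cons.prems by (cases j) auto
qed simp

abbreviation gate_node :: "tree \<Rightarrow> tree \<Rightarrow> tree" where
  "gate_node c i \<equiv> lookup (num (left c)) (elems (right c)) (num i)"

text \<open>Sharing is lost, but to a constant depth \<open>d\<close> the formula stays polynomial
  in the circuit. The value \<open>var i\<close> at exhausted fuel is correct for input nodes, the
  only nodes of depth 0.\<close>

primrec unfolding_of :: "nat \<Rightarrow> tree \<Rightarrow> tree \<Rightarrow> tree" where
  "unfolding_of 0 c i = var i"
| "unfolding_of (Suc d) c i =
     (if num i < num (left c) then var i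
      else if left (gate_node c i) = Lf then flip (unfolding_of d c (right (gate_node c i)))
      else if left (gate_node c i) = Br Lf Lf then
        conj_of (map (\<lambda>p. unfolding_of d c p) (elems (right (gate_node c i))))
      else flip (conj_of (map (\<lambda>p. flip (unfolding_of d c p)) (elems (right (gate_node c i))))))"

text \<open>Depth and weft are tested together by recursion on the constant \<open>d\<close>, so
  that the reduction can reject circuits outside the class. A negation uses up depth but no
  weft.\<close>

primrec depth_weft_le :: "nat \<Rightarrow> nat \<Rightarrow> tree \<Rightarrow> tree \<Rightarrow> bool" where
  "depth_weft_le 0 w c i \<longleftrightarrow> num i < num (left c)"
| "depth_weft_le (Suc d) w c i \<longleftrightarrow> num i < num (left c) \<or>
     (if left (gate_node c i) = Lf then depth_weft_le d w c (right (gate_node c i))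
      else if binary (right (gate_node c i)) then
        \<forall>p \<in> set (elems (right (gate_node c i))). depth_weft_le d w c p
      else 0 < w \<and> (\<forall>p \<in> set (elems (right (gate_node c i))). depth_weft_le d (w - 1) c p))"

abbreviation is_nat :: "tree \<Rightarrow> bool" where
  "is_nat t \<equiv> \<forall>e \<in> set (elems t). e = Lf"

definition is_gate :: "tree \<Rightarrow> bool" where
  "is_gate g \<longleftrightarrow> g \<noteq> Lf \<and> (left g = Lf \<and> is_nat (right g) \<or>
     (left g = Br Lf Lf \<or> left g = Br Lf (Br Lf Lf)) \<and> (\<forall>p \<in> set (elems (right g)). is_nat p))"

text \<open>A reduction has to treat arbitrary trees, so valid encodings must be recognised. The
  gate heading the suffix \<open>s\<close> has number inputs plus gates minus
  \<open>length s\<close>; a predecessor must have a smaller number, again written without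
  subtraction.\<close>

definition is_circuit :: "tree \<Rightarrow> bool" where
  "is_circuit c \<longleftrightarrow> is_nat (left c) \<and> right c \<noteq> Lf \<and> (\<forall>g \<in> set (elems (right c)). is_gate g) \<and>
     (\<forall>s \<in> set (tails (elems (right c))).
        if left (left (of_list s)) = Lf
        then num (right (left (of_list s))) + length s < num (left c) + num (right c)
        else right (left (of_list s)) \<noteq> Lf \<and>
          (\<forall>p \<in> set (elems (right (left (of_list s)))). num p + length s < num (left c) + num (right c)))"

lemma is_nat_iff: "is_nat t \<longleftrightarrow> (\<exists>n. t = enc_nat n)"
proof
  assume *: "is_nat t"
  then have "elems t = replicate (num t) Lf" by (simp add: list_eq_iff_nth_eq)
  then have "t = of_list (replicate (num t) Lf)" by (metis of_list_elems)
  then show "\<exists>n. t = enc_nat n" by (metis enc_nat_replicate)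
next
  assume "\<exists>n. t = enc_nat n"
  then show "is_nat t" by (auto simp: enc_nat_replicate)
qed

lemma all_is_nat_iff: "(\<forall>p \<in> set (elems t). is_nat p) \<longleftrightarrow> (\<exists>ns. t = of_list (map enc_nat ns))"
proof
  assume "\<forall>p \<in> set (elems t). is_nat p"
  then have "elems t = map enc_nat (map num (elems t))"
    by (auto simp: is_nat_iff list_eq_iff_nth_eq) (metis length_elems_enc_nat nth_mem)
  then show "\<exists>ns. t = of_list (map enc_nat ns)" by (metis of_list_elems)
next
  assume "\<exists>ns. t = of_list (map enc_nat ns)"
  then show "\<forall>p \<in> set (elems t). is_nat p" by (auto simp: enc_nat_replicate)
qed

lemma enc_gate_simps [simp]:
  "enc_gate (Neg i) = Br Lf (enc_nat i)"
  "enc_gate (Conj is) = Br (Br Lf Lf) (of_list (map enc_nat is))"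
  "enc_gate (Disj is) = Br (Br Lf (Br Lf Lf)) (of_list (map enc_nat is))"
  by (simp_all add: enc_list_map[of enc_nat] numeral_2_eq_2)

declare enc_gate.simps [simp del]

lemma is_gate_iff: "is_gate g \<longleftrightarrow> (\<exists>g'. g = enc_gate g')"
proof
  assume *: "is_gate g"
  then obtain a b where g: "g = Br a b" by (cases g) (auto simp: is_gate_def)
  consider "a = Lf" "is_nat b" | "a = Br Lf Lf" "\<forall>p \<in> set (elems b). is_nat p"
    | "a = Br Lf (Br Lf Lf)" "\<forall>p \<in> set (elems b). is_nat p"
    using * g unfolding is_gate_def by auto
  then show "\<exists>g'. g = enc_gate g'"
    by cases (metis g is_nat_iff all_is_nat_iff enc_gate_simps)+
next
  assume "\<exists>g'. g = enc_gate g'"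
  then obtain g' where "g = enc_gate g'" by blast
  then show "is_gate g" by (cases g') (auto simp: is_gate_def enc_nat_replicate)
qed

lemma enc_circuit_Pair: "enc_circuit (n, gs) = Br (enc_nat n) (of_list (map enc_gate gs))"
  by (simp add: enc_circuit_def enc_list_map[of enc_gate])

lemma tails_conv_drop: "set (tails xs) = (\<lambda>j. drop j xs) ` {..<length xs}"
proof (induction xs)
  case (Cons x xs)
  have "{..<length (x # xs)} = insert 0 (Suc ` {..<length xs})" by (auto simp: image_iff less_Suc_eq_0_disj)
  then show ?case using Cons by (simp add: image_image)
qed simp

lemma is_circuit_enc: "is_circuit (enc_circuit (n, gs)) \<longleftrightarrow> wf_circuit (n, gs)"
proof -
  have gate: "(if left (enc_gate g) = Lf then num (right (enc_gate g)) + k < m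
      else right (enc_gate g) \<noteq> Lf \<and> (\<forall>p \<in> set (elems (right (enc_gate g))). num p + k < m)) \<longleftrightarrow>
    preds g \<noteq> [] \<and> (\<forall>i \<in> set (preds g). i + k < m)" for g k m
    by (cases g) auto
  have hd: "left (of_list (drop j (map enc_gate gs))) = enc_gate (gs ! j)" if "j < length gs" for j
    using that by (simp add: drop_map flip: Cons_nth_drop_Suc)
  let ?c = "enc_circuit (n, gs)"
  have "is_nat (left ?c)" by (auto simp: enc_circuit_Pair enc_nat_replicate)
  moreover have "\<forall>g \<in> set (elems (right ?c)). is_gate g"
    unfolding is_gate_iff by (auto simp: enc_circuit_Pair)
  moreover have "(\<forall>s \<in> set (tails (elems (right ?c))).
        if left (left (of_list s)) = Lf
        then num (right (left (of_list s))) + length s < num (left ?c) + num (right ?c)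
        else right (left (of_list s)) \<noteq> Lf \<and>
          (\<forall>p \<in> set (elems (right (left (of_list s)))). num p + length s < num (left ?c) + num (right ?c)))
    \<longleftrightarrow> (\<forall>j \<in> {..<length gs}. preds (gs ! j) \<noteq> [] \<and>
        (\<forall>i \<in> set (preds (gs ! j)). i + (length gs - j) < n + length gs))"
    unfolding enc_circuit_Pair left.simps right.simps elems_of_list length_elems_enc_nat length_map
      tails_conv_drop ball_simps
  proof (rule ball_cong[OF refl], goal_cases)
    case (1 j)
    then have "j < length gs" by simp
    from hd[OF this] show ?case
      by (simp only: gate length_drop length_map)
  qed
  ultimately have "is_circuit ?c \<longleftrightarrow> gs \<noteq> [] \<and>
      (\<forall>j \<in> {..<length gs}. preds (gs ! j) \<noteq> [] \<and>
        (\<forall>i \<in> set (preds (gs ! j)). i + (length gs - j) < n + length gs))"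
    unfolding is_circuit_def by (simp only: simp_thms) (simp add: enc_circuit_Pair)
  also have "\<dots> \<longleftrightarrow> wf_circuit (n, gs)"
    by (auto simp: less_diff_conv2)
  finally show ?thesis .
qed

lemma is_circuit_iff: "is_circuit c \<longleftrightarrow> (\<exists>C. c = enc_circuit C \<and> wf_circuit C)"
proof
  assume *: "is_circuit c"
  then obtain a b where c: "c = Br a b" by (cases c) (auto simp: is_circuit_def)
  obtain n where n: "a = enc_nat n" using * c by (auto simp: is_circuit_def is_nat_iff)
  have "\<forall>g \<in> set (elems b). \<exists>g'. g = enc_gate g'" using * c by (auto simp: is_circuit_def is_gate_iff)
  then obtain gs where "elems b = map enc_gate gs"
    by (metis (mono_tags, lifting) ex_map_conv)
  then have "c = enc_circuit (n, gs)" using c n by (metis enc_circuit_Pair of_list_elems)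
  then show "\<exists>C. c = enc_circuit C \<and> wf_circuit C" using * is_circuit_enc by blast
next
  assume "\<exists>C. c = enc_circuit C \<and> wf_circuit C"
  then show "is_circuit c" using is_circuit_enc by auto
qed

text \<open>\<open>right (right c)\<close> is the gate list without its first entry, so the sum is
  the number of the last node.\<close>

definition output_node :: "tree \<Rightarrow> tree" where
  "output_node c = enc_nat (num (left c) + num (right (right c)))"

context
  fixes n :: nat and gs :: "gate list"
  assumes wf: "wf_circuit (n, gs)"
begin

lemma node_value_gate:
  assumes "j < length gs" "length init = n"
  shows "node_values F init gs ! (n + j) = F (gs ! j) (map (\<lambda>i. node_values F init gs ! i) (preds (gs ! j)))"
  using node_values_nth_gate[OF assms(1), of init F] wf assms(2) by simp

lemma node_cases:
  assumes "i < n + length gs"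
  obtains "i < n" | j where "j < length gs" "i = n + j" "preds (gs ! j) \<noteq> []"
    "\<And>p. p \<in> set (preds (gs ! j)) \<Longrightarrow> p < n + length gs"
proof (cases "i < n")
  case False
  then have j: "i - n < length gs" "i = n + (i - n)" using assms by auto
  have "p < n + length gs" if "p \<in> set (preds (gs ! (i - n)))" for p
    using wf that j(1) by (fastforce simp: less_trans)
  then show ?thesis using that(2)[OF j] wf j(1) by auto
qed (use that in auto)

lemma gate_node_enc: "j < length gs \<Longrightarrow> gate_node (enc_circuit (n, gs)) (enc_nat (n + j)) = enc_gate (gs ! j)"
  by (simp add: enc_circuit_Pair lookup_nth)

abbreviation (input) "depths \<equiv> node_values (\<lambda>g ds. Suc (Max (set ds))) (replicate n 0) gs"
abbreviation (input) "wefts \<equiv> node_values (\<lambda>g ws. (if large g then 1 else 0) + Max (set ws)) (replicate n (0::nat)) gs"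

lemma binary_of_list: "binary (of_list xs) \<longleftrightarrow> length xs \<le> 2"
  by (cases xs rule: tails.cases; cases "tl xs") auto

lemma depth_weft_le_iff:
  "i < n + length gs \<Longrightarrow>
    depth_weft_le d w (enc_circuit (n, gs)) (enc_nat i) \<longleftrightarrow> depths ! i \<le> d \<and> wefts ! i \<le> w"
proof (induction d arbitrary: w i)
  case 0
  from 0 show ?case
  proof (cases rule: node_cases)
    case 1
    then show ?thesis by (simp add: node_values_nth_init enc_circuit_Pair)
  next
    case (2 j)
    then show ?thesis by (simp add: node_value_gate enc_circuit_Pair)
  qed
next
  case (Suc d)
  from Suc.prems show ?case
  proof (cases rule: node_cases)
    case 1
    then show ?thesis by (simp add: node_values_nth_init enc_circuit_Pair)
  next
    case (2 j)
    let ?P = "preds (gs ! j)"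
    have max: "Max (set (map f ?P)) \<le> m \<longleftrightarrow> (\<forall>p \<in> set ?P. f p \<le> m)" for f :: "nat \<Rightarrow> nat" and m
      using 2(3) by simp
    have dep: "depths ! i \<le> Suc d \<longleftrightarrow> (\<forall>p \<in> set ?P. depths ! p \<le> d)"
      using 2(1,2) max by (simp add: node_value_gate)
    have wft: "wefts ! i \<le> w \<longleftrightarrow> (if large (gs ! j) then 0 < w \<and> (\<forall>p \<in> set ?P. wefts ! p \<le> w - 1)
        else \<forall>p \<in> set ?P. wefts ! p \<le> w)"
    proof -
      have "wefts ! i = (if large (gs ! j) then 1 else 0) + Max (set (map (\<lambda>p. wefts ! p) ?P))"
        using 2(1,2) by (simp add: node_value_gate)
      moreover have "Suc m \<le> w \<longleftrightarrow> 0 < w \<and> m \<le> w - 1" for m by auto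
      ultimately show ?thesis using max by auto
    qed
    have "\<not> num (enc_nat i) < num (left (enc_circuit (n, gs)))" using 2(2) by (simp add: enc_circuit_Pair)
    then have "depth_weft_le (Suc d) w (enc_circuit (n, gs)) (enc_nat i) \<longleftrightarrow>
      (if large (gs ! j) then 0 < w \<and> (\<forall>p \<in> set ?P. depth_weft_le d (w - 1) (enc_circuit (n, gs)) (enc_nat p))
       else \<forall>p \<in> set ?P. depth_weft_le d w (enc_circuit (n, gs)) (enc_nat p))"
      unfolding depth_weft_le.simps using 2(1) unfolding 2(2) gate_node_enc[OF 2(1)]
      by (cases "gs ! j") (auto simp: large_def binary_of_list)
    then show ?thesis using Suc.IH 2(4) dep wft by (cases "large (gs ! j)") auto
  qed
qed

lemma formula_value_unfolding:
  assumes a: "length a = n" and T: "T = {i. i < n \<and> a ! i}"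
  shows "i < n + length gs \<Longrightarrow> depths ! i \<le> d \<Longrightarrow>
    formula_value T (unfolding_of d (enc_circuit (n, gs)) (enc_nat i)) \<longleftrightarrow> node_values gate_value a gs ! i"
proof (induction d arbitrary: i)
  case 0
  from 0(1) show ?case
  proof (cases rule: node_cases)
    case 1
    then show ?thesis using a T by (simp add: node_values_nth_init)
  next
    case (2 j)
    \<comment> \<open>A gate has depth at least 1, against the depth bound 0.\<close>
    then show ?thesis using 0(2) by (simp add: node_value_gate)
  qed
next
  case (Suc d)
  from Suc.prems(1) show ?case
  proof (cases rule: node_cases)
    case 1
    then show ?thesis using a T by (simp add: node_values_nth_init enc_circuit_Pair)
  next
    case (2 j)
    let ?P = "preds (gs ! j)"
    have dep: "depths ! p \<le> d" if "p \<in> set ?P" for p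
    proof -
      have "Max (set (map (\<lambda>p. depths ! p) ?P)) \<le> d"
        using Suc.prems(2) 2(1,2) by (simp add: node_value_gate)
      then show ?thesis using 2(3) that by (simp del: set_map) (simp add: that)
    qed
    have IH: "formula_value T (unfolding_of d (enc_circuit (n, gs)) (enc_nat p)) \<longleftrightarrow> node_values gate_value a gs ! p"
      if "p \<in> set ?P" for p
      using Suc.IH dep 2(4) that by blast
    have "\<not> num (enc_nat i) < num (left (enc_circuit (n, gs)))" using 2(2) by (simp add: enc_circuit_Pair)
    then show ?thesis
      unfolding unfolding_of.simps 2(2) gate_node_enc[OF 2(1)] node_value_gate[OF 2(1) a]
      using IH by (cases "gs ! j") auto
  qed
qed

lemma weft_le_unfolding:
  "i < n + length gs \<Longrightarrow> depth_weft_le d w (enc_circuit (n, gs)) (enc_nat i) \<Longrightarrow>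
    weft_le d w (unfolding_of d (enc_circuit (n, gs)) (enc_nat i))"
proof (induction d arbitrary: w i)
  case 0
  then show ?case by (simp add: var_def)
next
  case (Suc d)
  from Suc.prems(1) show ?case
  proof (cases rule: node_cases)
    case 1
    then show ?thesis by (simp add: var_def enc_circuit_Pair)
  next
    case (2 j)
    have n: "\<not> num (enc_nat i) < num (left (enc_circuit (n, gs)))" using 2(2) by (simp add: enc_circuit_Pair)
    have list: "weft_le (Suc d) w (conj_of (map f ps))"
      if "ps \<noteq> []" "if length ps \<le> 2 then \<forall>p \<in> set ps. weft_le d w (f p)
        else 0 < w \<and> (\<forall>p \<in> set ps. weft_le d (w - 1) (f p))" for f :: "nat \<Rightarrow> tree" and ps
      using that by (simp add: conj_of_def binary_of_list split: if_splits)
    note IH = Suc.IH[OF 2(4)]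
    show ?thesis
    proof (cases "gs ! j")
      case (Neg p)
      then have "weft_le d w (unfolding_of d (enc_circuit (n, gs)) (enc_nat p))"
        using Suc.prems(2) n unfolding depth_weft_le.simps 2(2) gate_node_enc[OF 2(1)]
        by (intro IH) auto
      \<comment> \<open>A negation gate adds no level to the formula, so the height bound
        \<open>d\<close> is merely relaxed to \<open>Suc d\<close>.\<close>
      then show ?thesis
        using n Neg weft_le_mono unfolding unfolding_of.simps 2(2) gate_node_enc[OF 2(1)] by simp
    next
      case (Conj ps)
      then show ?thesis
        using Suc.prems(2) n 2(3) IH unfolding depth_weft_le.simps unfolding_of.simps 2(2) gate_node_enc[OF 2(1)]
        by (auto simp: binary_of_list o_def simp del: weft_le.simps intro!: list split: if_splits)
    next
      case (Disj ps)
      then show ?thesis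
        using Suc.prems(2) n 2(3) IH unfolding depth_weft_le.simps unfolding_of.simps 2(2) gate_node_enc[OF 2(1)]
        by (auto simp: binary_of_list o_def simp del: weft_le.simps intro!: list split: if_splits)
    qed
  qed
qed

lemma output_node_enc: "output_node (enc_circuit (n, gs)) = enc_nat (n + length gs - 1)"
  using wf by (cases gs) (auto simp: output_node_def enc_circuit_Pair)

lemma depth_weft_le_output:
  "depth_weft_le d w (enc_circuit (n, gs)) (output_node (enc_circuit (n, gs))) \<longleftrightarrow>
    depth (n, gs) \<le> d \<and> weft (n, gs) \<le> w"
proof -
  have "gs \<noteq> []" using wf by simp
  then show ?thesis
    by (simp add: output_node_enc depth_weft_le_iff last_node_values)
qed

lemma weighted_sat_iff:
  assumes "depth (n, gs) \<le> d"
  shows "weighted_sat (n, gs) k \<longleftrightarrow> (\<exists>T. T \<subseteq> {..<n} \<and> card T = k \<and>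
    formula_value T (unfolding_of d (enc_circuit (n, gs)) (output_node (enc_circuit (n, gs)))))"
proof -
  have gs: "gs \<noteq> []" using wf by simp
  then have out: "n + length gs - 1 < n + length gs" by (cases gs) auto
  have dep: "depths ! (n + length gs - 1) \<le> d" using assms gs by (simp add: last_node_values)
  have val: "circuit_value (n, gs) a \<longleftrightarrow> formula_value {i. i < n \<and> a ! i}
      (unfolding_of d (enc_circuit (n, gs)) (output_node (enc_circuit (n, gs))))" if "length a = n" for a
    using formula_value_unfolding[OF that refl out dep] gs that
    by (simp add: output_node_enc last_node_values)
  show ?thesis
  proof
    assume "weighted_sat (n, gs) k"
    then obtain a where a: "length a = n" "card {i. i < n \<and> a ! i} = k" "circuit_value (n, gs) a"
      unfolding weighted_sat_def fst_conv by blast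
    show "\<exists>T. T \<subseteq> {..<n} \<and> card T = k \<and>
      formula_value T (unfolding_of d (enc_circuit (n, gs)) (output_node (enc_circuit (n, gs))))"
      using a(2,3) val[OF a(1)] by (intro exI[of _ "{i. i < n \<and> a ! i}"]) (simp del: circuit_value.simps add: subset_iff)
  next
    assume "\<exists>T. T \<subseteq> {..<n} \<and> card T = k \<and>
      formula_value T (unfolding_of d (enc_circuit (n, gs)) (output_node (enc_circuit (n, gs))))"
    then obtain T where T: "T \<subseteq> {..<n}" "card T = k"
      "formula_value T (unfolding_of d (enc_circuit (n, gs)) (output_node (enc_circuit (n, gs))))" by blast
    let ?a = "map (\<lambda>i. i \<in> T) [0..<n]"
    have a: "length ?a = n" "{i. i < n \<and> ?a ! i} = T" using T(1) by auto
    then have "circuit_value (n, gs) ?a" using T(3) val[OF a(1)] by (simp del: circuit_value.simps)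
    then show "weighted_sat (n, gs) k"
      using a T(2) unfolding weighted_sat_def fst_conv by (intro exI[of _ ?a]) (simp del: circuit_value.simps)
  qed
qed

end

subsection \<open>Running times\<close>

lemma polyn_num: "polyf f \<Longrightarrow> polyn (\<lambda>x. num (f x))"
  by (intro polyn_length polyl_elems)

lemma polyf_var: "polyf f \<Longrightarrow> polyf (\<lambda>x. var (f x))"
  unfolding var_def by (intro polyf_Br polyf_const)

lemma polyf_conj_of: "polyl f \<Longrightarrow> polyf (\<lambda>x. conj_of (f x))"
  unfolding conj_of_def by (intro polyf_Br polyf_const polyf_of_list)

lemma polyf_flip: "polyf f \<Longrightarrow> polyf (\<lambda>x. flip (f x))"
  unfolding flip_def by (intro polyf_Br polyf_const polyf_if polyp_eq polyf_left polyf_right)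

text \<open>Here and below, \<open>d\<close> is a constant of the program: the recursion is unrolled
  into nested list operations, and the degree of the polynomial may depend on
  \<open>d\<close>.\<close>

lemma polyl_dnf: "polyf f \<Longrightarrow> polyl (\<lambda>x. dnf d (f x))"
proof (induction d arbitrary: f)
  case 0
  then show ?case by (simp add: polyl_Cons polyl_Nil)
next
  case (Suc d)
  show ?case
    unfolding dnf.simps
    by (intro polyl_if polyp_eq polyp_not polyl_Cons polyl_Nil polyl_concat_map polyl_map polyl_elems
        polyf_conj_of polyf_flip polyf_left polyf_right polyf_if polyf_const polyf_id Suc.IH
        Suc.prems polyf_comp[OF Suc.prems])
qed

lemma polyp_in_gap: "polyn n \<Longrightarrow> polyf f \<Longrightarrow> polyp (\<lambda>x. in_gap (n x) (f x))"
  unfolding in_gap_def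
  by (intro polyp_conj polyp_disj polyp_less polyp_nat_eq polyn_Suc polyn_num polyn_const
      polyf_left polyf_right)

lemma polyp_literal_certified:
  assumes "polyf f" "polyf g" shows "polyp (\<lambda>x. literal_certified (f x) (g x))"
  unfolding literal_certified_def
  by (intro polyp_if polyp_eq polyp_bex polyp_in_gap polyp_nat_eq polyn_Suc polyn_num polyl_elems
      polyf_left polyf_right polyf_const polyf_id assms polyf_comp[OF assms(2)])

lemma polyp_certified: "polyf f \<Longrightarrow> polyf g \<Longrightarrow> polyp (\<lambda>x. certified d (f x) (g x))"
proof (induction d arbitrary: f g)
  case 0
  then show ?case by (simp add: polyp_literal_certified)
next
  case (Suc d)
  show ?case
    unfolding certified.simps
    by (intro polyp_if polyp_eq polyp_ball polyp_literal_certified polyl_elems polyf_left polyf_right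
        polyf_const polyf_id Suc.IH Suc.prems polyf_comp[OF Suc.prems(1)])
qed

lemma polyf_lookup:
  assumes "polyn n" "polyl gs" "polyn i" shows "polyf (\<lambda>x. lookup (n x) (gs x) (i x))"
proof -
  have env: "polyn (\<lambda>z. n (left z))" "polyl (\<lambda>z. gs (left z))" "polyn (\<lambda>z. i (left z))"
    using polyf_comp[OF assms(1)[unfolded polyn_def] polyf_left[OF polyf_id]]
      polyf_comp[OF assms(2)[unfolded polyl_def] polyf_left[OF polyf_id]]
      polyf_comp[OF assms(3)[unfolded polyn_def] polyf_left[OF polyf_id]]
    by (simp_all add: polyn_def polyl_def)
  show ?thesis
    unfolding lookup_def
    by (intro polyf_left polyf_of_list polyl_concat_tails polyl_if polyp_nat_eq polyn_add polyn_length
        polyl_Cons polyl_Nil polyl_elems polyf_right polyf_id assms env)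
qed

lemma polyf_unfolding_of: "polyf f \<Longrightarrow> polyf g \<Longrightarrow> polyf (\<lambda>x. unfolding_of d (f x) (g x))"
proof (induction d arbitrary: f g)
  case 0
  then show ?case by (simp add: polyf_var)
next
  case (Suc d)
  show ?case
    unfolding unfolding_of.simps
    by (intro polyf_if polyp_less polyp_eq polyn_num polyf_var polyf_flip polyf_conj_of polyl_map
        polyl_elems polyf_lookup polyf_left polyf_right polyf_const polyf_id Suc.IH Suc.prems
        polyf_comp[OF Suc.prems(1)])
qed

lemma polyp_depth_weft_le: "polyf f \<Longrightarrow> polyf g \<Longrightarrow> polyp (\<lambda>x. depth_weft_le d w (f x) (g x))"
proof (induction d arbitrary: f g w)
  case 0
  then show ?case by (simp add: polyp_less polyn_num polyf_left)
next
  case (Suc d)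
  show ?case
    unfolding depth_weft_le.simps
    by (intro polyp_if polyp_disj polyp_conj polyp_const polyp_less polyp_eq polyp_ball polyn_num
        polyl_elems polyf_lookup polyf_left polyf_right polyf_const polyf_id Suc.IH Suc.prems
        polyf_comp[OF Suc.prems(1)])
qed

lemma polyp_is_gate: "polyf f \<Longrightarrow> polyp (\<lambda>x. is_gate (f x))"
  unfolding is_gate_def
  by (intro polyp_conj polyp_disj polyp_not polyp_eq polyp_ball polyl_elems polyf_left polyf_right
      polyf_const polyf_id; assumption)

lemma polyp_is_circuit: assumes "polyf f" shows "polyp (\<lambda>x. is_circuit (f x))"
  unfolding is_circuit_def
  by (intro polyp_conj polyp_not polyp_if polyp_less polyp_eq polyp_ball polyp_ball_tails polyp_is_gate
      polyn_add polyn_num polyn_length polyl_elems polyf_of_list polyf_left polyf_right polyf_const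
      polyf_id assms polyf_comp[OF assms])

lemma polyf_output_node: "polyf f \<Longrightarrow> polyf (\<lambda>x. output_node (f x))"
  unfolding output_node_def by (intro polyf_enc_nat polyn_add polyn_num polyf_left polyf_right)

section \<open>The reduction\<close>

primrec tuples :: "nat \<Rightarrow> tree list \<Rightarrow> tree list" where
  "tuples 0 L = [Lf]"
| "tuples (Suc m) L = concat (map (\<lambda>e. map (\<lambda>t. Br e t) (tuples m L)) L)"

lemma set_tuples: "set (tuples m L) = {t. num t = m \<and> set (elems t) \<subseteq> set L}"
proof (induction m)
  case (Suc m)
  have "num t = Suc m \<longleftrightarrow> (\<exists>e t'. t = Br e t' \<and> num t' = m)" for t by (cases t) auto
  then show ?case using Suc by auto
qed auto

lemma card_tuples: "card (set (tuples m L)) = card (set L) ^ m"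
proof -
  have "set (tuples m L) = of_list ` {xs. set xs \<subseteq> set L \<and> length xs = m}"
    unfolding set_tuples by (auto simp: image_iff) (metis of_list_elems)
  moreover have "inj_on of_list {xs. set xs \<subseteq> set L \<and> length xs = m}" by (auto simp: inj_on_def)
  ultimately show ?thesis by (simp add: card_image card_lists_length_eq)
qed

text \<open>In an instance \<open>z = Br c k\<close>, the gap \<open>Br s (Br a b)\<close> is a possible value of the \<open>s\<close>-th
  gap of a set of \<open>k\<close> input nodes of \<open>c\<close>.\<close>

definition gaps :: "tree \<Rightarrow> tree list" where
  "gaps z = concat (map (\<lambda>s. concat (map (\<lambda>a. concat (map (\<lambda>b.
     if (a = Lf \<longleftrightarrow> s = Lf) \<and> (b = Lf \<longleftrightarrow> s = enc_nat (num (right z))) \<and> (b \<noteq> Lf \<longrightarrow> num a < num b)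
     then [Br s (Br a b)] else [])
     (nat_trees (Suc (num (left (left z))))))) (nat_trees (Suc (num (left (left z)))))))
     (nat_trees (Suc (num (right z)))))"

text \<open>Without conflicts, every gap number has a single value and gap \<open>s\<close> ends
  where gap \<open>s + 1\<close> starts (\<open>Br Lf\<close> is the unary successor), so the chosen
  gaps fit together into one increasing sequence.\<close>

definition conflict :: "tree \<Rightarrow> tree \<Rightarrow> bool" where
  "conflict e e' \<longleftrightarrow> left e = left e' \<and> right e \<noteq> right e' \<or>
     left e' = Br Lf (left e) \<and> right (right e) \<noteq> left (right e')"

text \<open>The tuple of gap numbers in front is the slot for which the tuple of gaps
  competes.\<close>

definition tuple_cands :: "nat \<Rightarrow> tree \<Rightarrow> tree list" where
  "tuple_cands d z = map (\<lambda>u. Br (of_list (map left (elems u))) u) (tuples (2 ^ d) (gaps z))"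

definition circuit_formula :: "nat \<Rightarrow> tree \<Rightarrow> tree" where
  "circuit_formula d z = unfolding_of d (left z) (output_node (left z))"

text \<open>\<open>Lf\<close> is the slot for the choice of \<open>u\<close>. It differs from the
  tuples, whose length \<open>2 ^ d\<close> is positive.\<close>

definition slots :: "nat \<Rightarrow> tree \<Rightarrow> tree list" where
  "slots d z = Lf # tuples (2 ^ d) (nat_trees (Suc (num (right z))))"

definition cands :: "nat \<Rightarrow> tree \<Rightarrow> tree list" where
  "cands d z = tuple_cands d z @ map (\<lambda>u. Br Lf u) (dnf d (circuit_formula d z))"

text \<open>A candidate made of true gaps proves some \<open>l\<close> true, while \<open>j\<close>
  requires every \<open>l\<close> to be false.\<close>

definition refutes :: "nat \<Rightarrow> tree \<Rightarrow> tree \<Rightarrow> bool" where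
  "refutes d j x \<longleftrightarrow> (\<exists>l \<in> set (dnf d (flip j)). certified d (right x) l)"

text \<open>The clause \<open>[[x], [y]]\<close> forbids the choice of both \<open>x\<close> and \<open>y\<close>.\<close>

definition consistency_clauses :: "nat \<Rightarrow> tree \<Rightarrow> tree list" where
  "consistency_clauses d z = concat (map (\<lambda>x. map (\<lambda>y. of_list [of_list [x], of_list [y]])
     (filter (\<lambda>y. \<exists>e \<in> set (elems (right x)). \<exists>e' \<in> set (elems (right y)). conflict e e')
       (tuple_cands d z))) (tuple_cands d z))"

text \<open>The first disjunct holds when \<open>u\<close> is not chosen. So the clause is an
  implication: if \<open>u\<close> is chosen, then for this \<open>i\<close> some \<open>j\<close>
  is refuted by no chosen candidate.\<close>

definition formula_clauses :: "nat \<Rightarrow> tree \<Rightarrow> tree list" where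
  "formula_clauses d z = concat (map (\<lambda>u. map (\<lambda>i.
     of_list (of_list [Br Lf u] #
       map (\<lambda>j. of_list (filter (\<lambda>x. refutes d j x) (tuple_cands d z))) (dnf d (flip i))))
     (dnf d (flip u))) (dnf d (circuit_formula d z)))"

text \<open>On inputs that do not encode a circuit of weft at most 3 and depth at most \<open>d\<close>, the empty clause makes
  the instance negative.\<close>

definition clauses :: "nat \<Rightarrow> tree \<Rightarrow> tree list" where
  "clauses d z =
     (if is_circuit (left z) \<and> depth_weft_le d 3 (left z) (output_node (left z))
      then consistency_clauses d z @ formula_clauses d z else [Lf])"

definition graph_verts :: "nat \<Rightarrow> tree \<Rightarrow> tree list" where
  "graph_verts d z = remdups (map (\<lambda>a. Br slot_tag a) (slots d z) @ map (\<lambda>x. Br cand_tag x) (cands d z) @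
     map (\<lambda>b. Br disj_tag b) (concat (map elems (clauses d z))) @ map (\<lambda>w. Br clause_tag w) (clauses d z))"

definition new_param :: "nat \<Rightarrow> nat \<Rightarrow> nat" where
  "new_param d k = 2 * Suc (Suc k ^ 2 ^ d)"

definition reduction :: "nat \<Rightarrow> tree \<Rightarrow> tree" where
  "reduction d z = Br (enc_berd (instance_of (graph_verts d z))) (enc_nat (new_param d (num (right z))))"

subsection \<open>Gaps\<close>

text \<open>For \<open>s > 0\<close>, \<open>st s\<close> is meant to be the successor of the
  \<open>s\<close>-th element of \<open>T\<close>; the shift frees \<open>st 0 = 0\<close> for the
  left end, and the last gap gets the end 0 that stands for infinity.\<close>

definition gap_tree :: "(nat \<Rightarrow> nat) \<Rightarrow> nat \<Rightarrow> nat \<Rightarrow> tree" where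
  "gap_tree st k s = Br (enc_nat s) (Br (enc_nat (st s)) (enc_nat (if s = k then 0 else st (Suc s))))"

context
  fixes st :: "nat \<Rightarrow> nat" and k :: nat and T :: "nat set"
  assumes st0: "st 0 = 0" and st_less: "\<And>s. s < k \<Longrightarrow> st s < st (Suc s)"
    and T: "T = {y. \<exists>s \<le> k. st s = Suc y}"
begin

lemma st_mono: "s < r \<Longrightarrow> r \<le> k \<Longrightarrow> st s < st r"
proof (induction r)
  case (Suc r)
  then show ?case using st_less[of r] by (cases "s = r") auto
qed simp

lemma gap_tree_sound:
  assumes "s \<le> k"
  shows "(gap_start (gap_tree st k s) = 0 \<or> gap_start (gap_tree st k s) - 1 \<in> T) \<and>
    (\<forall>y. in_gap y (gap_tree st k s) \<longrightarrow> y \<notin> T)"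
proof (intro conjI allI impI)
  show "gap_start (gap_tree st k s) = 0 \<or> gap_start (gap_tree st k s) - 1 \<in> T"
    using assms T by (cases "st s") (auto simp: gap_tree_def)
  fix y assume y: "in_gap y (gap_tree st k s)"
  show "y \<notin> T"
  proof
    assume "y \<in> T"
    then obtain r where r: "r \<le> k" "st r = Suc y" using T by auto
    have "s < r"
      using y r st_mono[of r s] assms by (cases "r = s"; cases "r < s") (auto simp: in_gap_def gap_tree_def)
    then have "s < k" "st (Suc s) \<noteq> 0" using r(1) st_less[of s] by auto
    then have "st r < st (Suc s)" using y r(2) by (auto simp: in_gap_def gap_tree_def)
    moreover have "st (Suc s) \<le> st r"
      using \<open>s < r\<close> r(1) st_mono[of "Suc s" r] by (cases "Suc s = r") auto
    ultimately show False by simp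
  qed
qed

lemma gap_tree_cover: "\<exists>s \<le> k. if y \<in> T then gap_start (gap_tree st k s) = Suc y else in_gap y (gap_tree st k s)"
proof (cases "y \<in> T")
  case True
  then show ?thesis using T by (auto simp: gap_tree_def)
next
  case False
  \<comment> \<open>The last gap starting before \<open>y\<close>; index 0 always qualifies because
    \<open>st 0 = 0\<close>.\<close>
  define s where "s = Max {s. s \<le> k \<and> st s < Suc y}"
  have fin: "finite {s. s \<le> k \<and> st s < Suc y}" by simp
  have "0 \<in> {s. s \<le> k \<and> st s < Suc y}" using st0 by simp
  then have s: "s \<le> k" "st s < Suc y" using Max_in[OF fin] unfolding s_def by blast+
  have "Suc y < st (Suc s)" if "s < k"
  proof (rule ccontr)
    assume "\<not> Suc y < st (Suc s)"
    moreover have "st (Suc s) \<noteq> Suc y" using False T that by auto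
    ultimately have "Suc s \<in> {s. s \<le> k \<and> st s < Suc y}" using that by auto
    then show False using Max_ge[OF fin] unfolding s_def by fastforce
  qed
  then have "in_gap y (gap_tree st k s)" using s by (auto simp: in_gap_def gap_tree_def)
  then show ?thesis using s False by auto
qed

text \<open>The indices 1 to \<open>k\<close> contribute different elements since \<open>st\<close>
  increases strictly, and index 0 contributes none. This is how the weight condition on assignments
  is enforced.\<close>

lemma card_gap_set: "card T = k"
proof -
  have "st s \<noteq> 0" if "s \<in> {1..k}" for s using st_mono[of 0 s] that by auto
  then have pos: "Suc (st s - 1) = st s" if "s \<in> {1..k}" for s using that by simp
  have "T = (\<lambda>s. st s - 1) ` {1..k}"
  proof (intro equalityI subsetI)
    fix y assume "y \<in> T"
    then obtain s where s: "s \<le> k" "st s = Suc y" using T by blast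
    then have "s \<noteq> 0" using st0 by (cases s) auto
    then have "s \<in> {1..k}" using s(1) by simp
    moreover have "y = st s - 1" using s(2) by simp
    ultimately show "y \<in> (\<lambda>s. st s - 1) ` {1..k}" by blast
  next
    fix y assume "y \<in> (\<lambda>s. st s - 1) ` {1..k}"
    then obtain s where s: "s \<in> {1..k}" "y = st s - 1" by blast
    then have "s \<le> k" "st s = Suc y" using pos[of s] by simp_all
    then show "y \<in> T" using T by blast
  qed
  moreover have "inj_on (\<lambda>s. st s - 1) {1..k}"
  proof (rule linorder_inj_onI)
    fix s r assume "s < r" "s \<in> {1..k}" "r \<in> {1..k}"
    then show "st s - 1 \<noteq> st r - 1" using st_mono[of s r] st_mono[of 0 s] by auto
  qed auto
  ultimately show ?thesis by (simp add: card_image)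
qed

end

lemma set_gaps: "set (gaps z) = {Br (enc_nat s) (Br (enc_nat a) (enc_nat b)) | s a b.
    s \<le> num (right z) \<and> a \<le> num (left (left z)) \<and> b \<le> num (left (left z)) \<and> (a = 0 \<longleftrightarrow> s = 0) \<and>
    (b = 0 \<longleftrightarrow> s = num (right z)) \<and> (b \<noteq> 0 \<longrightarrow> a < b)}"
proof -
  have Lf: "enc_nat i = Lf \<longleftrightarrow> i = 0" for i by (cases i) auto
  have bex: "(\<exists>s \<in> set (nat_trees (Suc n)). P s) \<longleftrightarrow> (\<exists>i \<le> n. P (enc_nat i))" for n P
    by (auto simp: nat_trees_def less_Suc_eq_le simp del: upt_Suc)
  have "e \<in> set (gaps z) \<longleftrightarrow> (\<exists>s \<in> set (nat_trees (Suc (num (right z)))).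
      \<exists>a \<in> set (nat_trees (Suc (num (left (left z))))). \<exists>b \<in> set (nat_trees (Suc (num (left (left z))))).
      ((a = Lf \<longleftrightarrow> s = Lf) \<and> (b = Lf \<longleftrightarrow> s = enc_nat (num (right z))) \<and> (b \<noteq> Lf \<longrightarrow> num a < num b))
      \<and> e = Br s (Br a b))" for e
    unfolding gaps_def set_concat set_map UN_iff bex_simps by (intro bex_cong refl) auto
  then have "e \<in> set (gaps z) \<longleftrightarrow> (\<exists>s \<le> num (right z). \<exists>a \<le> num (left (left z)). \<exists>b \<le> num (left (left z)).
      ((a = 0 \<longleftrightarrow> s = 0) \<and> (b = 0 \<longleftrightarrow> s = num (right z)) \<and> (b \<noteq> 0 \<longrightarrow> a < b))
      \<and> e = Br (enc_nat s) (Br (enc_nat a) (enc_nat b)))" for e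
    unfolding bex Lf inj_eq[OF inj_enc_nat] length_elems_enc_nat by simp
  then show ?thesis by blast
qed

subsection \<open>Correctness\<close>

lemma tuple_cands_iff: "x \<in> set (tuple_cands d z) \<longleftrightarrow>
  (\<exists>us. x = Br (of_list (map left us)) (of_list us) \<and> length us = 2 ^ d \<and> set us \<subseteq> set (gaps z))"
  unfolding tuple_cands_def by (auto simp: set_tuples image_iff)

lemma slots_iff: "a \<in> set (slots d z) \<longleftrightarrow> a = Lf \<or>
  (\<exists>ss. a = of_list (map enc_nat ss) \<and> length ss = 2 ^ d \<and> set ss \<subseteq> {..num (right z)})"
proof -
  have "num a = 2 ^ d \<and> set (elems a) \<subseteq> enc_nat ` {..num (right z)} \<longleftrightarrow>
      (\<exists>ss. a = of_list (map enc_nat ss) \<and> length ss = 2 ^ d \<and> set ss \<subseteq> {..num (right z)})"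
  proof
    assume a: "num a = 2 ^ d \<and> set (elems a) \<subseteq> enc_nat ` {..num (right z)}"
    then have "elems a \<in> lists (enc_nat ` {..num (right z)})" by blast
    then obtain ss where "elems a = map enc_nat ss" "set ss \<subseteq> {..num (right z)}"
      unfolding lists_image by auto
    then show "\<exists>ss. a = of_list (map enc_nat ss) \<and> length ss = 2 ^ d \<and> set ss \<subseteq> {..num (right z)}"
      using a by (metis length_map of_list_elems)
  qed (auto dest: subsetD intro!: imageI)
  moreover have "set (nat_trees (Suc (num (right z)))) = enc_nat ` {..num (right z)}"
    by (simp add: nat_trees_def lessThan_Suc_atMost atLeast0LessThan del: upt_Suc)
  ultimately show ?thesis by (simp add: slots_def set_tuples)
qed

lemma consistency_clauses_iff: "w \<in> set (consistency_clauses d z) \<longleftrightarrow>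
  (\<exists>x \<in> set (tuple_cands d z). \<exists>y \<in> set (tuple_cands d z).
    (\<exists>e \<in> set (elems (right x)). \<exists>e' \<in> set (elems (right y)). conflict e e') \<and>
    w = of_list [of_list [x], of_list [y]])"
  unfolding consistency_clauses_def
  by (simp only: set_concat set_map set_filter UN_iff image_iff bex_simps mem_Collect_eq) blast

lemma formula_clauses_iff: "w \<in> set (formula_clauses d z) \<longleftrightarrow>
  (\<exists>u \<in> set (dnf d (circuit_formula d z)). \<exists>i \<in> set (dnf d (flip u)).
    w = of_list (of_list [Br Lf u] #
       map (\<lambda>j. of_list (filter (\<lambda>x. refutes d j x) (tuple_cands d z))) (dnf d (flip i))))"
  unfolding formula_clauses_def by (simp only: set_concat set_map UN_iff image_iff bex_simps)

lemma of_list_neq_Lf: "length xs = 2 ^ d \<Longrightarrow> of_list xs \<noteq> Lf"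
  by (cases xs) auto

text \<open>The converse of \<open>card_gap_set\<close>: the starts are read off the sorted list of
  \<open>T\<close>.\<close>

lemma sorted_wrt_enumerate:
  assumes "finite T" "card T = k"
  shows "\<exists>st :: nat \<Rightarrow> nat. st 0 = 0 \<and> (\<forall>s < k. st s < st (Suc s)) \<and> T = {y. \<exists>s \<le> k. st s = Suc y}"
proof -
  let ?l = "sorted_list_of_set T"
  define st where "st s = (if s = 0 then 0 else Suc (?l ! (s - 1)))" for s
  have len: "length ?l = k" using assms by simp
  have "st s < st (Suc s)" if "s < k" for s
    using that len sorted_wrt_nth_less[OF strict_sorted_list_of_set[of T], of "s - 1" s] by (auto simp: st_def)
  moreover have "T = {y. \<exists>s \<le> k. st s = Suc y}"
  proof (intro equalityI subsetI)
    fix y assume "y \<in> T"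
    then have "y \<in> set ?l" using assms(1) by simp
    then obtain i where "i < k" "?l ! i = y" using len by (metis in_set_conv_nth)
    then show "y \<in> {y. \<exists>s \<le> k. st s = Suc y}" by (intro CollectI exI[of _ "Suc i"]) (auto simp: st_def)
  next
    fix y assume "y \<in> {y. \<exists>s \<le> k. st s = Suc y}"
    then obtain s where s: "s \<le> k" "st s = Suc y" by blast
    then have "s \<noteq> 0" "y = ?l ! (s - 1)" by (auto simp: st_def split: if_splits)
    then have "y \<in> set ?l" using s(1) len by (metis One_nat_def Suc_le_lessD Suc_pred nth_mem not_gr_zero)
    then show "y \<in> T" using assms(1) by simp
  qed
  ultimately show ?thesis by (intro exI[of _ st]) (simp add: st_def[of 0])
qed

lemma left_gap_tree [simp]: "left (gap_tree st k s) = enc_nat s"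
  by (simp add: gap_tree_def)

lemma gap_tree_no_conflict:
  assumes "s \<le> k" "r \<le> k" shows "\<not> conflict (gap_tree st k s) (gap_tree st k r)"
proof -
  have "enc_nat r = Br Lf (enc_nat s) \<longleftrightarrow> r = Suc s"
    using inj_eq[OF inj_enc_nat, of r "Suc s"] by simp
  then show ?thesis
    using assms by (auto simp: conflict_def gap_tree_def inj_eq[OF inj_enc_nat])
qed

text \<open>Slot \<open>Lf\<close> chooses a true \<open>u\<close>, every other slot the actual gaps
  of \<open>T\<close>. These never conflict, and by soundness of certificates they refute no true
  \<open>j\<close>.\<close>

lemma selectable_if_formula:
  assumes w: "weft_le d 3 (circuit_formula d z)"
    and T: "T \<subseteq> {..<num (left (left z))}" "card T = num (right z)"
    and val: "formula_value T (circuit_formula d z)"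
  shows "selectable (set (slots d z)) (set (cands d z))
    (set (consistency_clauses d z @ formula_clauses d z))"
proof -
  let ?k = "num (right z)" and ?n = "num (left (left z))"
  have "finite T" using T(1) finite_subset by blast
  from sorted_wrt_enumerate[OF this T(2)] obtain st where
    st': "st 0 = 0 \<and> (\<forall>s < ?k. st s < st (Suc s)) \<and> T = {y. \<exists>s \<le> ?k. st s = Suc y}" ..
  then have st: "st 0 = 0" "\<And>s. s < ?k \<Longrightarrow> st s < st (Suc s)" "T = {y. \<exists>s \<le> ?k. st s = Suc y}"
    by simp_all
  let ?g = "gap_tree st ?k"
  have st_le: "st s \<le> ?n" if "s \<le> ?k" for s
  proof (cases "st s")
    case (Suc y)
    then have "y \<in> T" using st(3) that by blast
    then show ?thesis using T(1) Suc by auto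
  qed simp
  have g_in: "?g s \<in> set (gaps z)" if "s \<le> ?k" for s
  proof -
    have "st s = 0 \<longleftrightarrow> s = 0"
      using st(1) st_mono[where st = st and k = ?k and s = 0 and r = s, OF st(1,2,3)] that by (cases s) auto
    moreover have "s \<noteq> ?k \<Longrightarrow> st s < st (Suc s) \<and> st (Suc s) \<le> ?n"
      using st(2)[of s] st_le[of "Suc s"] that by auto
    ultimately show ?thesis
      unfolding set_gaps gap_tree_def using that st_le[OF that]
      by (intro CollectI exI[of _ s] exI[of _ "st s"] exI[of _ "if s = ?k then 0 else st (Suc s)"]) auto
  qed
  obtain u where u: "u \<in> set (dnf d (circuit_formula d z))"
    "\<And>i. i \<in> set (dnf d (flip u)) \<Longrightarrow>
      \<exists>j \<in> set (dnf d (flip i)). \<forall>l \<in> set (dnf d (flip j)). \<not> formula_value T l"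
    using val formula_value_weft3[OF w] by blast
  define p where "p a = (if a = Lf then Br Lf u else Br a (of_list (map (\<lambda>s. ?g (num s)) (elems a))))" for a
  have p_tuple: "p a \<in> set (tuple_cands d z) \<and> left (p a) = a \<and>
      (\<forall>e \<in> set (elems (right (p a))). \<exists>s \<le> ?k. e = ?g s)" if a: "a \<in> set (slots d z)" "a \<noteq> Lf" for a
  proof -
    obtain ss where ss: "a = of_list (map enc_nat ss)" "length ss = 2 ^ d" "set ss \<subseteq> {..?k}"
      using a slots_iff[of a] by blast
    have "p a = Br (of_list (map left (map ?g ss))) (of_list (map ?g ss))"
      using a(2) ss(1) by (simp add: p_def o_def)
    moreover have "set (map ?g ss) \<subseteq> set (gaps z)" using ss(3) g_in by auto
    ultimately have "p a \<in> set (tuple_cands d z)"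
      unfolding tuple_cands_iff using ss(2) by (intro exI[of _ "map ?g ss"]) simp
    moreover have "\<forall>e \<in> set (elems (right (p a))). \<exists>s \<le> ?k. e = ?g s"
      using a(2) ss by (auto simp: p_def)
    ultimately show ?thesis using a(2) by (simp add: p_def)
  qed
  have tuple_left: "left x \<noteq> Lf" if "x \<in> set (tuple_cands d z)" for x
    using that of_list_neq_Lf unfolding tuple_cands_iff by fastforce
  have p_Lf: "a \<noteq> Lf" if "p a \<in> set (tuple_cands d z)" for a
    using tuple_left[OF that] by (auto simp: p_def)
  have "p a \<in> set (cands d z) \<and> left (p a) = a" if "a \<in> set (slots d z)" for a
  proof (cases "a = Lf")
    case True
    then show ?thesis using u(1) by (simp add: p_def cands_def)
  next
    case False
    then show ?thesis using p_tuple[OF that] by (simp add: cands_def)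
  qed
  moreover have "\<exists>b \<in> set (elems w). \<forall>a \<in> set (slots d z). p a \<notin> set (elems b)"
    if wc: "w \<in> set (consistency_clauses d z)" for w
  proof -
    obtain x y e e' where xy: "x \<in> set (tuple_cands d z)" "y \<in> set (tuple_cands d z)"
      "e \<in> set (elems (right x))" "e' \<in> set (elems (right y))" "conflict e e'"
      "w = of_list [of_list [x], of_list [y]]"
      using wc unfolding consistency_clauses_iff by blast
    have "False" if a: "a \<in> set (slots d z)" "p a = x" "a' \<in> set (slots d z)" "p a' = y" for a a'
    proof -
      obtain s r where "s \<le> ?k" "e = ?g s" "r \<le> ?k" "e' = ?g r"
        using p_tuple[OF a(1)] p_tuple[OF a(3)] p_Lf[of a] p_Lf[of a'] a(2,4) xy(1-4) by blast
      then show False using gap_tree_no_conflict xy(5) by blast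
    qed
    then show ?thesis using xy(6) by fastforce
  qed
  moreover have "\<exists>b \<in> set (elems w). \<forall>a \<in> set (slots d z). p a \<notin> set (elems b)"
    if wc: "w \<in> set (formula_clauses d z)" for w
  proof -
    obtain u' i where i: "i \<in> set (dnf d (flip u'))"
      "w = of_list (of_list [Br Lf u'] #
        map (\<lambda>j. of_list (filter (\<lambda>x. refutes d j x) (tuple_cands d z))) (dnf d (flip i)))"
      using wc unfolding formula_clauses_iff by blast
    show ?thesis
    proof (cases "u' = u")
      case False
      then have "\<forall>a \<in> set (slots d z). p a \<notin> set (elems (of_list [Br Lf u']))"
        by (auto simp: p_def)
      then show ?thesis using i(2) by simp
    next
      case True
      then obtain j where j: "j \<in> set (dnf d (flip i))" "\<forall>l \<in> set (dnf d (flip j)). \<not> formula_value T l"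
        using u(2) i(1) by blast
      have "\<not> refutes d j (p a)" if a: "a \<in> set (slots d z)" "p a \<in> set (tuple_cands d z)" for a
      proof
        assume "refutes d j (p a)"
        then obtain l where l: "l \<in> set (dnf d (flip j))" "certified d (right (p a)) l"
          unfolding refutes_def by blast
        have "conj_weft_le d 0 l"
          using weft3_literals[OF w u(1) _ j(1) l(1)] i(1) True by blast
        moreover have "(gap_start e = 0 \<or> gap_start e - 1 \<in> T) \<and> (\<forall>y. in_gap y e \<longrightarrow> y \<notin> T)"
          if e: "e \<in> set (elems (right (p a)))" for e
        proof -
          obtain s where s: "s \<le> ?k" "e = ?g s"
            using p_tuple[OF a(1) p_Lf[OF a(2)]] e by blast
          show ?thesis unfolding s(2) by (rule gap_tree_sound[OF st s(1)])
        qed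
        ultimately have "formula_value T l" using certified_sound[OF _ _ l(2)] by blast
        then show False using j(2) l(1) by blast
      qed
      then have "\<forall>a \<in> set (slots d z). p a \<notin>
          set (elems (of_list (filter (\<lambda>x. refutes d j x) (tuple_cands d z))))" by auto
      then show ?thesis using i(2) j(1) by auto
    qed
  qed
  ultimately show ?thesis
    unfolding selectable_def set_append by (intro exI[of _ p] conjI ballI) (blast, blast, erule UnE, blast, blast)
qed

text \<open>The constant tuples determine a set \<open>T\<close>, and consistency with them forces
  every other slot to hold the gaps of \<open>T\<close> too. A true \<open>l\<close> would have a
  certificate, which is then the choice in its own slot and refutes \<open>j\<close>.\<close>

lemma formula_if_selectable:
  assumes w: "weft_le d 3 (circuit_formula d z)"
    and sel: "selectable (set (slots d z)) (set (cands d z))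
      (set (consistency_clauses d z @ formula_clauses d z))"
  shows "\<exists>T \<subseteq> {..<num (left (left z))}. card T = num (right z) \<and> formula_value T (circuit_formula d z)"
proof -
  let ?k = "num (right z)" and ?n = "num (left (left z))"
  obtain p where p: "\<And>a. a \<in> set (slots d z) \<Longrightarrow> p a \<in> set (cands d z) \<and> left (p a) = a"
    and cl: "\<And>w. w \<in> set (consistency_clauses d z) \<union> set (formula_clauses d z) \<Longrightarrow>
      \<exists>b \<in> set (elems w). \<forall>a \<in> set (slots d z). p a \<notin> set (elems b)"
    using sel unfolding selectable_def by auto
  have p_tuple: "\<exists>us. p a = Br (of_list (map left us)) (of_list us) \<and> length us = 2 ^ d \<and> set us \<subseteq> set (gaps z)"
    if a: "a \<in> set (slots d z)" "a \<noteq> Lf" for a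
  proof -
    have "p a \<in> set (tuple_cands d z)" using p[OF a(1)] a(2) unfolding cands_def by auto
    then show ?thesis unfolding tuple_cands_iff .
  qed
  have no_conflict: "\<not> conflict e e'"
    if a: "a \<in> set (slots d z)" "a \<noteq> Lf" "a' \<in> set (slots d z)" "a' \<noteq> Lf"
      and e: "e \<in> set (elems (right (p a)))" "e' \<in> set (elems (right (p a')))" for a a' e e'
  proof
    assume c: "conflict e e'"
    have "p a \<in> set (tuple_cands d z)" "p a' \<in> set (tuple_cands d z)"
      using p_tuple a unfolding tuple_cands_iff by blast+
    then have "of_list [of_list [p a], of_list [p a']] \<in> set (consistency_clauses d z)"
      unfolding consistency_clauses_iff using e c by blast
    then show False using cl a(1,3) by fastforce
  qed
  \<comment> \<open>The slot of the constant tuple \<open>(s, ..., s)\<close>; the first entry of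
    its candidate serves as the value of gap \<open>s\<close>.\<close>
  define rs where "rs s = of_list (replicate (2 ^ d) (enc_nat s))" for s
  have rs: "rs s \<in> set (slots d z)" "rs s \<noteq> Lf" if "s \<le> ?k" for s
    unfolding rs_def slots_iff using that of_list_neq_Lf[of _ d]
    by (auto intro!: disjI2 exI[of _ "replicate (2 ^ d) s"])
  define e where "e s = left (right (p (rs s)))" for s
  have e: "e s \<in> set (elems (right (p (rs s))))" "e s \<in> set (gaps z)" "left (e s) = enc_nat s" if s: "s \<le> ?k" for s
  proof -
    obtain us where us: "p (rs s) = Br (of_list (map left us)) (of_list us)" "length us = 2 ^ d"
        "set us \<subseteq> set (gaps z)"
      using p_tuple[OF rs[OF s]] by blast
    obtain e0 us' where c: "us = e0 # us'" using us(2) by (cases us) auto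
    have "of_list (map left us) = rs s" using p[OF rs(1)[OF s]] us(1) by simp
    then have "map left us = replicate (2 ^ d) (enc_nat s)" by (simp add: rs_def)
    then have "left e0 = enc_nat s" using c us(2) by (metis in_set_replicate list.set_intros(1) list.simps(9))
    then show "e s \<in> set (elems (right (p (rs s))))" "e s \<in> set (gaps z)" "left (e s) = enc_nat s"
      using us c by (auto simp: e_def)
  qed
  define st where "st s = gap_start (e s)" for s
  have e_gap: "\<exists>a b. e s = Br (enc_nat s) (Br (enc_nat a) (enc_nat b)) \<and> a \<le> ?n \<and> b \<le> ?n \<and>
      (a = 0 \<longleftrightarrow> s = 0) \<and> (b = 0 \<longleftrightarrow> s = ?k) \<and> (b \<noteq> 0 \<longrightarrow> a < b)" if s: "s \<le> ?k" for s
  proof -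
    obtain s' a b where sab: "e s = Br (enc_nat s') (Br (enc_nat a) (enc_nat b))" "a \<le> ?n" "b \<le> ?n"
      "a = 0 \<longleftrightarrow> s' = 0" "b = 0 \<longleftrightarrow> s' = ?k" "b \<noteq> 0 \<longrightarrow> a < b"
      using e(2)[OF s] unfolding set_gaps by blast
    moreover have "s' = s" using e(3)[OF s] sab(1) by (simp add: inj_eq[OF inj_enc_nat])
    ultimately show ?thesis by blast
  qed
  have next_gap: "right (right (e s)) = left (right (e (Suc s)))" if "s < ?k" for s
  proof -
    have s: "s \<le> ?k" "Suc s \<le> ?k" using that by auto
    have "\<not> conflict (e s) (e (Suc s))"
      by (rule no_conflict[OF rs[OF s(1)] rs[OF s(2)] e(1)[OF s(1)] e(1)[OF s(2)]])
    then show ?thesis using e(3)[OF s(1)] e(3)[OF s(2)] by (simp add: conflict_def)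
  qed
  \<comment> \<open>Since each end is the next start, the starts alone determine all gaps.\<close>
  have e_eq: "e s = gap_tree st ?k s" if s: "s \<le> ?k" for s
  proof -
    obtain a b where ab: "e s = Br (enc_nat s) (Br (enc_nat a) (enc_nat b))" "b = 0 \<longleftrightarrow> s = ?k"
      using e_gap[OF s] by blast
    have "s \<noteq> ?k \<Longrightarrow> st (Suc s) = b" using next_gap[of s] s ab(1) by (simp add: st_def flip: next_gap)
    then show ?thesis using ab by (auto simp: gap_tree_def st_def)
  qed
  have st0: "st 0 = 0" using e_gap[of 0] by (auto simp: st_def)
  have st_less: "st s < st (Suc s)" if "s < ?k" for s
  proof -
    obtain a b where "e s = Br (enc_nat s) (Br (enc_nat a) (enc_nat b))" "b = 0 \<longleftrightarrow> s = ?k" "b \<noteq> 0 \<longrightarrow> a < b"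
      using e_gap[of s] \<open>s < ?k\<close> by auto
    then show ?thesis using next_gap[OF that] that by (auto simp: st_def simp flip: next_gap)
  qed
  define T where "T = {y. \<exists>s \<le> ?k. st s = Suc y}"
  have "st s \<le> ?n" if "s \<le> ?k" for s using e_gap[OF that] by (auto simp: st_def)
  then have sub: "T \<subseteq> {..<?n}" unfolding T_def by (auto simp: Suc_le_eq) (metis Suc_le_eq)
  have card: "card T = ?k" by (rule card_gap_set[OF st0 st_less T_def])
  have Lf_slot: "Lf \<in> set (slots d z)" by (simp add: slots_def)
  have "p Lf \<in> set (cands d z)" "left (p Lf) = Lf" using p[OF Lf_slot] by auto
  then have "p Lf \<in> set (tuple_cands d z) \<or> (\<exists>u \<in> set (dnf d (circuit_formula d z)). p Lf = Br Lf u)"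
    unfolding cands_def by auto
  \<comment> \<open>A tuple candidate is marked by a nonempty tuple of gap numbers, so it cannot
    fill the slot \<open>Lf\<close>.\<close>
  moreover have "p Lf \<notin> set (tuple_cands d z)"
    using \<open>left (p Lf) = Lf\<close> of_list_neq_Lf[of _ d] unfolding tuple_cands_iff by fastforce
  ultimately obtain u where u: "u \<in> set (dnf d (circuit_formula d z))" "p Lf = Br Lf u" by blast
  have "\<exists>j \<in> set (dnf d (flip i)). \<forall>l \<in> set (dnf d (flip j)). \<not> formula_value T l"
    if i: "i \<in> set (dnf d (flip u))" for i
  proof -
    let ?w = "of_list (of_list [Br Lf u] #
       map (\<lambda>j. of_list (filter (\<lambda>x. refutes d j x) (tuple_cands d z))) (dnf d (flip i)))"
    have "?w \<in> set (formula_clauses d z)" unfolding formula_clauses_iff using u(1) i by blast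
    then obtain b where b: "b \<in> set (elems ?w)" "\<forall>a \<in> set (slots d z). p a \<notin> set (elems b)"
      using cl by blast
    have "b \<noteq> of_list [Br Lf u]" using b(2) Lf_slot u(2) by auto
    then obtain j where j: "j \<in> set (dnf d (flip i))"
      "b = of_list (filter (\<lambda>x. refutes d j x) (tuple_cands d z))" using b(1) by auto
    have "\<not> formula_value T l" if l: "l \<in> set (dnf d (flip j))" for l
    proof
      assume val: "formula_value T l"
      have lw: "conj_weft_le d 0 l" by (rule weft3_literals[OF w u(1) i j(1) l])
      have cover: "\<exists>e \<in> gap_tree st ?k ` {..?k}. if y \<in> T then gap_start e = Suc y else in_gap y e" for y
        using gap_tree_cover[OF st0 st_less T_def, of y] by blast
      obtain xs where xs: "length xs = 2 ^ d" "set xs \<subseteq> gap_tree st ?k ` {..?k}" "certified d (of_list xs) l"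
        using certified_complete[OF cover lw val] by blast
      let ?a = "of_list (map left xs)"
      have "xs \<in> lists (gap_tree st ?k ` {..?k})" using xs(2) by blast
      then obtain ss where ss: "xs = map (gap_tree st ?k) ss" "set ss \<subseteq> {..?k}"
        unfolding lists_image by auto
      have "?a = of_list (map enc_nat ss)" using ss(1) by (simp add: o_def)
      then have "?a \<in> set (slots d z)"
        unfolding slots_iff using xs(1) ss by (intro disjI2 exI[of _ ss]) simp
      moreover have "?a \<noteq> Lf" by (rule of_list_neq_Lf[of _ d]) (simp add: xs(1))
      ultimately have a: "?a \<in> set (slots d z)" "?a \<noteq> Lf" .
      obtain us where us: "p ?a = Br (of_list (map left us)) (of_list us)" "length us = 2 ^ d"
        using p_tuple[OF a] by blast
      have left_eq: "map left us = map left xs" using p[OF a(1)] us(1) by simp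
      \<comment> \<open>Each entry is compared with the constant tuple of its gap number: equal
        numbers without conflict have equal gaps.\<close>
      have "us ! m = xs ! m" if m: "m < 2 ^ d" for m
      proof -
        let ?s = "ss ! m"
        have "?s \<in> set ss" using ss(1) m xs(1) by simp
        then have s: "?s \<le> ?k" using ss(2) by blast
        have xm: "xs ! m = e ?s" using ss(1) m xs(1) e_eq[OF s] by simp
        have um: "us ! m \<in> set (elems (right (p ?a)))" using us m by simp
        have "left (us ! m) = left (xs ! m)" using left_eq m us(2) xs(1) by (metis nth_map)
        moreover have "\<not> conflict (us ! m) (e ?s)"
          by (rule no_conflict[OF a rs[OF s] um e(1)[OF s]])
        ultimately have "right (us ! m) = right (xs ! m)" unfolding conflict_def xm by blast
        moreover have "xs ! m \<noteq> Lf" using xm e_eq[OF s] by (simp add: gap_tree_def)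
        moreover have "us ! m \<noteq> Lf"
        proof
          assume "us ! m = Lf"
          then have "right (xs ! m) = Lf" using \<open>right (us ! m) = right (xs ! m)\<close> by simp
          then show False using xm e_eq[OF s] by (simp add: gap_tree_def)
        qed
        ultimately show ?thesis using \<open>left (us ! m) = left (xs ! m)\<close>
          by (metis left.simps(2) right.simps(2) tree.exhaust)
      qed
      then have "us = xs" using us(2) xs(1) by (simp add: list_eq_iff_nth_eq)
      then have "refutes d j (p ?a)" unfolding refutes_def using us(1) xs(3) l by auto
      moreover have "p ?a \<in> set (tuple_cands d z)" using p_tuple[OF a] unfolding tuple_cands_iff .
      ultimately show False using b(2) a(1) j(2) by auto
    qed
    then show ?thesis using j(1) by blast
  qed
  then have "formula_value T (circuit_formula d z)"
    using formula_value_weft3[OF w] u(1) by blast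
  then show ?thesis using sub card by blast
qed

section \<open>The constructed instance: vertices, weight, split property and equivalence\<close>

lemma card_slots: "card (set (slots d z)) = Suc (Suc (num (right z)) ^ 2 ^ d)"
proof -
  have "set (nat_trees (Suc (num (right z)))) = enc_nat ` {..num (right z)}"
    by (simp add: nat_trees_def lessThan_Suc_atMost atLeast0LessThan del: upt_Suc)
  then have "card (set (nat_trees (Suc (num (right z))))) = Suc (num (right z))"
    by (simp add: card_image inj_on_subset[OF inj_enc_nat])
  moreover have "Lf \<notin> set (tuples (2 ^ d) (nat_trees (Suc (num (right z)))))"
    by (simp add: set_tuples)
  ultimately show ?thesis by (simp add: slots_def card_tuples)
qed

lemma left_cands: assumes "x \<in> set (cands d z)" shows "left x \<in> set (slots d z)"
proof (cases "x \<in> set (tuple_cands d z)")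
  case True
  then obtain us where us: "x = Br (of_list (map left us)) (of_list us)" "length us = 2 ^ d"
    "set us \<subseteq> set (gaps z)" unfolding tuple_cands_iff by blast
  have "\<forall>u \<in> set us. \<exists>s \<le> num (right z). left u = enc_nat s"
    using us(3) unfolding set_gaps by fastforce
  then have "set (map left us) \<subseteq> enc_nat ` {..num (right z)}" by fastforce
  then have "map left us \<in> lists (enc_nat ` {..num (right z)})" by blast
  then obtain ss where ss: "map left us = map enc_nat ss" "set ss \<subseteq> {..num (right z)}"
    unfolding lists_image by auto
  have "length ss = 2 ^ d" using us(2) map_eq_imp_length_eq[OF ss(1)] by simp
  then show ?thesis unfolding slots_iff using us(1) ss by auto
next
  case False
  then show ?thesis using assms by (auto simp: cands_def slots_def)
qed

lemma set_graph_verts: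
  "set (graph_verts d z) = selection_verts (set (slots d z)) (set (cands d z)) (set (clauses d z))"
  by (simp add: graph_verts_def selection_verts_def Un_assoc)

lemma weight_graph_verts:
  "weight (verts (instance_of (graph_verts d z))) (lower (instance_of (graph_verts d z))) =
    new_param d (num (right z))"
proof -
  have slots: "{u \<in> set (graph_verts d z). left u = slot_tag} = Br slot_tag ` set (slots d z)"
    by (auto simp: set_graph_verts selection_verts_def)
  have "inj_on (Br slot_tag) (set (slots d z))" by (auto simp: inj_on_def)
  moreover have dist: "distinct (graph_verts d z)" by (simp add: graph_verts_def)
  ultimately show ?thesis
    unfolding weight_instance_of[OF dist] slots by (simp add: card_image card_slots new_param_def)
qed

lemma reduction_split:
  "(enc_berd (instance_of (graph_verts d z)), new_param d (num (right z))) \<in> BERD_split_instances"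
proof -
  have "split_graph (verts (instance_of (graph_verts d z))) (edges (instance_of (graph_verts d z)))"
  proof (rule split_instance_of)
    show "left u \<in> {slot_tag, cand_tag, disj_tag, clause_tag}" if "u \<in> set (graph_verts d z)" for u
      using that by (auto simp: set_graph_verts selection_verts_def)
  qed (simp add: graph_verts_def)
  then show ?thesis
    unfolding BERD_split_instances_def using wf_instance_of weight_graph_verts by fastforce
qed

lemma reduction_correct:
  "(enc_berd (instance_of (graph_verts d z)), new_param d (num (right z))) \<in> BERD \<longleftrightarrow>
    (left z, num (right z)) \<in> WCS 3 d"
proof -
  let ?L = "graph_verts d z" and ?A = "set (slots d z)" and ?X = "set (cands d z)"
  let ?J = "instance_of ?L" and ?c = "left z" and ?k = "num (right z)"
  have "(enc_berd ?J, new_param d ?k) \<in> BERD \<longleftrightarrow>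
      bounded_extension (verts ?J) (edges ?J) (lower ?J) (upper ?J)"
  proof
    assume "(enc_berd ?J, new_param d ?k) \<in> BERD"
    then obtain J where J: "enc_berd ?J = enc_berd J"
      "bounded_extension (verts J) (edges J) (lower J) (upper J)"
      unfolding BERD_def by blast
    then show "bounded_extension (verts ?J) (edges ?J) (lower ?J) (upper ?J)"
      using injD[OF inj_enc_berd J(1)] by simp
  next
    assume "bounded_extension (verts ?J) (edges ?J) (lower ?J) (upper ?J)"
    then show "(enc_berd ?J, new_param d ?k) \<in> BERD"
      unfolding BERD_def weight_graph_verts[symmetric] using wf_instance_of by blast
  qed
  also have "\<dots> \<longleftrightarrow> bounded_extension (set ?L) (arc_edges (set ?L)) lower_bound upper_bound"
    by (rule bounded_extension_instance_of) (simp add: graph_verts_def)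
  also have "\<dots> \<longleftrightarrow> selectable ?A ?X (set (clauses d z))"
    unfolding set_graph_verts
  proof (rule selectable_iff_bounded_extension)
    show "Lf \<in> ?A" by (simp add: slots_def)
    \<comment> \<open>The tuple of zeros is the second slot that keeps private neighbours out of the
      clique; it exists even for \<open>k = 0\<close>.\<close>
    show "of_list (map enc_nat (replicate (2 ^ d) 0)) \<in> ?A"
      unfolding slots_iff by (intro disjI2 exI[of _ "replicate (2 ^ d) 0"]) auto
    show "Lf \<noteq> of_list (map enc_nat (replicate (2 ^ d) 0))"
      by (rule not_sym, rule of_list_neq_Lf[of _ d]) simp
  qed (auto intro: left_cands)
  also have "\<dots> \<longleftrightarrow> (?c, ?k) \<in> WCS 3 d"
  proof (cases "is_circuit ?c \<and> depth_weft_le d 3 ?c (output_node ?c)")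
    case True
    then obtain C where C: "?c = enc_circuit C" "wf_circuit C" using is_circuit_iff by blast
    obtain n gs where ngs: "C = (n, gs)" by (cases C)
    have wf: "wf_circuit (n, gs)" and c: "?c = enc_circuit (n, gs)" using C ngs by auto
    have dw: "depth (n, gs) \<le> d" "weft (n, gs) \<le> 3"
      using True depth_weft_le_output[OF wf] c by auto
    have gs: "gs \<noteq> []" using wf by simp
    have w: "weft_le d 3 (circuit_formula d z)"
      unfolding circuit_formula_def c output_node_enc[OF wf]
      by (rule weft_le_unfolding[OF wf]) (use True c output_node_enc[OF wf] gs in auto)
    have "num (left ?c) = n" by (simp add: c enc_circuit_Pair)
    then have "selectable ?A ?X (set (clauses d z)) \<longleftrightarrow>
        (\<exists>T \<subseteq> {..<n}. card T = ?k \<and> formula_value T (circuit_formula d z))"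
      using True selectable_if_formula[OF w] formula_if_selectable[OF w] unfolding clauses_def by auto
    also have "\<dots> \<longleftrightarrow> weighted_sat (n, gs) ?k"
      unfolding weighted_sat_iff[OF wf dw(1)] circuit_formula_def c by blast
    also have "\<dots> \<longleftrightarrow> (?c, ?k) \<in> WCS 3 d"
      unfolding WCS_def c using wf dw by (auto dest: injD[OF inj_enc_circuit])
    finally show ?thesis .
  next
    case False
    then have "clauses d z = [Lf]" unfolding clauses_def by (rule if_not_P)
    then have "\<not> selectable ?A ?X (set (clauses d z))" by (simp add: selectable_def)
    moreover have "(?c, ?k) \<notin> WCS 3 d"
    proof
      assume "(?c, ?k) \<in> WCS 3 d"
      then obtain n gs where "?c = enc_circuit (n, gs)" "wf_circuit (n, gs)"
        "weft (n, gs) \<le> 3" "depth (n, gs) \<le> d"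
        unfolding WCS_def by auto
      then show False using False is_circuit_enc depth_weft_le_output by metis
    qed
    ultimately show ?thesis by blast
  qed
  finally show ?thesis .
qed

subsection \<open>Running time of the reduction\<close>

lemma polyl_comp: "polyl L \<Longrightarrow> polyf f \<Longrightarrow> polyl (\<lambda>x. L (f x))"
  unfolding polyl_def by (rule polyf_comp)

lemma polyl_tuples: "polyl L \<Longrightarrow> polyl (\<lambda>x. tuples m (L x))"
proof (induction m arbitrary: L)
  case 0
  then show ?case by (simp add: polyl_Cons polyl_Nil polyf_const)
next
  case (Suc m)
  show ?case
    unfolding tuples.simps
    by (intro polyl_concat_map polyl_map polyf_Br polyf_left polyf_right polyf_id Suc.IH Suc.prems
        polyl_comp[OF Suc.prems])
qed

lemma polyl_gaps: "polyl gaps"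
  unfolding gaps_def
  by (intro polyl_concat_map polyl_nat_trees polyl_if polyp_conj polyp_iff polyp_imp polyp_not polyp_eq
      polyp_less polyn_Suc polyn_num polyl_Cons polyl_Nil polyf_Br polyf_enc_nat polyf_left polyf_right
      polyf_const polyf_id)

lemma polyp_conflict: "polyf f \<Longrightarrow> polyf g \<Longrightarrow> polyp (\<lambda>x. conflict (f x) (g x))"
  unfolding conflict_def
  by (intro polyp_conj polyp_disj polyp_not polyp_eq polyf_Br polyf_left polyf_right polyf_const)

lemma polyl_tuple_cands: "polyl (tuple_cands d)"
  unfolding tuple_cands_def
  by (intro polyl_map polyl_tuples polyl_gaps polyf_Br polyf_of_list polyl_elems polyf_left polyf_right
      polyf_id)

lemma polyf_circuit_formula: "polyf (circuit_formula d)"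
  unfolding circuit_formula_def by (intro polyf_unfolding_of polyf_output_node polyf_left polyf_id)

lemma polyl_slots: "polyl (slots d)"
  unfolding slots_def
  by (intro polyl_Cons polyl_tuples polyl_nat_trees polyn_Suc polyn_num polyf_right polyf_const polyf_id)

lemma polyl_cands: "polyl (cands d)"
  unfolding cands_def
  by (intro polyl_append polyl_tuple_cands polyl_map polyl_dnf polyf_circuit_formula polyf_Br polyf_right
      polyf_const polyf_id)

lemma polyp_refutes: assumes "polyf f" "polyf g" shows "polyp (\<lambda>x. refutes d (f x) (g x))"
  unfolding refutes_def
  by (intro polyp_bex polyl_dnf polyf_flip polyp_certified polyf_right polyf_left polyf_id assms
      polyf_comp[OF assms(2)])

lemma polyl_consistency_clauses: "polyl (consistency_clauses d)"
  unfolding consistency_clauses_def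
  by (intro polyl_concat_map polyl_map polyl_filter polyp_bex polyp_conflict polyl_elems polyf_of_list
      polyl_Cons polyl_Nil polyl_tuple_cands polyl_comp[OF polyl_tuple_cands] polyf_left polyf_right polyf_id)

lemma polyl_formula_clauses: "polyl (formula_clauses d)"
  unfolding formula_clauses_def
  by (intro polyl_concat_map polyl_map polyl_filter polyp_refutes polyl_dnf polyf_of_list polyl_Cons
      polyl_Nil polyl_comp[OF polyl_tuple_cands] polyf_circuit_formula polyf_flip polyf_Br polyf_left
      polyf_right polyf_const polyf_id)

lemma polyl_clauses: "polyl (clauses d)"
  unfolding clauses_def
  by (intro polyl_if polyp_conj polyp_is_circuit polyp_depth_weft_le polyf_output_node polyl_append
      polyl_consistency_clauses polyl_formula_clauses polyl_Cons polyl_Nil polyf_left polyf_const polyf_id)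

lemma polyl_graph_verts: "polyl (graph_verts d)"
  unfolding graph_verts_def
  by (intro polyl_remdups polyl_append polyl_map polyl_concat_map polyl_elems polyl_slots polyl_cands
      polyl_clauses polyf_Br polyf_right polyf_const polyf_id)

lemma polyn_new_param: "polyn n \<Longrightarrow> polyn (\<lambda>x. new_param d (n x))"
  unfolding new_param_def by (intro polyn_mult polyn_Suc polyn_power polyn_const)

lemma polyf_reduction: "polyf (reduction d)"
  unfolding reduction_def
  by (intro polyf_Br polyf_instance_of polyl_graph_verts polyf_enc_nat polyn_new_param polyn_num
      polyf_right polyf_id)

subsection \<open>Composition of reductions\<close>

lemma computable_poly:
  assumes "computable f" "polyn (\<lambda>x. h (num x))" shows "computable (\<lambda>k. h (f k))"
proof -
  obtain p where p: "\<And>n. \<exists>t. exec p (enc_nat n) (enc_nat (f n)) t"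
    using assms(1) unfolding computable_def by blast
  obtain q U where q: "\<And>x. exec q x (enc_nat (h (num x))) (U x)"
    using assms(2) unfolding polyn_def polyf_def by blast
  have "\<exists>t. exec (Seq p q) (enc_nat n) (enc_nat (h (f n))) t" for n
    using p[of n] exec_Seq[OF _ q] by (metis length_elems_enc_nat)
  then show ?thesis unfolding computable_def by blast
qed

text \<open>The cost of the first run bounds the size of its output, unary parameter included. So
  the second stage costs a polynomial in \<open>f k * tsize x ^ c\<close>, which splits again into a
  function of \<open>k\<close> and a power of \<open>tsize x\<close>. Monotonicity of
  \<open>h\<close> carries the parameter bound over.\<close>

lemma fpt_reducible_poly_trans:
  assumes P: "fpt_reducible P Q" and R: "polyf R"
    and out: "\<And>x k. \<exists>x'. R (Br x (enc_nat k)) = Br x' (enc_nat (h k)) \<and>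
      ((x, k) \<in> Q \<longleftrightarrow> (x', h k) \<in> S) \<and> (x', h k) \<in> D"
    and h: "polyn (\<lambda>x. h (num x))" "mono h"
  shows "fpt_reducible_into D P S"
proof -
  obtain p f g c where pfg: "computable f \<and> computable g \<and>
      (\<forall>x k. \<exists>x' k' t. exec p (Br x (enc_nat k)) (Br x' (enc_nat k')) t \<and>
          t \<le> f k * tsize x ^ c \<and> k' \<le> g k \<and> ((x, k) \<in> P \<longleftrightarrow> (x', k') \<in> Q) \<and> (x', k') \<in> UNIV)"
    using P unfolding fpt_reducible_def fpt_reducible_into_def by (elim exE)
  have fg: "computable f" "computable g"
    using pfg[THEN conjunct1] pfg[THEN conjunct2, THEN conjunct1] .
  from pfg have p: "\<exists>x' k' t. exec p (Br x (enc_nat k)) (Br x' (enc_nat k')) t \<and>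
      t \<le> f k * tsize x ^ c \<and> k' \<le> g k \<and> ((x, k) \<in> P \<longleftrightarrow> (x', k') \<in> Q) \<and> (x', k') \<in> UNIV" for x k
    by (elim conjE allE)
  obtain q U where U: "poly_bounded U" and q: "\<And>x. exec q x (R x) (U x)"
    using R unfolding polyf_def by blast
  obtain C e where Ce: "\<And>x. U x \<le> C * tsize x ^ e" using U unfolding poly_bounded_def by blast
  let ?F = "\<lambda>m. Suc (m + C * m ^ e)"
  have "computable (\<lambda>k. ?F (f k))"
    by (rule computable_poly[OF fg(1), of ?F])
       (intro polyn_Suc polyn_add polyn_mult polyn_power polyn_const polyn_num polyf_id)
  moreover have "computable (\<lambda>k. h (g k))" by (rule computable_poly[OF fg(2) h(1)])
  moreover have "\<exists>x' k' t. exec (Seq p q) (Br x (enc_nat k)) (Br x' (enc_nat k')) t \<and>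
      t \<le> ?F (f k) * tsize x ^ (c + c * e) \<and> k' \<le> h (g k) \<and>
      ((x, k) \<in> P \<longleftrightarrow> (x', k') \<in> S) \<and> (x', k') \<in> D" for x k
  proof -
    obtain y m t where y: "exec p (Br x (enc_nat k)) (Br y (enc_nat m)) t"
      "t \<le> f k * tsize x ^ c" "m \<le> g k" "(x, k) \<in> P \<longleftrightarrow> (y, m) \<in> Q"
      using p by blast
    obtain x' where x': "R (Br y (enc_nat m)) = Br x' (enc_nat (h m))"
      "(y, m) \<in> Q \<longleftrightarrow> (x', h m) \<in> S" "(x', h m) \<in> D"
      using out by blast
    let ?z = "Br y (enc_nat m)"
    have ex: "exec (Seq p q) (Br x (enc_nat k)) (Br x' (enc_nat (h m))) (Suc (t + U ?z))"
      using exec_Seq[OF y(1) q] x'(1) by simp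
    have "U ?z \<le> C * tsize ?z ^ e" by (rule Ce)
    also have "\<dots> \<le> C * (f k * tsize x ^ c) ^ e"
      using exec_cost_ge_output[OF y(1)] y(2) by (intro mult_left_mono power_mono) auto
    also have "\<dots> = C * f k ^ e * tsize x ^ (c * e)"
      by (simp add: power_mult_distrib power_mult)
    also have "\<dots> \<le> C * f k ^ e * tsize x ^ (c + c * e)"
      by (intro mult_left_mono tsize_power_mono) auto
    finally have "U ?z \<le> C * f k ^ e * tsize x ^ (c + c * e)" .
    moreover have "f k * tsize x ^ c \<le> f k * tsize x ^ (c + c * e)"
      by (intro mult_left_mono tsize_power_mono) auto
    moreover have "1 \<le> tsize x ^ (c + c * e)" using tsize_pos[of x] by simp
    ultimately have "Suc (t + U ?z) \<le> ?F (f k) * tsize x ^ (c + c * e)"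
      using y(2) unfolding mult_Suc add_mult_distrib by linarith
    moreover have "h m \<le> h (g k)" using y(3) h(2) by (simp add: monoD)
    ultimately show ?thesis using ex y(4) x'(2,3) by blast
  qed
  ultimately show ?thesis unfolding fpt_reducible_into_def by blast
qed

text \<open>Each problem in \<open>W 3\<close> comes with its own depth \<open>d\<close>, and the
  reduction is built for that \<open>d\<close>; no uniformity in \<open>d\<close> is asked
  for.\<close>

lemma W_hard_on_BERD: "W_hard_on BERD_split_instances 3 BERD"
  unfolding W_hard_on_def
proof
  fix P assume "P \<in> W 3"
  then obtain d where d: "fpt_reducible P (WCS 3 d)" unfolding W_def by blast
  show "fpt_reducible_into BERD_split_instances P BERD"
  proof (rule fpt_reducible_poly_trans[OF d polyf_reduction[of d], where h = "new_param d"])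
    show "\<exists>x'. reduction d (Br x (enc_nat k)) = Br x' (enc_nat (new_param d k)) \<and>
        ((x, k) \<in> WCS 3 d \<longleftrightarrow> (x', new_param d k) \<in> BERD) \<and>
        (x', new_param d k) \<in> BERD_split_instances" for x k
      using reduction_correct[of d "Br x (enc_nat k)"] reduction_split[of d "Br x (enc_nat k)"]
      by (simp add: reduction_def)
    show "polyn (\<lambda>x. new_param d (num x))" by (intro polyn_new_param polyn_num polyf_id)
    show "mono (new_param d)" by (intro monoI) (simp add: new_param_def power_mono)
  qed
qed

lemma fpt_reducible_into_imp_fpt_reducible: "fpt_reducible_into D P Q \<Longrightarrow> fpt_reducible P Q"
  unfolding fpt_reducible_def fpt_reducible_into_def
  by (erule ex_forward all_forward conj_forward | assumption | rule UNIV_I)+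

theorem theorem12:
  shows "W_hard 3 BERD \<and> W_hard_on BERD_split_instances 3 BERD"
  using W_hard_on_BERD fpt_reducible_into_imp_fpt_reducible
  unfolding W_hard_def W_hard_on_def by blast

end
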